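(* Let $L:\mathbb{R}\times\mathbb{R}^n\times\mathbb{R}^n\times\mathbb{R}\to\mathbb{R}$ be of class $C^1$ and satisfy conditions (L1), (L2), (L3) listed in the context. Fix $x,y\in\mathbb{R}^n$, $b>a$ and $u\in\mathbb{R}$. Then the functional $$\mathcal{A}\ni\xi\mapsto J(\xi)=\int_a^bL(s,\xi(s),\dot\xi(s),u_\xi(s))\,ds,$$ where $u_\xi$ is determined by $\dot u_\xi(s)=L(s,\xi(s),\dot\xi(s),u_\xi(s))$ for a.e. $s\in[a,b]$ and $u_\xi(a)=u$, admits a minimizer over $\mathcal{A}$.
   Context: Write $L=L(t,x,v,r)$; $L_r$ denotes the partial derivative in the last (real) variable. A function $\theta:[0,+\infty)\to[0,+\infty)$ is superlinear if $\theta(r)/r\to+\infty$ as $r\to+\infty$. Conditions: (L1) $L(t,x,\cdot,r)$ is strictly convex for all $(t,x,r)$. (L2) There exist two superlinear functions $\overline\theta_0,\theta_0:[0,+\infty)\to[0,+\infty)$ and two $L^\infty_{\rm loc}$ functions $c_0,c_1:\mathbb{R}\to[0,+\infty)$ such that $\overline\theta_0(|v|)+c_1(t)\geqslant L(t,x,v,0)\geqslant\theta_0(|v|)-c_0(t)$ for all $(t,x,v)\in\mathbb{R}\times\mathbb{R}^n\times\mathbb{R}^n$. (L3) There exists an $L^\infty_{\rm loc}$ function $K:\mathbb{R}\to[0,+\infty)$ such that $|L_r(t,x,v,r)|\leqslant K(t)$ for all $(t,x,v,r)$. $\Gamma^{a,b}_{x,y}=\{\xi\in W^{1,1}([a,b],\mathbb{R}^n):\xi(a)=x,\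 \xi(b)=y\}$, and $\mathcal{A}=\mathcal{A}^{a,b,u}_{x,y}$ is the set of $\xi\in\Gamma^{a,b}_{x,y}$ for which the (Carathéodory) problem $\dot u_\xi(s)=L(s,\xi(s),\dot\xi(s),u_\xi(s))$ a.e. on $[a,b]$, $u_\xi(a)=u$, admits an absolutely continuous solution $u_\xi$ (which is then unique). Equivalently, $\mathcal{A}$ is the set of $\xi\in\Gamma^{a,b}_{x,y}$ such that $s\mapsto L(s,\xi(s),\dot\xi(s),r)$ is in $L^1([a,b])$ for some (equivalently every) $r\in\mathbb{R}$. *)

theory Defs
  imports "HOL-Analysis.Analysis"
begin

definition C1 :: "('a::real_normed_vector \<Rightarrow> 'b::real_normed_vector) \<Rightarrow> bool" where
  "C1 f \<longleftrightarrow> (\<exists>f' :: 'a \<Rightarrow> 'a \<Rightarrow>\<^sub>L 'b.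
     (\<forall>z. (f has_derivative blinfun_apply (f' z)) (at z)) \<and> continuous_on UNIV f')"

definition strictly_convex :: "('a::real_vector \<Rightarrow> real) \<Rightarrow> bool" where
  "strictly_convex f \<longleftrightarrow> (\<forall>v w \<alpha>. v \<noteq> w \<longrightarrow> 0 < \<alpha> \<longrightarrow> \<alpha> < 1 \<longrightarrow>
     f (\<alpha> *\<^sub>R v + (1 - \<alpha>) *\<^sub>R w) < \<alpha> * f v + (1 - \<alpha>) * f w)"

text \<open>Functions on $[0,+\infty)$ are represented by functions on the reals whose values at
  negative arguments are never used.\<close>

definition superlinear :: "(real \<Rightarrow> real) \<Rightarrow> bool" where
  "superlinear \<theta> \<longleftrightarrow> (\<forall>r\<ge>0. 0 \<le> \<theta> r) \<and> filterlim (\<lambda>r. \<theta> r / r) at_top at_top"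

definition Linf_loc :: "(real \<Rightarrow> real) \<Rightarrow> bool" where
  "Linf_loc c \<longleftrightarrow> c \<in> borel_measurable lebesgue \<and>
     (\<forall>S. compact S \<longrightarrow> (\<exists>M. AE t in lebesgue. t \<in> S \<longrightarrow> \<bar>c t\<bar> \<le> M))"

type_synonym 'n lagrangian = "real \<Rightarrow> real^'n \<Rightarrow> real^'n \<Rightarrow> real \<Rightarrow> real"

definition L1 :: "'n::finite lagrangian \<Rightarrow> bool" where
  "L1 L \<longleftrightarrow> (\<forall>t x r. strictly_convex (\<lambda>v. L t x v r))"

definition L2 :: "'n::finite lagrangian \<Rightarrow> bool" where
  "L2 L \<longleftrightarrow> (\<exists>\<theta>' \<theta>\<^sub>0 c\<^sub>0 c\<^sub>1. superlinear \<theta>' \<and> superlinear \<theta>\<^sub>0 \<and>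
     Linf_loc c\<^sub>0 \<and> (\<forall>t. 0 \<le> c\<^sub>0 t) \<and> Linf_loc c\<^sub>1 \<and> (\<forall>t. 0 \<le> c\<^sub>1 t) \<and>
     (\<forall>t x v. \<theta>' (norm v) + c\<^sub>1 t \<ge> L t x v 0 \<and> L t x v 0 \<ge> \<theta>\<^sub>0 (norm v) - c\<^sub>0 t))"

definition L3 :: "'n::finite lagrangian \<Rightarrow> bool" where
  "L3 L \<longleftrightarrow> (\<exists>K. Linf_loc K \<and> (\<forall>t. 0 \<le> K t) \<and>
     (\<forall>t x v r. \<bar>deriv (\<lambda>r. L t x v r) r\<bar> \<le> K t))"

text \<open>The classical notion: for every $\varepsilon$ there is a $\delta$ such that for every finite
  family of non-overlapping intervals $[c_i,d_i]$ in $S$ of total length less than $\delta$, the sum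
  of the $|f(d_i)-f(c_i)|$ is less than $\varepsilon$. (The library constant
  \<^const>\<open>absolutely_continuous\<close> is the unrelated notion for measures.)\<close>

definition absolutely_continuous_on :: "real set \<Rightarrow> (real \<Rightarrow> 'a::real_normed_vector) \<Rightarrow> bool" where
  "absolutely_continuous_on S f \<longleftrightarrow> (\<forall>\<epsilon>>0. \<exists>\<delta>>0. \<forall>D T. D division_of T \<and> T \<subseteq> S \<and>
     (\<Sum>I\<in>D. Sup I - Inf I) < \<delta> \<longrightarrow> (\<Sum>I\<in>D. norm (f (Sup I) - f (Inf I))) < \<epsilon>)"

text \<open>An element of $W^{1,1}([a,b],\mathbb{R}^n)$ is identified with its absolutely continuous
  representative, and its weak derivative with the derivative that this representative has almost
  everywhere. Curves are functions on the whole line of which only the restriction to $[a,b]$ is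
  relevant.\<close>

definition curves :: "real \<Rightarrow> real \<Rightarrow> real^'n \<Rightarrow> real^'n \<Rightarrow> (real \<Rightarrow> real^'n::finite) set" where
  "curves a b x y = {\<xi>. absolutely_continuous_on {a..b} \<xi> \<and> \<xi> a = x \<and> \<xi> b = y}"

definition velocity :: "real \<Rightarrow> real \<Rightarrow> (real \<Rightarrow> real^'n::finite) \<Rightarrow> real \<Rightarrow> real^'n" where
  "velocity a b \<xi> s = vector_derivative \<xi> (at s within {a..b})"

definition caratheodory_solution ::
  "'n::finite lagrangian \<Rightarrow> real \<Rightarrow> real \<Rightarrow> real \<Rightarrow> (real \<Rightarrow> real^'n) \<Rightarrow> (real \<Rightarrow> real) \<Rightarrow> bool" where
  "caratheodory_solution L a b u \<xi> w \<longleftrightarrow> absolutely_continuous_on {a..b} w \<and> w a = u \<and>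
     (AE s in lebesgue. s \<in> {a..b} \<longrightarrow>
        (w has_real_derivative L s (\<xi> s) (velocity a b \<xi> s) (w s)) (at s within {a..b}))"

definition admissible ::
  "'n::finite lagrangian \<Rightarrow> real \<Rightarrow> real \<Rightarrow> real \<Rightarrow> real^'n \<Rightarrow> real^'n \<Rightarrow> (real \<Rightarrow> real^'n) set" where
  "admissible L a b u x y = {\<xi> \<in> curves a b x y. \<exists>w. caratheodory_solution L a b u \<xi> w}"

text \<open>Under (L3) the solution is unique on $[a,b]$ and arbitrary outside; the choice operator
  only fixes these irrelevant outside values.\<close>

definition u_sol :: "'n::finite lagrangian \<Rightarrow> real \<Rightarrow> real \<Rightarrow> real \<Rightarrow> (real \<Rightarrow> real^'n) \<Rightarrow> real \<Rightarrow> real" where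
  "u_sol L a b u \<xi> = (SOME w. caratheodory_solution L a b u \<xi> w)"

definition J :: "'n::finite lagrangian \<Rightarrow> real \<Rightarrow> real \<Rightarrow> real \<Rightarrow> (real \<Rightarrow> real^'n) \<Rightarrow> real" where
  "J L a b u \<xi> = (LINT s:{a..b}|lebesgue. L s (\<xi> s) (velocity a b \<xi> s) (u_sol L a b u \<xi> s))"

end

theory Submission
  imports Defs "HOL-Complex_Analysis.Great_Picard"
begin

text \<open>
  The direct method. Writing $J(\xi) = u_\xi(b) - u$, take a minimizing sequence $\xi_k$ with states
  $u_k$. Gronwall-type estimates bound $u_k$ uniformly, and then the superlinear lower bound makes the
  velocities equi-integrable, so a subsequence of $\xi_k$ converges uniformly to an absolutely
  continuous $\xi$.

  The states $u_k$ need not converge, so the lower limit $z = \liminf u_k$ is used instead. Replacing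
  $L$ by $F = e^{K(t-a)}(L + K r)$, with $K$ a Lipschitz constant of $L$ in $r$, gives an integrand
  that is nondecreasing in $r$, and
  $F(t,\xi_k,\dot\xi_k,u_k) \ge F(t,\xi_k,p,q) + F_v(t,\xi_k,p,q) \cdot (\dot\xi_k - p) - \Lambda (q - u_k)^+$
  for all continuous test functions $p$ and $q$. All terms on the right pass to the limit, and letting
  $p \to \dot\xi$ on the sets where $\dot\xi$ is bounded and $q \to \inf_{k \ge m} u_k$ shows that $z$ is
  a supersolution of the integrated state equation along $\xi$. Comparison yields $u_\xi \le z$, so
  $u_\xi(b) \le \lim u_k(b)$ and $\xi$ is a minimizer.

  That an absolutely continuous function is the integral of its derivative is proved by writing it as a
  difference of increasing absolutely continuous functions through its variation, and applying the
  Radon--Nikodym theorem to their Stieltjes measures.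
\<close>

text \<open>L is convex in the velocity alone, and velocities converge only weakly, so nothing
  forces the states to converge. Monotonicity of F in r replaces that convergence: a tail infimum
  lies below every later state and can be substituted for it. The factor e^{K(t-a)} is the
  integrating factor of K r: along a solution w the derivative of e^{K(t-a)} w is F, so the integral
  of F over [a,t] equals e^{K(t-a)} w(t) - u. A bound for the weighted functional on [a,t] is
  therefore a statement about the state at time t. The indices at which u_k(t) comes near its lower
  limit depend on t. The semicontinuity theorem thus asks for its upper bound only at infinitely
  many indices, and no subsequence common to all t has to be extracted for the states. The a priori
  bounds are asymmetric. L has a lower bound uniform in the velocity but no such upper bound, so a
  state is bounded below through its initial value and above only through its terminal value, which
  a minimizing sequence controls.\<close>

lemmas HK_integrable_add = Henstock_Kurzweil_Integration.integrable_add
  and HK_integrable_diff = Henstock_Kurzweil_Integration.integrable_diff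
  and HK_integral_add = Henstock_Kurzweil_Integration.integral_add
  and HK_integral_diff = Henstock_Kurzweil_Integration.integral_diff
  and HK_integral_combine = Henstock_Kurzweil_Integration.integral_combine

subsection \<open>Absolutely continuous functions and their variation\<close>

lemma continuous_on_Icc_bounded:
  fixes f :: "real \<Rightarrow> 'a::real_normed_vector"
  assumes "continuous_on {a..b} f"
  obtains B where "\<And>t. t \<in> {a..b} \<Longrightarrow> norm (f t) \<le> B"
  using compact_imp_bounded[OF compact_continuous_image[OF assms]] unfolding bounded_iff
  by (metis compact_Icc imageI)

lemma division_of_real_interval:
  fixes D :: "real set set"
  assumes "D division_of T" "I \<in> D"
  shows "I = {Inf I..Sup I}" "Inf I \<le> Sup I" "Inf I \<in> T" "Sup I \<in> T" "measure lborel I = Sup I - Inf I"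
proof -
  obtain c d where cd: "I = cbox c d" and ne: "I \<noteq> {}" and sub: "I \<subseteq> T"
    using division_ofD(2,3,4)[OF assms(1)] assms(2) by metis
  then have "c \<le> d" "I = {c..d}" by auto
  then show "I = {Inf I..Sup I}" "Inf I \<le> Sup I" "Inf I \<in> T" "Sup I \<in> T" "measure lborel I = Sup I - Inf I"
    using sub by auto
qed

text \<open>A single epsilon-delta argument for all closure properties below: linear images, sums,
  the product of a solution with the exponential weight, affine curves. Two dominating functions
  cover sums, and the term \<open>C * (t - s)\<close> covers Lipschitz contributions.\<close>

lemma AC_dominated:
  fixes f :: "real \<Rightarrow> 'a::real_normed_vector" and g :: "real \<Rightarrow> 'b::real_normed_vector"
    and h :: "real \<Rightarrow> 'c::real_normed_vector"
  assumes f: "absolutely_continuous_on S f" and g: "absolutely_continuous_on S g"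
    and h: "\<And>s t. s \<in> S \<Longrightarrow> t \<in> S \<Longrightarrow> s \<le> t \<Longrightarrow>
      norm (h t - h s) \<le> C * norm (f t - f s) + C * norm (g t - g s) + C * (t - s)"
  shows "absolutely_continuous_on S h"
  unfolding absolutely_continuous_on_def
proof (intro allI impI)
  fix e :: real assume "e > 0"
  define B where "B = \<bar>C\<bar> + 1"
  have B: "B > 0" "C \<le> B" by (auto simp: B_def)
  have e: "e / (3 * B) > 0" using \<open>e > 0\<close> B by simp
  obtain d1 where d1: "d1 > 0" "\<And>D T. D division_of T \<Longrightarrow> T \<subseteq> S \<Longrightarrow>
     (\<Sum>I\<in>D. Sup I - Inf I) < d1 \<Longrightarrow> (\<Sum>I\<in>D. norm (f (Sup I) - f (Inf I))) < e / (3 * B)"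
    using f e unfolding absolutely_continuous_on_def by meson
  obtain d2 where d2: "d2 > 0" "\<And>D T. D division_of T \<Longrightarrow> T \<subseteq> S \<Longrightarrow>
     (\<Sum>I\<in>D. Sup I - Inf I) < d2 \<Longrightarrow> (\<Sum>I\<in>D. norm (g (Sup I) - g (Inf I))) < e / (3 * B)"
    using g e unfolding absolutely_continuous_on_def by meson
  show "\<exists>\<delta>>0. \<forall>D T. D division_of T \<and> T \<subseteq> S \<and> (\<Sum>I\<in>D. Sup I - Inf I) < \<delta> \<longrightarrow>
       (\<Sum>I\<in>D. norm (h (Sup I) - h (Inf I))) < e"
  proof (intro exI[of _ "min (min d1 d2) (e / (3 * B))"] conjI allI impI)
    show "0 < min (min d1 d2) (e / (3 * B))" using d1 d2 e by auto
    fix D T assume *: "D division_of T \<and> T \<subseteq> S \<and> (\<Sum>I\<in>D. Sup I - Inf I) < min (min d1 d2) (e / (3 * B))"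
    have "(\<Sum>I\<in>D. norm (h (Sup I) - h (Inf I))) \<le>
        (\<Sum>I\<in>D. B * norm (f (Sup I) - f (Inf I)) + B * norm (g (Sup I) - g (Inf I)) + B * (Sup I - Inf I))"
    proof (rule sum_mono)
      fix I assume "I \<in> D"
      then have I: "Inf I \<le> Sup I" "Inf I \<in> S" "Sup I \<in> S"
        using division_of_real_interval(2,3,4)[of D T I] * by auto
      have "C * norm (f (Sup I) - f (Inf I)) \<le> B * norm (f (Sup I) - f (Inf I))"
        "C * norm (g (Sup I) - g (Inf I)) \<le> B * norm (g (Sup I) - g (Inf I))"
        "C * (Sup I - Inf I) \<le> B * (Sup I - Inf I)"
        using B I by (auto intro!: mult_right_mono)
      with h[OF I(2,3,1)] show "norm (h (Sup I) - h (Inf I)) \<le>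
        B * norm (f (Sup I) - f (Inf I)) + B * norm (g (Sup I) - g (Inf I)) + B * (Sup I - Inf I)"
        by linarith
    qed
    also have "\<dots> = B * (\<Sum>I\<in>D. norm (f (Sup I) - f (Inf I))) + B * (\<Sum>I\<in>D. norm (g (Sup I) - g (Inf I)))
        + B * (\<Sum>I\<in>D. Sup I - Inf I)"
      by (simp add: sum.distrib sum_distrib_left)
    also have "\<dots> < B * (e / (3 * B)) + B * (e / (3 * B)) + B * (e / (3 * B))"
      using d1(2)[of D T] d2(2)[of D T] * B by (intro add_strict_mono mult_strict_left_mono) auto
    also have "\<dots> = e" using B by (simp add: field_simps)
    finally show "(\<Sum>I\<in>D. norm (h (Sup I) - h (Inf I))) < e" .
  qed
qed

lemma AC_id: "absolutely_continuous_on S (\<lambda>t::real. t)"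
  unfolding absolutely_continuous_on_def
proof (intro allI impI)
  fix e :: real assume "e > 0"
  have "(\<Sum>I\<in>D. norm (Sup I - Inf I)) = (\<Sum>I\<in>D. Sup I - Inf I)"
    if "D division_of T" for D :: "real set set" and T
    by (intro sum.cong refl) (use division_of_real_interval(2)[OF that] in auto)
  then show "\<exists>\<delta>>0. \<forall>D T. D division_of T \<and> T \<subseteq> S \<and> (\<Sum>I\<in>D. Sup I - Inf I) < \<delta> \<longrightarrow>
       (\<Sum>I\<in>D. norm (Sup I - Inf I)) < e"
    using \<open>e > 0\<close> by (metis )
qed

lemma AC_linear:
  assumes "bounded_linear h" "absolutely_continuous_on S f"
  shows "absolutely_continuous_on S (\<lambda>t. h (f t))"
proof -
  obtain K where K: "\<And>x. norm (h x) \<le> norm x * K" "K > 0"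
    using bounded_linear.pos_bounded[OF assms(1)] by blast
  show ?thesis
  proof (rule AC_dominated[OF assms(2,2), where C = K])
    fix s t :: real assume "s \<le> t"
    then have "0 \<le> K * norm (f t - f s) + K * (t - s)" using K by simp
    then show "norm (h (f t) - h (f s)) \<le> K * norm (f t - f s) + K * norm (f t - f s) + K * (t - s)"
      using K(1)[of "f t - f s"] by (simp add: linear_diff[OF bounded_linear.linear[OF assms(1)]] mult.commute)
  qed
qed

lemma AC_uniform_modulus:
  assumes "absolutely_continuous_on {a..b} f" "e > 0"
  obtains d where "d > 0" "\<And>s t. a \<le> s \<Longrightarrow> s \<le> t \<Longrightarrow> t \<le> b \<Longrightarrow> t - s < d \<Longrightarrow> norm (f t - f s) < e"
proof -
  obtain d where d: "d > 0" "\<And>D T. D division_of T \<Longrightarrow> T \<subseteq> {a..b} \<Longrightarrow>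
     (\<Sum>I\<in>D. Sup I - Inf I) < d \<Longrightarrow> (\<Sum>I\<in>D. norm (f (Sup I) - f (Inf I))) < e"
    using assms unfolding absolutely_continuous_on_def by meson
  show thesis
  proof (rule that[OF d(1)])
    fix s t assume st: "a \<le> s" "s \<le> t" "t \<le> b" "t - s < d"
    have "{cbox s t} division_of cbox s t" using st by (intro division_of_self) auto
    from d(2)[OF this] show "norm (f t - f s) < e" using st by auto
  qed
qed

lemma AC_imp_continuous_on:
  assumes "absolutely_continuous_on {a..b} f"
  shows "continuous_on {a..b} f"
  unfolding continuous_on_iff
proof (intro ballI allI impI)
  fix x and e :: real assume x: "x \<in> {a..b}" and "e > 0"
  obtain d where d: "d > 0" "\<And>s t. a \<le> s \<Longrightarrow> s \<le> t \<Longrightarrow> t \<le> b \<Longrightarrow> t - s < d \<Longrightarrow> norm (f t - f s) < e"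
    using AC_uniform_modulus[OF assms \<open>e > 0\<close>] by metis
  show "\<exists>d>0. \<forall>x'\<in>{a..b}. dist x' x < d \<longrightarrow> dist (f x') (f x) < e"
  proof (intro exI[of _ d] conjI ballI impI)
    fix x' assume "x' \<in> {a..b}" "dist x' x < d"
    then show "dist (f x') (f x) < e"
      using d(2)[of x x'] d(2)[of x' x] x by (cases "x \<le> x'") (auto simp: dist_norm norm_minus_commute)
  qed (use d in auto)
qed

definition variation_sum :: "(real \<Rightarrow> 'a::real_normed_vector) \<Rightarrow> real set set \<Rightarrow> real" where
  "variation_sum f D = (\<Sum>I\<in>D. norm (f (Sup I) - f (Inf I)))"

text \<open>The supremum runs over families covering any part of the interval, as in
  \<open>absolutely_continuous_on\<close>, and not only over full partitions. A family inside a
  subinterval then competes without being completed, and the empty family makes the set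
  nonempty.\<close>

definition variation :: "(real \<Rightarrow> 'a::real_normed_vector) \<Rightarrow> real \<Rightarrow> real \<Rightarrow> real" where
  "variation f s t = Sup {variation_sum f D | D T. D division_of T \<and> T \<subseteq> {s..t}}"

text \<open>Two different members of \<open>D\<close> can have the same trace on
  \<open>{c..d}\<close> only if that trace has empty interior, hence is a single point, and then it
  contributes 0. This is what allows the sum to be reindexed by \<open>D\<close>.\<close>

lemma division_restrict_interval:
  fixes D :: "real set set"
  assumes "D division_of T" "c \<le> d"
  defines "E \<equiv> {I \<inter> {c..d} | I. I \<in> D \<and> I \<inter> {c..d} \<noteq> {}}"
  shows "E division_of T \<inter> {c..d}"
    and "variation_sum f E = (\<Sum>I\<in>D. if I \<inter> {c..d} = {} then 0
       else norm (f (Sup (I \<inter> {c..d})) - f (Inf (I \<inter> {c..d}))))"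
proof -
  have E: "E = {k1 \<inter> k2 | k1 k2. k1 \<in> D \<and> k2 \<in> {{c..d}} \<and> k1 \<inter> k2 \<noteq> {}}"
    by (auto simp: E_def)
  have "{cbox c d} division_of cbox c d" using assms(2) by (intro division_of_self) auto
  then show "E division_of T \<inter> {c..d}"
    unfolding E using division_inter[OF assms(1), of "{{c..d}}" "{c..d}"] by (simp add: cbox_interval)
  have fin: "finite D" using assms(1) by auto
  define D' where "D' = {I \<in> D. I \<inter> {c..d} \<noteq> {}}"
  have ED': "E = (\<lambda>I. I \<inter> {c..d}) ` D'" by (auto simp: E_def D'_def)
  let ?v = "\<lambda>I. norm (f (Sup I) - f (Inf I))"
  have "sum ?v E = sum (?v \<circ> (\<lambda>I. I \<inter> {c..d})) D'"
    unfolding ED'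
  proof (rule sum.reindex_nontrivial)
    show "finite D'" using fin by (simp add: D'_def)
    fix I J assume IJ: "I \<in> D'" "J \<in> D'" "I \<noteq> J" "I \<inter> {c..d} = J \<inter> {c..d}"
    have "interior (I \<inter> {c..d}) \<subseteq> interior I \<inter> interior J"
      using IJ(4) interior_mono[of "I \<inter> {c..d}" I] interior_mono[of "I \<inter> {c..d}" J] by blast
    also have "\<dots> = {}" using division_ofD(5)[OF assms(1)] IJ by (auto simp: D'_def)
    finally have int: "interior (I \<inter> {c..d}) = {}" by auto
    obtain p q where "I = {p..q}" using division_of_real_interval(1)[OF assms(1), of I] IJ by (auto simp: D'_def)
    then have I: "I \<inter> {c..d} = {max p c..min q d}" by auto
    moreover have "I \<inter> {c..d} \<noteq> {}" using IJ by (auto simp: D'_def)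
    ultimately have "max p c = min q d" using int by (auto simp: interior_atLeastAtMost_real greaterThanLessThan_empty_iff)
    then show "?v (I \<inter> {c..d}) = 0" unfolding I by simp
  qed
  also have "\<dots> = (\<Sum>I\<in>D. if I \<inter> {c..d} = {} then 0 else ?v (I \<inter> {c..d}))"
    unfolding D'_def by (subst sum.inter_filter[OF fin]) (auto intro!: sum.cong)
  finally show "variation_sum f E = (\<Sum>I\<in>D. if I \<inter> {c..d} = {} then 0
       else norm (f (Sup (I \<inter> {c..d})) - f (Inf (I \<inter> {c..d}))))"
    unfolding variation_sum_def .
qed

text \<open>Every interval is cut at \<open>m\<close>; the triangle inequality handles one that
  contains \<open>m\<close>.\<close>

lemma division_split_at:
  fixes D :: "real set set"
  assumes D: "D division_of T" "T \<subseteq> {s..t}" and m: "s \<le> m" "m \<le> t"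
  obtains D1 T1 D2 T2 where "D1 division_of T1" "T1 \<subseteq> {s..m}" "D2 division_of T2" "T2 \<subseteq> {m..t}"
    "variation_sum f D \<le> variation_sum f D1 + variation_sum f D2"
proof -
  note r1 = division_restrict_interval[OF D(1) m(1)]
  note r2 = division_restrict_interval[OF D(1) m(2)]
  have "variation_sum f D \<le> (\<Sum>I\<in>D. (if I \<inter> {s..m} = {} then 0
       else norm (f (Sup (I \<inter> {s..m})) - f (Inf (I \<inter> {s..m}))))
    + (if I \<inter> {m..t} = {} then 0 else norm (f (Sup (I \<inter> {m..t})) - f (Inf (I \<inter> {m..t})))))"
    unfolding variation_sum_def
  proof (rule sum_mono)
    fix I assume "I \<in> D"
    then obtain p q where I: "I = {p..q}" "p \<le> q" "s \<le> p" "q \<le> t"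
      using division_of_real_interval[OF D(1), of I] D(2) by (metis atLeastAtMost_iff subsetD)
    have i: "I \<inter> {s..m} = {p..min q m}" "I \<inter> {m..t} = {max p m..q}" using I by auto
    consider "q < m" | "m < p" | "p \<le> m" "m \<le> q" by linarith
    then show "norm (f (Sup I) - f (Inf I)) \<le> (if I \<inter> {s..m} = {} then 0
       else norm (f (Sup (I \<inter> {s..m})) - f (Inf (I \<inter> {s..m}))))
    + (if I \<inter> {m..t} = {} then 0 else norm (f (Sup (I \<inter> {m..t})) - f (Inf (I \<inter> {m..t}))))"
      unfolding i unfolding I(1)
    proof cases
      case 3
      then show "norm (f (Sup {p..q}) - f (Inf {p..q})) \<le> (if {p..min q m} = {} then 0
         else norm (f (Sup {p..min q m}) - f (Inf {p..min q m})))
        + (if {max p m..q} = {} then 0 else norm (f (Sup {max p m..q}) - f (Inf {max p m..q})))"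
        using I(2) norm_triangle_ineq[of "f q - f m" "f m - f p"] by (simp add: min_def max_def algebra_simps)
    qed (use I(2) in \<open>auto simp: min_def max_def\<close>)
  qed
  also have "\<dots> = variation_sum f {I \<inter> {s..m} | I. I \<in> D \<and> I \<inter> {s..m} \<noteq> {}}
    + variation_sum f {I \<inter> {m..t} | I. I \<in> D \<and> I \<inter> {m..t} \<noteq> {}}"
    unfolding r1(2) r2(2) by (simp add: sum.distrib)
  finally show thesis using that[OF r1(1) _ r2(1)] by blast
qed

lemma sum_lengths_le:
  fixes D :: "real set set"
  assumes "D division_of T" "T \<subseteq> {s..t}" "s \<le> t"
  shows "(\<Sum>I\<in>D. Sup I - Inf I) \<le> t - s"
proof -
  have "(\<Sum>I\<in>D. Sup I - Inf I) = sum (measure lborel) D"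
    by (intro sum.cong refl) (use division_of_real_interval(5)[OF assms(1)] in auto)
  also have "\<dots> \<le> measure lborel (cbox s t)"
    using assms by (intro subadditive_content_division) (auto simp: cbox_interval)
  finally show ?thesis using assms by simp
qed

text \<open>Take the delta belonging to epsilon = 1 and cut the interval into finitely many pieces
  shorter than that; each piece contributes less than 1, so the number of pieces is a bound.\<close>

lemma variation_sum_bounded:
  assumes f: "absolutely_continuous_on {a..b} f"
  obtains B where "\<And>D T. D division_of T \<Longrightarrow> T \<subseteq> {a..b} \<Longrightarrow> variation_sum f D \<le> B"
proof -
  obtain d where d: "d > 0" "\<And>D T. D division_of T \<Longrightarrow> T \<subseteq> {a..b} \<Longrightarrow>
     (\<Sum>I\<in>D. Sup I - Inf I) < d \<Longrightarrow> variation_sum f D < 1"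
    using f unfolding absolutely_continuous_on_def variation_sum_def by (meson zero_less_one)
  have *: "variation_sum f D \<le> real n"
    if "D division_of T" "T \<subseteq> {s..b}" "a \<le> s" "b - s \<le> real n * (d / 2)" "s \<le> b" for n s D T
    using that
  proof (induction n arbitrary: s D T)
    case 0
    then have "s = b" by simp
    have "I = {b}" if "I \<in> D" for I
    proof -
      have "I \<subseteq> {b}" "I \<noteq> {}" using division_ofD(2,3)[OF 0(1) that] 0(2) \<open>s = b\<close> by auto
      then show ?thesis by auto
    qed
    then have "variation_sum f D = 0"
      unfolding variation_sum_def by (intro sum.neutral ballI) (metis cSup_singleton cInf_singleton diff_self norm_zero)
    then show ?case by simp
  next
    case (Suc n)
    \<comment> \<open>Steps of length d / 2 keep the total length of a piece strictly below
      \<open>d\<close>, and the minimum with \<open>b\<close> ends the last step at the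
      endpoint.\<close>
    define m where "m = min b (s + d / 2)"
    have m: "s \<le> m" "m \<le> b" using Suc.prems d(1) by (auto simp: m_def)
    obtain D1 T1 D2 T2 where D: "D1 division_of T1" "T1 \<subseteq> {s..m}" "D2 division_of T2" "T2 \<subseteq> {m..b}"
      "variation_sum f D \<le> variation_sum f D1 + variation_sum f D2"
      using division_split_at[OF Suc.prems(1,2) m] by metis
    have "variation_sum f D2 \<le> real n"
    proof (rule Suc.IH[OF D(3,4)])
      show "b - m \<le> real n * (d / 2)"
        using Suc.prems(4) d(1) by (cases "m = b") (auto simp: m_def min_def algebra_simps split: if_splits)
    qed (use m Suc.prems in auto)
    moreover have "variation_sum f D1 < 1"
    proof (rule d(2)[OF D(1)])
      show "(\<Sum>I\<in>D1. Sup I - Inf I) < d"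
        using sum_lengths_le[OF D(1,2) m(1)] d(1) by (auto simp: m_def)
    qed (use D(2) m Suc.prems in auto)
    ultimately show ?case using D(5) by simp
  qed
  show thesis
  proof (cases "a \<le> b")
    case True
    obtain n where n: "b - a \<le> real n * (d / 2)"
      using reals_Archimedean3[of "d / 2"] d(1) by (metis half_gt_zero less_imp_le)
    show thesis by (rule that[of "real n"]) (rule *[OF _ _ order_refl n True])
  next
    case False
    show thesis
      by (rule that[of 0]) (use False in \<open>auto simp: variation_sum_def\<close>)
  qed
qed

lemma variation_upper:
  assumes "absolutely_continuous_on {a..b} f" "D division_of T" "T \<subseteq> {s..t}" "a \<le> s" "t \<le> b"
  shows "variation_sum f D \<le> variation f s t"
proof -
  obtain B where B: "\<And>D T. D division_of T \<Longrightarrow> T \<subseteq> {a..b} \<Longrightarrow> variation_sum f D \<le> B"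
    using variation_sum_bounded[OF assms(1)] by metis
  have "{s..t} \<subseteq> {a..b}" using assms by auto
  then show ?thesis
    unfolding variation_def using assms(2,3) B
    by (intro cSup_upper bdd_aboveI[of _ B]) (blast intro: subset_trans)+
qed

lemma variation_least:
  assumes "\<And>D T. D division_of T \<Longrightarrow> T \<subseteq> {s..t} \<Longrightarrow> variation_sum f D \<le> B"
  shows "variation f s t \<le> B"
  unfolding variation_def
proof (rule cSup_least)
  have "{} division_of ({}::real set)" "({}::real set) \<subseteq> {s..t}" by auto
  then show "{variation_sum f D |D T. D division_of T \<and> T \<subseteq> {s..t}} \<noteq> {}" by blast
qed (use assms in blast)

lemma variation_subadditive:
  assumes f: "absolutely_continuous_on {a..b} f" and "a \<le> s" "s \<le> m" "m \<le> t" "t \<le> b"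
  shows "variation f s t \<le> variation f s m + variation f m t"
proof (rule variation_least)
  fix D T assume D: "D division_of T" "T \<subseteq> {s..t}"
  obtain D1 T1 D2 T2 where E: "D1 division_of T1" "T1 \<subseteq> {s..m}" "D2 division_of T2" "T2 \<subseteq> {m..t}"
    "variation_sum f D \<le> variation_sum f D1 + variation_sum f D2"
    using division_split_at[OF D assms(3,4)] by metis
  show "variation_sum f D \<le> variation f s m + variation f m t"
    using variation_upper[OF f E(1,2)] variation_upper[OF f E(3,4)] E(5) assms by auto
qed

text \<open>The interval from s to t is appended to a family inside \<open>{a..s}\<close>. When s <
  t it cannot already belong to that family, so its term really is added. The inequality shows that
  both the variation and the variation minus a real \<open>f\<close> are nondecreasing.\<close>

lemma variation_increment:
  assumes f: "absolutely_continuous_on {a..b} f" and "a \<le> s" "s \<le> t" "t \<le> b"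
  shows "variation f a s + norm (f t - f s) \<le> variation f a t"
proof (cases "s = t")
  case False
  then have "s < t" using assms by simp
  have "variation f a s \<le> variation f a t - norm (f t - f s)"
  proof (rule variation_least)
    fix D T assume D: "D division_of T" "T \<subseteq> {a..s}"
    have "interior T \<inter> interior {s..t} \<subseteq> interior {a..s} \<inter> interior {s..t}"
      using interior_mono[OF D(2)] by auto
    also have "\<dots> = {}" by (auto simp: interior_atLeastAtMost_real)
    finally have i: "interior T \<inter> interior {s..t} = {}" by auto
    have "{cbox s t} division_of cbox s t" using assms by (intro division_of_self) auto
    then have "(D \<union> {{s..t}}) division_of (T \<union> {s..t})"
      using division_disjoint_union[OF D(1) _ i, of "{{s..t}}"] by (simp add: cbox_interval)
    moreover have "T \<union> {s..t} \<subseteq> {a..t}" using D(2) assms by auto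
    ultimately have "variation_sum f (D \<union> {{s..t}}) \<le> variation f a t"
      using variation_upper[OF f] assms by auto
    moreover have "{s..t} \<notin> D"
    proof
      assume "{s..t} \<in> D"
      then have "{s..t} \<subseteq> {a..s}" using division_ofD(2)[OF D(1)] D(2) by blast
      then show False using \<open>s < t\<close> by auto
    qed
    moreover have "finite D" using D(1) by auto
    ultimately show "variation_sum f D \<le> variation f a t - norm (f t - f s)"
      using \<open>s < t\<close> unfolding variation_sum_def by simp
  qed
  then show ?thesis by simp
qed auto

text \<open>By subadditivity the increment of the variation over an interval I is at most the
  variation on I, which is nearly attained by a family inside I. The union of these families over
  \<open>D\<close> is again a family of total length below \<open>d\<close>, so absolute continuity
  of \<open>f\<close> bounds all of them together.\<close>

lemma AC_variation:
  assumes f: "absolutely_continuous_on {a..b} f"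
  shows "absolutely_continuous_on {a..b} (variation f a)"
  unfolding absolutely_continuous_on_def
proof (intro allI impI)
  let ?dV = "\<lambda>I. norm (variation f a (Sup I) - variation f a (Inf I))"
  fix e :: real assume e: "e > 0"
  obtain d where d: "d > 0" "\<And>D T. D division_of T \<Longrightarrow> T \<subseteq> {a..b} \<Longrightarrow>
     (\<Sum>I\<in>D. Sup I - Inf I) < d \<Longrightarrow> variation_sum f D < e / 2"
    using f e unfolding absolutely_continuous_on_def variation_sum_def by (meson half_gt_zero)
  show "\<exists>\<delta>>0. \<forall>D T. D division_of T \<and> T \<subseteq> {a..b} \<and> (\<Sum>I\<in>D. Sup I - Inf I) < \<delta> \<longrightarrow>
       (\<Sum>I\<in>D. ?dV I) < e"
  proof (intro exI[of _ d] conjI allI impI)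
    fix D T assume *: "D division_of T \<and> T \<subseteq> {a..b} \<and> (\<Sum>I\<in>D. Sup I - Inf I) < d"
    then have D: "D division_of T" "T \<subseteq> {a..b}" "(\<Sum>I\<in>D. Sup I - Inf I) < d" by auto
    note I = division_of_real_interval[OF D(1)]
    have fin: "finite D" using D(1) by auto
    \<comment> \<open>The error allowed per interval: all of them together cost at most e / 2.
      Adding 1 covers the empty family.\<close>
    define \<eta> where "\<eta> = e / (2 * (real (card D) + 1))"
    have \<eta>: "\<eta> > 0" "real (card D) * \<eta> \<le> e / 2"
      using e by (auto simp: \<eta>_def field_simps)
    have "\<exists>E. (\<exists>U. E division_of U \<and> U \<subseteq> I) \<and> ?dV I \<le> variation_sum f E + \<eta>"
      if "I \<in> D" for I
    proof -
      have ab: "a \<le> Inf I" "Inf I \<le> Sup I" "Sup I \<le> b" using I(2,3,4)[OF that] D(2) by auto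
      have "?dV I \<le> variation f (Inf I) (Sup I)"
        using variation_increment[OF f ab] variation_subadditive[OF f order_refl ab]
          norm_ge_zero[of "f (Sup I) - f (Inf I)"] unfolding real_norm_def by linarith
      moreover have ex: "\<exists>E U. E division_of U \<and> U \<subseteq> I \<and> variation f (Inf I) (Sup I) \<le> variation_sum f E + \<eta>"
      proof (rule ccontr)
        assume n: "\<not> ?thesis"
        have "variation f (Inf I) (Sup I) \<le> variation f (Inf I) (Sup I) - \<eta>"
        proof (rule variation_least)
          fix E U assume "E division_of U" "U \<subseteq> {Inf I..Sup I}"
          moreover from this(2) have "U \<subseteq> I" by (subst I(1)[OF that])
          ultimately have "\<not> variation f (Inf I) (Sup I) \<le> variation_sum f E + \<eta>"
            using n by blast
          then show "variation_sum f E \<le> variation f (Inf I) (Sup I) - \<eta>" by linarith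
        qed
        then show False using \<eta> by simp
      qed
      from ex obtain E U where "E division_of U" "U \<subseteq> I" "variation f (Inf I) (Sup I) \<le> variation_sum f E + \<eta>"
        by blast
      ultimately show ?thesis by (meson order_trans)
    qed
    then obtain E where E: "\<And>I. I \<in> D \<Longrightarrow> (\<exists>U. E I division_of U \<and> U \<subseteq> I)"
      "\<And>I. I \<in> D \<Longrightarrow> ?dV I \<le> variation_sum f (E I) + \<eta>"
      by metis
    \<comment> \<open>One-point intervals are dropped: neighbouring members of \<open>D\<close>
      could both have chosen their common endpoint, and the families would not be disjoint. The
      dropped terms are 0.\<close>
    define E' where "E' I = {K \<in> E I. Inf K \<noteq> Sup K}" for I
    have Efin: "finite (E I)" if "I \<in> D" for I using E(1)[OF that] by auto
    have Esub: "K \<subseteq> I" "interior K \<noteq> {}" if IK: "I \<in> D" "K \<in> E' I" for I K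
    proof -
      obtain U where U: "E I division_of U" "U \<subseteq> I" using E(1)[OF IK(1)] by blast
      have K: "K \<in> E I" "Inf K \<noteq> Sup K" using IK by (auto simp: E'_def)
      show "K \<subseteq> I" using U K division_ofD(2) by blast
      have "K = {Inf K..Sup K}" "Inf K < Sup K"
        using division_of_real_interval(1,2)[OF U(1) K(1)] K(2) by auto
      then show "interior K \<noteq> {}"
        by (metis interior_atLeastAtMost_real greaterThanLessThan_empty_iff not_le)
    qed
    have disj: "E' I \<inter> E' J = {}" if "I \<in> D" "J \<in> D" "I \<noteq> J" for I J
    proof (rule ccontr)
      assume "E' I \<inter> E' J \<noteq> {}"
      then obtain K where K: "K \<in> E' I" "K \<in> E' J" by auto
      then have "interior K \<subseteq> interior I \<inter> interior J"
        using Esub(1) that by (meson Int_greatest interior_mono)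
      then show False using division_ofD(5)[OF D(1) that] Esub(2)[OF that(1) K(1)] by auto
    qed
    have div: "(\<Union>I\<in>D. E' I) division_of (\<Union>(\<Union>I\<in>D. E' I))"
    proof (rule division_ofI)
      show "finite (\<Union>I\<in>D. E' I)" using fin Efin by (auto simp: E'_def)
      fix K assume "K \<in> (\<Union>I\<in>D. E' I)"
      then obtain I where IK: "I \<in> D" "K \<in> E' I" by auto
      then obtain U where U: "E I division_of U" using E(1) by blast
      show "K \<subseteq> (\<Union>(\<Union>I\<in>D. E' I))" using IK by auto
      show "K \<noteq> {}" "\<exists>c d. K = cbox c d"
        using division_ofD(3,4)[OF U, of K] IK by (auto simp: E'_def)
      fix K' assume "K' \<in> (\<Union>I\<in>D. E' I)" "K \<noteq> K'"
      then obtain J where JK: "J \<in> D" "K' \<in> E' J" by auto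
      show "interior K \<inter> interior K' = {}"
      proof (cases "I = J")
        case True
        then show ?thesis using division_ofD(5)[OF U, of K K'] IK JK \<open>K \<noteq> K'\<close> by (auto simp: E'_def)
      next
        case False
        have "interior K \<inter> interior K' \<subseteq> interior I \<inter> interior J"
          using Esub(1)[OF IK] Esub(1)[OF JK] by (meson Int_mono interior_mono)
        then show ?thesis using division_ofD(5)[OF D(1) IK(1) JK(1) False] by auto
      qed
    qed simp
    have sumE': "sum g (\<Union>I\<in>D. E' I) = (\<Sum>I\<in>D. sum g (E' I))" for g :: "real set \<Rightarrow> real"
      by (rule sum.UNION_disjoint) (use fin Efin disj in \<open>auto simp: E'_def\<close>)
    have "(\<Sum>K\<in>(\<Union>I\<in>D. E' I). Sup K - Inf K) < d"
    proof -
      have "(\<Sum>K\<in>E' I. Sup K - Inf K) \<le> Sup I - Inf I" if ID: "I \<in> D" for I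
      proof -
        obtain U where U: "E I division_of U" "U \<subseteq> I" using E(1)[OF ID] by blast
        from U(2) have "U \<subseteq> {Inf I..Sup I}" by (subst I(1)[OF ID, symmetric])
        note U = U(1) this
        have "(\<Sum>K\<in>E' I. Sup K - Inf K) = (\<Sum>K\<in>E I. Sup K - Inf K)"
          unfolding E'_def by (rule sum.mono_neutral_left) (use Efin[OF that] in auto)
        then show ?thesis using sum_lengths_le[OF U I(2)[OF that]] by simp
      qed
      then have "(\<Sum>I\<in>D. \<Sum>K\<in>E' I. Sup K - Inf K) \<le> (\<Sum>I\<in>D. Sup I - Inf I)" by (rule sum_mono)
      then show ?thesis using D(3) sumE' by simp
    qed
    moreover have "\<Union>(\<Union>I\<in>D. E' I) \<subseteq> {a..b}"
      using Esub(1) division_ofD(2)[OF D(1)] D(2) by blast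
    ultimately have "variation_sum f (\<Union>I\<in>D. E' I) < e / 2" using d(2)[OF div] by blast
    moreover have "variation_sum f (\<Union>I\<in>D. E' I) = (\<Sum>I\<in>D. variation_sum f (E I))"
    proof -
      have "(\<Sum>K\<in>E' I. norm (f (Sup K) - f (Inf K))) = (\<Sum>K\<in>E I. norm (f (Sup K) - f (Inf K)))" if "I \<in> D" for I
        unfolding E'_def by (rule sum.mono_neutral_left) (use Efin[OF that] in auto)
      then show ?thesis unfolding variation_sum_def sumE' by simp
    qed
    moreover have "(\<Sum>I\<in>D. ?dV I) \<le> (\<Sum>I\<in>D. variation_sum f (E I) + \<eta>)"
      by (rule sum_mono) (rule E(2))
    moreover have "(\<Sum>I\<in>D. variation_sum f (E I) + \<eta>) = (\<Sum>I\<in>D. variation_sum f (E I)) + real (card D) * \<eta>"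
      by (simp add: sum.distrib)
    ultimately show "(\<Sum>I\<in>D. ?dV I) < e"
      using \<eta>(2) by linarith
  qed (use d in auto)
qed

subsection \<open>The fundamental theorem of calculus for absolutely continuous functions\<close>

text \<open>Absolute continuity of the function becomes absolute continuity of its Stieltjes
  measure: a Lebesgue null set lies in an open set of small measure, and the Stieltjes measure of an
  open set is approximated by increments over finite families of intervals.\<close>

lemma density_of_increasing_AC:
  fixes F :: "real \<Rightarrow> real"
  assumes F: "absolutely_continuous_on {a..b} F" and mono: "\<And>s t. a \<le> s \<Longrightarrow> s \<le> t \<Longrightarrow> t \<le> b \<Longrightarrow> F s \<le> F t"
    and "a \<le> b"
  obtains g where "g absolutely_integrable_on {a..b}" "\<And>t. t \<in> {a..b} \<Longrightarrow> F t = F a + integral {a..t} g"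
proof -
  \<comment> \<open>Clamping to \<open>{a..b}\<close> extends \<open>F\<close> to the line by
    constants, so that the measure \<open>N\<close> gives no mass to the two outer
    half-lines.\<close>
  define c where "c t = max a (min b t)" for t :: real
  have c: "c t \<in> {a..b}" "s \<le> t \<Longrightarrow> c s \<le> c t" "t \<in> {a..b} \<Longrightarrow> c t = t" for s t
    using \<open>a \<le> b\<close> by (auto simp: c_def)
  define G where "G t = F (c t)" for t
  have Gmono: "G s \<le> G t" if "s \<le> t" for s t
    unfolding G_def using c[of s] c[of t] c(2)[OF that] by (intro mono) auto
  have "continuous_on UNIV c" unfolding c_def by (intro continuous_intros)
  then have Gcont: "continuous_on UNIV G"
    unfolding G_def using c(1)
    by (intro continuous_on_compose2[OF AC_imp_continuous_on[OF F]]) auto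
  define N where "N = interval_measure G"
  have Nicc: "emeasure N {s..t} = ennreal (G t - G s)" if "s \<le> t" for s t
    unfolding N_def using emeasure_interval_measure_Icc[OF that Gmono Gcont] .
  have setsN[simp]: "sets N = sets borel" unfolding N_def by simp
  have N0: "emeasure N {..a} = 0"
  proof -
    have "{..a} = (\<Union>k::nat. {a - real k..a})"
      by (auto simp: diff_le_eq) (metis real_arch_simple add.commute diff_le_eq)
    moreover have "emeasure N {a - real k..a} = 0" for k :: nat
      using Nicc[of "a - real k" a] \<open>a \<le> b\<close> by (simp add: G_def c_def)
    ultimately show ?thesis by (simp only:) (rule emeasure_UN_eq_0, auto)
  qed
  have N1: "emeasure N {b..} = 0"
  proof -
    have "{b..} = (\<Union>k::nat. {b..b + real k})"
      by auto (metis real_arch_simple add.commute diff_le_eq)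
    moreover have "emeasure N {b..b + real k} = 0" for k :: nat
      using Nicc[of b "b + real k"] \<open>a \<le> b\<close> by (simp add: G_def c_def)
    ultimately show ?thesis by (simp only:) (rule emeasure_UN_eq_0, auto)
  qed
  \<comment> \<open>\<open>d\<close> is a delta for \<open>e\<close>: an open set of Lebesgue
    measure below \<open>d\<close> has Stieltjes measure at most \<open>e\<close>.\<close>
  have Nle: "emeasure N A \<le> ennreal e"
    if A: "open A" "emeasure lborel A < ennreal d" and e: "e \<ge> 0"
      and d: "\<And>D T. D division_of T \<Longrightarrow> T \<subseteq> {a..b} \<Longrightarrow>
     (\<Sum>I\<in>D. Sup I - Inf I) < d \<Longrightarrow> (\<Sum>I\<in>D. norm (F (Sup I) - F (Inf I))) < e" for A e d
  proof -
    obtain \<D> where D: "countable \<D>" "\<D> \<subseteq> Pow A" "\<And>X. X \<in> \<D> \<Longrightarrow> \<exists>a b. X = cbox a b" "\<Union>\<D> = A"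
      using open_countable_Union_open_cbox[OF A(1)] by metis
    show ?thesis
    proof (cases "\<D> = {}")
      case True
      then show ?thesis using D(4) by auto
    next
      case False
      \<comment> \<open>The open set is exhausted by finite unions of closed intervals. These may
        overlap, so the part of such a union in \<open>{a..b}\<close> is first rewritten as a
        division \<open>E\<close>, whose total length is then its Lebesgue measure.\<close>
      define B where "B n = (\<Union>i\<le>n. from_nat_into \<D> i)" for n :: nat
      have Xi: "\<exists>p q. from_nat_into \<D> i = {p..q}" "from_nat_into \<D> i \<in> \<D>" for i
        using D(3) from_nat_into[OF False] by (metis cbox_interval)+
      have BA: "(\<Union>n. B n) = A"
        using D(4) D(1) from_nat_into_surj[OF D(1)] Xi(2) unfolding B_def by fastforce
      have Bsets: "B n \<in> sets borel" for n
        unfolding B_def using Xi(1) by (intro sets.finite_UN) (auto, metis borel_closed closed_atLeastAtMost)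
      have "incseq B" unfolding B_def incseq_def by fastforce
      then have "(\<lambda>n. emeasure N (B n)) \<longlonglongrightarrow> emeasure N A"
        unfolding BA[symmetric] using Bsets by (intro Lim_emeasure_incseq) auto
      moreover have "emeasure N (B n) \<le> ennreal e" for n
      proof -
        have fin: "finite ((\<lambda>i. from_nat_into \<D> i \<inter> {a..b}) ` {..n})" by simp
        have "\<exists>p q. X = cbox p q" if X: "X \<in> (\<lambda>i. from_nat_into \<D> i \<inter> {a..b}) ` {..n}" for X
        proof -
          obtain i where i: "X = from_nat_into \<D> i \<inter> {a..b}" using X by auto
          obtain p q where "from_nat_into \<D> i = {p..q}" using Xi(1) by blast
          then have "X = cbox (max p a) (min q b)" using i by auto
          then show ?thesis by blast
        qed
        then obtain E where E: "E division_of \<Union>((\<lambda>i. from_nat_into \<D> i \<inter> {a..b}) ` {..n})"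
          using elementary_unions_intervals[OF fin] by metis
        have U: "\<Union>((\<lambda>i. from_nat_into \<D> i \<inter> {a..b}) ` {..n}) = B n \<inter> {a..b}" by (auto simp: B_def)
        note E = E[unfolded U]
        note I = division_of_real_interval[OF E]
        have finE: "finite E" using E by auto
        have Esets: "I \<in> sets borel" if "I \<in> E" for I
          using division_ofD(4)[OF E that] by auto
        have "emeasure lborel (B n \<inter> {a..b}) < ennreal d"
          using emeasure_mono[of "B n \<inter> {a..b}" A lborel] A BA by (auto intro: le_less_trans)
        moreover have "emeasure lborel (B n \<inter> {a..b}) = ennreal (\<Sum>I\<in>E. Sup I - Inf I)"
        proof -
          have l: "B n \<inter> {a..b} \<in> lmeasurable" using lmeasurable_division[OF E] .
          have "measure lebesgue (B n \<inter> {a..b}) = (\<Sum>I\<in>E. measure lebesgue I)"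
            using content_division[OF E] by simp
          also have "\<dots> = (\<Sum>I\<in>E. Sup I - Inf I)"
            by (intro sum.cong refl) (use I(5) Esets in \<open>simp add: measure_completion\<close>)
          finally have "emeasure lebesgue (B n \<inter> {a..b}) = ennreal (\<Sum>I\<in>E. Sup I - Inf I)"
            using emeasure_eq_measure2[OF l] by (simp only:)
          moreover have "B n \<inter> {a..b} \<in> sets lborel" using Bsets[of n] by auto
          then have "emeasure lebesgue (B n \<inter> {a..b}) = emeasure lborel (B n \<inter> {a..b})" by simp
          ultimately show ?thesis by (simp only:)
        qed
        moreover have "0 \<le> (\<Sum>I\<in>E. Sup I - Inf I)" using I(2) by (intro sum_nonneg) simp
        ultimately have "(\<Sum>I\<in>E. Sup I - Inf I) < d" by (simp add: ennreal_less_iff)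
        then have *: "(\<Sum>I\<in>E. norm (F (Sup I) - F (Inf I))) < e"
          using d[OF E] by auto
        have sub: "B n \<subseteq> {..a} \<union> {b..} \<union> \<Union>E" using division_ofD(6)[OF E] by auto
        have UE: "\<Union>E \<in> sets borel" using finE Esets by (intro sets.finite_Union) auto
        have "emeasure N (B n) \<le> emeasure N ({..a} \<union> {b..} \<union> \<Union>E)"
          using sub UE by (intro emeasure_mono) auto
        also have "\<dots> \<le> emeasure N ({..a} \<union> {b..}) + emeasure N (\<Union>E)"
          using UE by (intro emeasure_subadditive) auto
        also have "\<dots> \<le> (emeasure N {..a} + emeasure N {b..}) + (\<Sum>I\<in>E. emeasure N I)"
        proof (rule add_mono)
          show "emeasure N ({..a} \<union> {b..}) \<le> emeasure N {..a} + emeasure N {b..}"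
            by (intro emeasure_subadditive) auto
          have "emeasure N (\<Union>I\<in>E. I) \<le> (\<Sum>I\<in>E. emeasure N I)"
            by (rule emeasure_subadditive_finite) (use finE Esets in auto)
          then show "emeasure N (\<Union>E) \<le> (\<Sum>I\<in>E. emeasure N I)" by simp
        qed
        also have "\<dots> = (\<Sum>I\<in>E. emeasure N I)" using N0 N1 by simp
        also have "\<dots> = (\<Sum>I\<in>E. ennreal (norm (F (Sup I) - F (Inf I))))"
        proof (rule sum.cong)
          fix J assume J: "J \<in> E"
          have "Inf J \<in> {a..b}" "Sup J \<in> {a..b}" using I(3,4)[OF J] by auto
          then show "emeasure N J = ennreal (norm (F (Sup J) - F (Inf J)))"
            using Nicc[OF I(2)[OF J]] arg_cong[OF I(1)[OF J], of "emeasure N"] Gmono[OF I(2)[OF J]]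
            by (simp add: G_def c(3))
        qed simp
        also have "\<dots> = ennreal (\<Sum>I\<in>E. norm (F (Sup I) - F (Inf I)))" by simp
        finally show ?thesis using * by (meson ennreal_leI less_imp_le order_trans)
      qed
      ultimately show ?thesis by (meson LIMSEQ_le_const2)
    qed
  qed
  have ac: "absolutely_continuous lborel N"
    unfolding absolutely_continuous_def
  proof
    fix A :: "real set" assume A: "A \<in> null_sets lborel"
    have "emeasure N A \<le> 0 + ennreal e" if e: "e > 0" for e
    proof -
      obtain d where d: "d > 0" "\<And>D T. D division_of T \<Longrightarrow> T \<subseteq> {a..b} \<Longrightarrow>
     (\<Sum>I\<in>D. Sup I - Inf I) < d \<Longrightarrow> (\<Sum>I\<in>D. norm (F (Sup I) - F (Inf I))) < e"
        using F e unfolding absolutely_continuous_on_def by meson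
      have "A \<in> sets lebesgue" using A by (auto simp: null_sets_def)
      then obtain U where U: "open U" "A \<subseteq> U" "U - A \<in> lmeasurable" "emeasure lebesgue (U - A) < ennreal d"
        using sets_lebesgue_outer_open d(1) by metis
      have "emeasure lborel U = emeasure lborel (U - A)"
        by (rule sym, rule emeasure_Diff_null_set) (use A U in auto)
      also have "\<dots> = emeasure lebesgue (U - A)"
      proof -
        have "U - A \<in> sets lborel" using U(1) A by auto
        then show ?thesis by simp
      qed
      also have "\<dots> < ennreal d" by (rule U(4))
      finally have "emeasure N U \<le> ennreal e" by (rule Nle[OF U(1) _ _ d(2)]) (use e in auto)
      moreover have "emeasure N A \<le> emeasure N U" by (rule emeasure_mono) (use U in auto)
      ultimately have "emeasure N A \<le> ennreal e" by (rule order_trans[rotated])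
      then show ?thesis by (simp only: add_0)
    qed
    then have "emeasure N A \<le> 0" by (rule ennreal_le_epsilon)
    then show "A \<in> null_sets N" using A by (auto simp: null_sets_def)
  qed
  obtain h where h: "h \<in> borel_measurable lborel" "density lborel h = N"
    using sigma_finite_measure.Radon_Nikodym[OF sigma_finite_lborel ac] by auto
  \<comment> \<open>The density is finite almost everywhere on \<open>{a..b}\<close>, because its
    integral there is finite. Passing to real values thus changes none of the integrals
    considered.\<close>
  define g where "g x = enn2real (h x)" for x
  have gm: "g \<in> borel_measurable borel" using h(1) unfolding g_def by measurable
  have hN: "(\<integral>\<^sup>+x. h x * indicator {s..t} x \<partial>lborel) = ennreal (G t - G s)" if "s \<le> t" for s t
    using Nicc[OF that] emeasure_density[OF h(1), of "{s..t}"] h(2) by simp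
  have hfin: "AE x in lborel. h x * indicator {a..b} x \<noteq> \<infinity>"
    using h(1) hN[OF \<open>a \<le> b\<close>] by (intro nn_integral_PInf_AE) auto
  have gN: "((\<lambda>x. indicator {s..t} x *\<^sub>R g x) has_integral (G t - G s)) UNIV"
      if "a \<le> s" "s \<le> t" "t \<le> b" for s t
  proof (rule nn_integral_has_integral)
    show "(\<lambda>x. indicator {s..t} x *\<^sub>R g x) \<in> borel_measurable borel" using gm by measurable
    show "0 \<le> indicator {s..t} x *\<^sub>R g x" for x by (simp add: g_def)
    have "(\<integral>\<^sup>+x. ennreal (indicator {s..t} x *\<^sub>R g x) \<partial>lborel) = (\<integral>\<^sup>+x. h x * indicator {s..t} x \<partial>lborel)"
    proof (rule nn_integral_cong_AE)
      show "AE x in lborel. ennreal (indicator {s..t} x *\<^sub>R g x) = h x * indicator {s..t} x"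
        using hfin
      proof eventually_elim
        case (elim x)
        then show ?case using that by (cases "x \<in> {s..t}") (auto simp: g_def less_top)
      qed
    qed
    then show "(\<integral>\<^sup>+x. ennreal (indicator {s..t} x *\<^sub>R g x) \<partial>lborel) = ennreal (G t - G s)"
      using hN that by simp
    show "0 \<le> G t - G s" using Gmono that by simp
  qed
  have gI: "(g has_integral (G t - G s)) {s..t}" if "a \<le> s" "s \<le> t" "t \<le> b" for s t
  proof -
    have "((\<lambda>x. if x \<in> {s..t} then g x else 0) has_integral (G t - G s)) UNIV"
      using gN[OF that] by (rule has_integral_eq[rotated]) (auto simp: indicator_def)
    then show ?thesis using has_integral_restrict_UNIV by blast
  qed
  show thesis
  proof
    show "g absolutely_integrable_on {a..b}"
      by (rule nonnegative_absolutely_integrable_1) (use gI[of a b] \<open>a \<le> b\<close> in \<open>auto simp: g_def\<close>)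
    show "F t = F a + integral {a..t} g" if "t \<in> {a..b}" for t
      using integral_unique[OF gI[of a t]] that \<open>a \<le> b\<close> by (simp add: G_def c(3))
  qed
qed

lemma AC_add:
  assumes f: "absolutely_continuous_on S f" and g: "absolutely_continuous_on S g"
  shows "absolutely_continuous_on S (\<lambda>t. f t + g t)"
proof (rule AC_dominated[OF assms, where C = 1])
  fix s t :: real assume "s \<le> t"
  have *: "f t + g t - (f s + g s) = (f t - f s) + (g t - g s)" by simp
  then show "norm (f t + g t - (f s + g s)) \<le> 1 * norm (f t - f s) + 1 * norm (g t - g s) + 1 * (t - s)"
    unfolding * using norm_triangle_ineq[of "f t - f s" "g t - g s"] \<open>s \<le> t\<close> by simp
qed

lemma AC_minus:
  "absolutely_continuous_on S f \<Longrightarrow> absolutely_continuous_on S (\<lambda>t. - f t)"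
  using AC_linear[OF bounded_linear_minus[OF bounded_linear_ident]] .

lemma absolutely_integrable_subinterval:
  fixes g :: "real \<Rightarrow> 'a::euclidean_space"
  assumes "g absolutely_integrable_on {a..b}" "{s..t} \<subseteq> {a..b}"
  shows "g integrable_on {s..t}"
  using set_lebesgue_integral_eq_integral(1)[OF assms(1)] assms(2) by (rule integrable_on_subinterval)

lemma density_of_real_AC:
  fixes f :: "real \<Rightarrow> real"
  assumes f: "absolutely_continuous_on {a..b} f" and "a \<le> b"
  shows "\<exists>g. g absolutely_integrable_on {a..b} \<and> (\<forall>t\<in>{a..b}. f t = f a + integral {a..t} g)"
proof -
  note V = AC_variation[OF f]
  note inc = variation_increment[OF f]
  have m1: "variation f a s \<le> variation f a t" if "a \<le> s" "s \<le> t" "t \<le> b" for s t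
    using inc[OF that] norm_ge_zero[of "f t - f s"] by linarith
  have m2: "variation f a s + - f s \<le> variation f a t + - f t" if "a \<le> s" "s \<le> t" "t \<le> b" for s t
    using inc[OF that] unfolding real_norm_def by linarith
  obtain g where g: "g absolutely_integrable_on {a..b}"
    "\<And>t. t \<in> {a..b} \<Longrightarrow> variation f a t = variation f a a + integral {a..t} g"
    using density_of_increasing_AC[OF V m1 \<open>a \<le> b\<close>] by metis
  obtain h where h: "h absolutely_integrable_on {a..b}"
    "\<And>t. t \<in> {a..b} \<Longrightarrow> variation f a t + - f t = variation f a a + - f a + integral {a..t} h"
    using density_of_increasing_AC[OF AC_add[OF V AC_minus[OF f]] m2 \<open>a \<le> b\<close>]
    by metis
  have "f t = f a + integral {a..t} (\<lambda>s. g s - h s)" if t: "t \<in> {a..b}" for t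
  proof -
    have "g integrable_on {a..t}" "h integrable_on {a..t}"
      using t by (auto intro!: absolutely_integrable_subinterval[OF g(1)]
          absolutely_integrable_subinterval[OF h(1)])
    then have "integral {a..t} (\<lambda>s. g s - h s) = integral {a..t} g - integral {a..t} h"
      by (rule HK_integral_diff)
    then show ?thesis using g(2)[OF t] h(2)[OF t] by linarith
  qed
  then show ?thesis using set_integral_diff(1)[OF g(1) h(1)] by blast
qed

lemma density_of_AC:
  fixes f :: "real \<Rightarrow> 'a::euclidean_space"
  assumes f: "absolutely_continuous_on {a..b} f" and "a \<le> b"
  obtains g where "g absolutely_integrable_on {a..b}" "\<And>t. t \<in> {a..b} \<Longrightarrow> f t = f a + integral {a..t} g"
proof -
  have "\<exists>g. g absolutely_integrable_on {a..b} \<and> (\<forall>t\<in>{a..b}. f t \<bullet> i = f a \<bullet> i + integral {a..t} g)" for i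
    using density_of_real_AC[OF AC_linear[OF bounded_linear_inner_left f] \<open>a \<le> b\<close>] .
  then obtain g where g: "\<And>i. g i absolutely_integrable_on {a..b}"
    "\<And>i t. t \<in> {a..b} \<Longrightarrow> f t \<bullet> i = f a \<bullet> i + integral {a..t} (g i)"
    by metis
  define h where "h t = (\<Sum>i\<in>Basis. g i t *\<^sub>R i)" for t
  show thesis
  proof
    show "h absolutely_integrable_on {a..b}"
      unfolding h_def by (rule absolutely_integrable_sum) (auto intro!: set_integrable_scaleR_left g)
    fix t assume t: "t \<in> {a..b}"
    have gi: "g i integrable_on {a..t}" for i
      using t by (intro absolutely_integrable_subinterval[OF g(1)]) auto
    have "integral {a..t} h = (\<Sum>i\<in>Basis. integral {a..t} (\<lambda>s. g i s *\<^sub>R i))"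
      unfolding h_def by (rule integral_sum) (auto intro!: integrable_on_scaleR_left gi)
    also have "\<dots> = (\<Sum>i\<in>Basis. (f t \<bullet> i - f a \<bullet> i) *\<^sub>R i)"
      using g(2)[OF t] integral_unique[OF has_integral_scaleR_left[OF integrable_integral[OF gi]]]
      by (intro sum.cong refl) simp
    also have "\<dots> = f t - f a"
      unfolding inner_diff_left[symmetric] by (rule euclidean_representation)
    finally show "f t = f a + integral {a..t} h" by simp
  qed
qed

text \<open>Lebesgue differentiation in the form of averages over boxes whose lower corner is the
  point gives the right derivative. Applied to the reflected function it gives the left one, and the
  two exceptional sets are united after reflecting the second back.\<close>

lemma has_vector_derivative_indefinite_integral_AE:
  fixes g :: "real \<Rightarrow> 'a::euclidean_space"
  assumes g: "g integrable_on {a..b}"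
  obtains N where "negligible N"
    "\<And>t. t \<in> {a..b} - N \<Longrightarrow> ((\<lambda>t. integral {a..t} g) has_vector_derivative g t) (at t within {a..b})"
proof -
  \<comment> \<open>Extension by 0, since the differentiation theorem asks for integrability over
    every box.\<close>
  define g0 where "g0 t = (if t \<in> {a..b} then g t else 0)" for t
  have g0: "g0 integrable_on cbox c d" for c d
  proof -
    have "g0 integrable_on UNIV" unfolding g0_def using g integrable_restrict_UNIV by blast
    then show ?thesis by (rule integrable_on_subcbox) auto
  qed
  have g0r: "(\<lambda>t. g0 (- t)) integrable_on cbox c d" for c d
    using g0[of "-d" "-c"] Henstock_Kurzweil_Integration.integrable_reflect_real[where f = g0 and a = "-d" and b = "-c"] by (simp add: cbox_interval)
  obtain N1 where N1: "negligible N1" "\<And>x e. \<lbrakk>x \<notin> N1; 0 < e\<rbrakk> \<Longrightarrow>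
       \<exists>d>0. \<forall>h. 0 < h \<and> h < d \<longrightarrow> norm (integral (cbox x (x + h *\<^sub>R One)) g0 /\<^sub>R h ^ DIM(real) - g0 x) < e"
    using integrable_ccontinuous_explicit[OF g0] by metis
  obtain N2 where N2: "negligible N2" "\<And>x e. \<lbrakk>x \<notin> N2; 0 < e\<rbrakk> \<Longrightarrow>
       \<exists>d>0. \<forall>h. 0 < h \<and> h < d \<longrightarrow>
         norm (integral (cbox x (x + h *\<^sub>R One)) (\<lambda>t. g0 (- t)) /\<^sub>R h ^ DIM(real) - g0 (- x)) < e"
    using integrable_ccontinuous_explicit[OF g0r] by metis
  have "negligible (uminus ` N2)"
    by (rule negligible_differentiable_image_negligible[OF order_refl N2(1)])
      (auto intro!: derivative_intros simp: differentiable_on_def)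
  with N1(1) have "negligible (N1 \<union> uminus ` N2)" by (rule negligible_Un)
  moreover
  have "((\<lambda>t. integral {a..t} g) has_vector_derivative g t) (at t within {a..b})"
    if t: "t \<in> {a..b} - (N1 \<union> uminus ` N2)" for t
    unfolding has_vector_derivative_def has_derivative_within_alt
  proof (intro conjI allI impI)
    show "bounded_linear (\<lambda>x. x *\<^sub>R g t)" by (rule bounded_linear_scaleR_left)
    fix e :: real assume e: "e > 0"
    have t': "t \<notin> N1" "- t \<notin> N2" "t \<in> {a..b}" using t by (auto intro: rev_image_eqI)
    obtain d1 where d1: "d1 > 0" "\<And>h. 0 < h \<Longrightarrow> h < d1 \<Longrightarrow>
        norm (integral {t..t + h} g0 /\<^sub>R h - g0 t) < e"
      using N1(2)[OF t'(1) e] by auto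
    obtain d2 where d2: "d2 > 0" "\<And>h. 0 < h \<Longrightarrow> h < d2 \<Longrightarrow>
        norm (integral {-t..-t + h} (\<lambda>t. g0 (- t)) /\<^sub>R h - g0 t) < e"
      using N2(2)[OF t'(2) e] by auto
    have key: "norm (I - h *\<^sub>R g t) \<le> e * h" if "norm (I /\<^sub>R h - g t) < e" "h > 0" for I h
    proof -
      have "I - h *\<^sub>R g t = h *\<^sub>R (I /\<^sub>R h - g t)" using that(2) by (simp add: algebra_simps)
      then have "norm (I - h *\<^sub>R g t) = h * norm (I /\<^sub>R h - g t)" using that(2) by simp
      also have "\<dots> \<le> h * e" using that by (intro mult_left_mono) auto
      finally show ?thesis by (simp add: mult.commute)
    qed
    have split: "integral {a..y} g - integral {a..s} g = integral {s..y} g0" if "a \<le> s" "s \<le> y" "y \<le> b" for s y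
    proof -
      have "g integrable_on {a..y}" using g that by (auto intro: integrable_on_subinterval)
      from HK_integral_combine[OF that(1,2) this]
      have "integral {a..y} g - integral {a..s} g = integral {s..y} g" by (simp add: algebra_simps)
      also have "\<dots> = integral {s..y} g0"
        by (rule Henstock_Kurzweil_Integration.integral_cong) (use that in \<open>auto simp: g0_def\<close>)
      finally show ?thesis .
    qed
    have gt: "g0 t = g t" using t' by (simp add: g0_def)
    show "\<exists>d>0. \<forall>y\<in>{a..b}. norm (y - t) < d \<longrightarrow>
      norm (integral {a..y} g - integral {a..t} g - (y - t) *\<^sub>R g t) \<le> e * norm (y - t)"
    proof (intro exI[of _ "min d1 d2"] conjI ballI impI)
      fix y assume y: "y \<in> {a..b}" "norm (y - t) < min d1 d2"
      consider "y = t" | "y > t" | "y < t" by linarith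
      then show "norm (integral {a..y} g - integral {a..t} g - (y - t) *\<^sub>R g t) \<le> e * norm (y - t)"
      proof cases
        case 2
        have "norm (integral {t..t + (y - t)} g0 /\<^sub>R (y - t) - g0 t) < e"
          by (rule d1(2)) (use 2 y in auto)
        then have "norm (integral {t..y} g0 - (y - t) *\<^sub>R g t) \<le> e * (y - t)"
          using key[where I = "integral {t..y} g0" and h = "y - t"] 2 by (simp add: gt)
        then show ?thesis using split[of t y] 2 y t' by simp
      next
        case 3
        have "integral {-t..-y} (\<lambda>t. g0 (- t)) = integral {y..t} g0"
          using integral_reflect_real[where f = g0 and a = y and b = t] by simp
        moreover have "norm (integral {-t..-t + (t - y)} (\<lambda>t. g0 (- t)) /\<^sub>R (t - y) - g0 t) < e"
          by (rule d2(2)) (use 3 y in auto)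
        ultimately have "norm (integral {y..t} g0 - (t - y) *\<^sub>R g t) \<le> e * (t - y)"
          using key[where I = "integral {y..t} g0" and h = "t - y"] 3 by (simp add: gt)
        moreover have "integral {a..y} g - integral {a..t} g - (y - t) *\<^sub>R g t
            = - (integral {y..t} g0 - (t - y) *\<^sub>R g t)"
          using split[of y t] 3 y t' by (simp add: algebra_simps)
        ultimately show ?thesis using 3 by (simp only: norm_minus_cancel) simp
      qed simp
    qed (use d1 d2 in auto)
  qed
  ultimately show thesis using that by blast
qed

text \<open>Cut the norm of \<open>g\<close> at a height n for which the part above n has integral
  below e / 2. The part below n contributes at most n times the total length, which a delta of e /
  (2 (n + 1)) makes small.\<close>

lemma AC_indefinite_integral:
  fixes g :: "real \<Rightarrow> 'a::euclidean_space"
  assumes g: "g absolutely_integrable_on {a..b}"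
  shows "absolutely_continuous_on {a..b} (\<lambda>t. integral {a..t} g)"
  unfolding absolutely_continuous_on_def
proof (intro allI impI)
  fix e :: real assume e: "e > 0"
  define h where "h n t = min (norm (g t)) (real n)" for n :: nat and t
  have ng: "(\<lambda>t. norm (g t)) absolutely_integrable_on {a..b}"
    using g by (rule set_integrable_norm)
  have h: "h n absolutely_integrable_on {a..b}" for n
    unfolding h_def by (rule absolutely_integrable_min_1[OF ng]) (auto intro: absolutely_integrable_continuous_real continuous_intros)
  have hi: "h n integrable_on {a..b}" for n using h set_lebesgue_integral_eq_integral(1) by blast
  have ngi: "(\<lambda>t. norm (g t)) integrable_on {a..b}" using ng set_lebesgue_integral_eq_integral(1) by blast
  have "(\<lambda>n. integral {a..b} (h n)) \<longlonglongrightarrow> integral {a..b} (\<lambda>t. norm (g t))"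
  proof (rule dominated_convergence(2)[OF hi ngi])
    show "norm (h n t) \<le> norm (g t)" for n t by (auto simp: h_def)
    show "(\<lambda>n. h n t) \<longlonglongrightarrow> norm (g t)" for t
    proof (rule tendsto_eventually)
      obtain m :: nat where "norm (g t) \<le> real m" using real_arch_simple by blast
      then show "\<forall>\<^sub>F n in sequentially. h n t = norm (g t)"
        unfolding h_def by (intro eventually_sequentiallyI[of m]) auto
    qed
  qed
  then have "\<forall>\<^sub>F n in sequentially. dist (integral {a..b} (h n)) (integral {a..b} (\<lambda>t. norm (g t))) < e / 2"
    using e by (intro tendstoD) auto
  then obtain n where n: "dist (integral {a..b} (h n)) (integral {a..b} (\<lambda>t. norm (g t))) < e / 2"
    by (auto simp: eventually_sequentially)
  have n': "integral {a..b} (\<lambda>t. norm (g t) - h n t) < e / 2"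
    using n unfolding HK_integral_diff[OF ngi hi[of n]] dist_real_def by linarith
  show "\<exists>\<delta>>0. \<forall>D T. D division_of T \<and> T \<subseteq> {a..b} \<and> (\<Sum>I\<in>D. Sup I - Inf I) < \<delta> \<longrightarrow>
       (\<Sum>I\<in>D. norm (integral {a..Sup I} g - integral {a..Inf I} g)) < e"
  proof (intro exI[of _ "e / (2 * (real n + 1))"] conjI allI impI)
    show "0 < e / (2 * (real n + 1))" using e by simp
    fix D T assume *: "D division_of T \<and> T \<subseteq> {a..b} \<and> (\<Sum>I\<in>D. Sup I - Inf I) < e / (2 * (real n + 1))"
    then have D: "D division_of T" "T \<subseteq> {a..b}" by auto
    note I = division_of_real_interval[OF D(1)]
    have di: "(\<lambda>t. norm (g t) - h n t) integrable_on {a..b}" using ngi hi by (rule HK_integrable_diff)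
    have "(\<Sum>I\<in>D. norm (integral {a..Sup I} g - integral {a..Inf I} g))
        \<le> (\<Sum>I\<in>D. integral I (\<lambda>t. norm (g t) - h n t) + real n * (Sup I - Inf I))"
    proof (rule sum_mono)
      fix J assume J: "J \<in> D"
      obtain p q where pq: "Inf J = p" "Sup J = q" by blast
      have Jpq: "J = {p..q}" "p \<le> q" "a \<le> p" "q \<le> b"
        using I(1-4)[OF J] D(2) unfolding pq by auto
      have sub: "{p..q} \<subseteq> {a..b}" using Jpq by auto
      have gi: "g integrable_on {a..q}" "g integrable_on {p..q}"
        by (rule absolutely_integrable_subinterval[OF g], use Jpq in auto)+
      note subi = integrable_on_subinterval[OF ngi sub] integrable_on_subinterval[OF di sub]
      have "integral {a..q} g - integral {a..p} g = integral {p..q} g"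
        using HK_integral_combine[OF Jpq(3,2) gi(1)] by (simp add: algebra_simps)
      also have "norm \<dots> \<le> integral {p..q} (\<lambda>t. norm (g t))"
        using gi(2) subi(1) by (rule integral_norm_bound_integral) simp
      also have "\<dots> \<le> integral {p..q} (\<lambda>t. (norm (g t) - h n t) + real n)"
        by (rule integral_le[OF subi(1) HK_integrable_add[OF subi(2)]]) (auto simp: h_def)
      also have "\<dots> = integral {p..q} (\<lambda>t. norm (g t) - h n t) + real n * (q - p)"
        using HK_integral_add[OF subi(2) integrable_const_ivl[of "real n" p q]] Jpq
        by simp
      finally show "norm (integral {a..Sup J} g - integral {a..Inf J} g)
        \<le> integral J (\<lambda>t. norm (g t) - h n t) + real n * (Sup J - Inf J)"
        unfolding pq unfolding Jpq(1) .
    qed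
    also have "\<dots> = (\<Sum>I\<in>D. integral I (\<lambda>t. norm (g t) - h n t)) + real n * (\<Sum>I\<in>D. Sup I - Inf I)"
      by (simp add: sum.distrib sum_distrib_left)
    also have "(\<Sum>I\<in>D. integral I (\<lambda>t. norm (g t) - h n t)) = integral T (\<lambda>t. norm (g t) - h n t)"
      by (rule integral_combine_division_topdown[symmetric, OF integrable_on_subdivision[OF D(1) di D(2)] D(1)])
    also have "integral T (\<lambda>t. norm (g t) - h n t) \<le> integral {a..b} (\<lambda>t. norm (g t) - h n t)"
      by (rule integral_subset_le[OF D(2) integrable_on_subdivision[OF D(1) di D(2)] di]) (auto simp: h_def)
    also have "\<dots> < e / 2" by (rule n')
    also have "real n * (\<Sum>I\<in>D. Sup I - Inf I) \<le> real n * (e / (2 * (real n + 1)))"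
      using * by (intro mult_left_mono) auto
    also have "\<dots> \<le> e / 2" using e by (simp add: field_simps)
    finally show "(\<Sum>I\<in>D. norm (integral {a..Sup I} g - integral {a..Inf I} g)) < e" by simp
  qed
qed

text \<open>A density of \<open>f\<close> exists, and by Lebesgue differentiation it agrees with the
  derivative almost everywhere. Where \<open>f\<close> is not differentiable,
  \<open>vector_derivative\<close> has an unspecified value; all such points lie in
  \<open>N\<close>.\<close>

lemma AC_FTC:
  fixes f :: "real \<Rightarrow> 'a::euclidean_space"
  assumes f: "absolutely_continuous_on {a..b} f" and ab: "a < b"
  defines "f' \<equiv> \<lambda>t. vector_derivative f (at t within {a..b})"
  obtains N where "negligible N" "\<And>t. t \<in> {a..b} - N \<Longrightarrow> (f has_vector_derivative f' t) (at t within {a..b})"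
    "f' absolutely_integrable_on {a..b}"
    "\<And>s t. a \<le> s \<Longrightarrow> s \<le> t \<Longrightarrow> t \<le> b \<Longrightarrow> (f' has_integral f t - f s) {s..t}"
proof -
  obtain g where g: "g absolutely_integrable_on {a..b}" "\<And>t. t \<in> {a..b} \<Longrightarrow> f t = f a + integral {a..t} g"
    using density_of_AC[OF f less_imp_le[OF ab]] by metis
  have gi: "g integrable_on {a..b}" using g(1) set_lebesgue_integral_eq_integral(1) by blast
  obtain N where N: "negligible N"
    "\<And>t. t \<in> {a..b} - N \<Longrightarrow> ((\<lambda>t. integral {a..t} g) has_vector_derivative g t) (at t within {a..b})"
    using has_vector_derivative_indefinite_integral_AE[OF gi] by metis
  have fg: "(f has_vector_derivative g t) (at t within {a..b})" if t: "t \<in> {a..b} - N" for t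
  proof -
    have "((\<lambda>t. f a + integral {a..t} g) has_vector_derivative 0 + g t) (at t within {a..b})"
      by (intro has_vector_derivative_add has_vector_derivative_const N(2)[OF t])
    then have "((\<lambda>t. f a + integral {a..t} g) has_vector_derivative g t) (at t within {a..b})" by simp
    then show ?thesis
      by (rule has_vector_derivative_transform[rotated 2]) (use t g(2) in blast)+
  qed
  have f'g: "f' t = g t" if t: "t \<in> {a..b} - N" for t
    unfolding f'_def using vector_derivative_within_closed_interval[OF ab _ fg[OF t]] t by blast
  show thesis
  proof
    show "negligible N" by fact
    show "(f has_vector_derivative f' t) (at t within {a..b})" if "t \<in> {a..b} - N" for t
      using fg[OF that] f'g[OF that] by simp
    show "f' absolutely_integrable_on {a..b}"
      by (rule absolutely_integrable_spike[OF g(1) N(1) f'g])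
    fix s t assume st: "a \<le> s" "s \<le> t" "t \<le> b"
    have g1: "g integrable_on {a..t}" "g integrable_on {s..t}" using gi st by (auto intro: integrable_on_subinterval)
    have "integral {s..t} g = f t - f s"
      using HK_integral_combine[OF st(1,2) g1(1), symmetric] g(2)[of s] g(2)[of t] st by simp
    then have "(g has_integral f t - f s) {s..t}" using g1(2) by (simp add: has_integral_iff)
    then show "(f' has_integral f t - f s) {s..t}"
      by (rule has_integral_spike[OF N(1), rotated]) (use st f'g in auto)
  qed
qed

subsection \<open>Weak lower semicontinuity\<close>

lemma dominated_convergence_negligible:
  fixes f :: "nat \<Rightarrow> 'n::euclidean_space \<Rightarrow> 'm::euclidean_space"
  assumes f: "\<And>k. f k integrable_on S" and h: "h integrable_on S" and N: "negligible N"
    and le: "\<And>k x. x \<in> S \<Longrightarrow> norm (f k x) \<le> h x"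
    and conv: "\<And>x. x \<in> S - N \<Longrightarrow> (\<lambda>k. f k x) \<longlonglongrightarrow> g x"
  shows "g integrable_on S" "(\<lambda>k. integral S (f k)) \<longlonglongrightarrow> integral S g"
proof -
  define f' where "f' k x = (if x \<in> N then 0 else f k x)" for k x
  define g' where "g' x = (if x \<in> N then 0 else g x)" for x
  have f': "f' k integrable_on S" for k
    by (rule integrable_spike[OF f N]) (auto simp: f'_def)
  have h0: "0 \<le> h x" if "x \<in> S" for x using le[OF that] norm_ge_zero order_trans by blast
  have *: "norm (f' k x) \<le> h x" "(\<lambda>k. f' k x) \<longlonglongrightarrow> g' x" if "x \<in> S" for k x
    using le[OF that] h0[OF that] conv[of x] that by (auto simp: f'_def g'_def)
  note dc = dominated_convergence[OF f' h *]
  show "g integrable_on S" by (rule integrable_spike[OF dc(1) N]) (auto simp: g'_def)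
  have "integral S (f' k) = integral S (f k)" for k
    by (rule integral_spike[OF N]) (auto simp: f'_def)
  moreover have "integral S g' = integral S g"
    by (rule integral_spike[OF N]) (auto simp: g'_def)
  ultimately show "(\<lambda>k. integral S (f k)) \<longlonglongrightarrow> integral S g" using dc(2) by simp
qed

text \<open>Projecting continuous approximants onto the closed ball of radius \<open>R\<close> keeps
  them continuous and imposes the bound, without disturbing the limit, which lies in the ball
  already. The uniform bound is what dominated convergence needs later.\<close>

lemma bounded_measurable_continuous_approximation:
  fixes z :: "real \<Rightarrow> 'a::euclidean_space"
  assumes z: "z \<in> borel_measurable (lebesgue_on {a..b})" and R: "\<And>t. t \<in> {a..b} \<Longrightarrow> norm (z t) \<le> R" "0 \<le> R"
  obtains N w where "negligible N" "\<And>n::nat. continuous_on UNIV (w n)" "\<And>n t. norm (w n t) \<le> R"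
    "\<And>t. t \<in> {a..b} - N \<Longrightarrow> (\<lambda>n. w n t) \<longlonglongrightarrow> z t"
proof -
  have "z measurable_on {a..b}"
    using z measurable_on_iff_borel_measurable[of "{a..b}" z] by simp
  then obtain N g where g: "negligible N" "\<And>n. continuous_on UNIV (g n)"
    "\<And>x. x \<notin> N \<Longrightarrow> (\<lambda>n. g n x) \<longlonglongrightarrow> (if x \<in> {a..b} then z x else 0)"
    unfolding measurable_on_def by metis
  have c: "convex (cball (0::'a) R)" "closed (cball (0::'a) R)" "cball (0::'a) R \<noteq> {}" using R(2) by auto
  note cp = continuous_on_closest_point[OF c]
  show thesis
  proof (rule that[OF g(1), of "\<lambda>n t. closest_point (cball 0 R) (g n t)"])
    show "continuous_on UNIV (\<lambda>t. closest_point (cball 0 R) (g n t))" for n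
      by (rule continuous_on_compose2[OF cp g(2)]) auto
    show "norm (closest_point (cball 0 R) (g n t)) \<le> R" for n t
      using closest_point_in_set[OF c(2,3), of "g n t"] by simp
    fix t assume t: "t \<in> {a..b} - N"
    have "(\<lambda>n. g n t) \<longlonglongrightarrow> z t" using g(3)[of t] t by auto
    then have "(\<lambda>n. closest_point (cball 0 R) (g n t)) \<longlonglongrightarrow> closest_point (cball 0 R) (z t)"
      by (rule continuous_on_tendsto_compose[OF cp[of UNIV]]) auto
    then show "(\<lambda>n. closest_point (cball 0 R) (g n t)) \<longlonglongrightarrow> z t"
      using closest_point_self[of "z t" "cball 0 R"] R(1)[of t] t by simp
  qed
qed

lemma absolutely_integrable_inner_bounded:
  fixes f g :: "real \<Rightarrow> 'a::euclidean_space"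
  assumes "f \<in> borel_measurable (lebesgue_on {a..b})" "\<And>t. t \<in> {a..b} \<Longrightarrow> norm (f t) \<le> C"
    and "g absolutely_integrable_on {a..b}"
  shows "(\<lambda>t. f t \<bullet> g t) absolutely_integrable_on {a..b}"
proof -
  have "bilinear ((\<bullet>) :: 'a \<Rightarrow> 'a \<Rightarrow> real)"
    by (simp add: bilinear_conv_bounded_bilinear bounded_bilinear_inner)
  moreover have "bounded (f ` {a..b})" using assms(2) unfolding bounded_iff by blast
  ultimately show ?thesis
    using absolutely_integrable_bounded_measurable_product[OF _ assms(1) _ _ assms(3)] by simp
qed

text \<open>Weak convergence tested on step functions: convergence of the primitives handles step
  functions, and the uniform bound \<open>B\<close> on the L1 norms handles the uniform distance
  from \<open>\<phi>\<close> to a step function.\<close>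

lemma integral_inner_continuous_tendsto_0:
  fixes \<phi> :: "real \<Rightarrow> 'a::euclidean_space"
  assumes \<phi>: "continuous_on {a..b} \<phi>" and "a \<le> b"
    and g: "\<And>k::nat. g k absolutely_integrable_on {a..b}"
    and B: "\<And>k. integral {a..b} (\<lambda>t. norm (g k t)) \<le> B"
    and lim: "\<And>s. s \<in> {a..b} \<Longrightarrow> (\<lambda>k. integral {a..s} (g k)) \<longlonglongrightarrow> 0"
  shows "(\<lambda>k. integral {a..b} (\<lambda>t. \<phi> t \<bullet> g k t)) \<longlonglongrightarrow> 0"
proof (rule LIMSEQ_I)
  fix e :: real assume e: "e > 0"
  have ngi: "(\<lambda>t. norm (g k t)) integrable_on {s..t}" if "{s..t} \<subseteq> {a..b}" for k s t
    using set_integrable_norm[OF g[of k]] that by (rule absolutely_integrable_subinterval)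
  have gi: "g k integrable_on {s..t}" if "{s..t} \<subseteq> {a..b}" for k s t
    using g[of k] that by (rule absolutely_integrable_subinterval)
  obtain C where C: "\<And>t. t \<in> {a..b} \<Longrightarrow> norm (\<phi> t) \<le> C"
    using continuous_on_Icc_bounded[OF \<phi>] by blast
  have \<phi>g: "(\<lambda>t. \<phi> t \<bullet> g k t) absolutely_integrable_on {a..b}" for k
    by (rule absolutely_integrable_inner_bounded[OF _ C g])
       (use \<phi> in \<open>auto intro!: continuous_imp_measurable_on_sets_lebesgue\<close>)
  have \<phi>gi: "(\<lambda>t. \<phi> t \<bullet> g k t) integrable_on {s..t}" if "{s..t} \<subseteq> {a..b}" for k s t
    using \<phi>g[of k] that by (rule absolutely_integrable_subinterval)
  have "0 \<le> integral {a..b} (\<lambda>t. norm (g 0 t))"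
    by (rule integral_nonneg) (use ngi in auto)
  then have B0: "0 \<le> B" using B[of 0] by linarith
  define \<epsilon> where "\<epsilon> = e / (2 * (B + 1))"
  have \<epsilon>: "\<epsilon> > 0" "\<epsilon> * B < e / 2" using e B0 by (auto simp: \<epsilon>_def field_simps)
  have "uniformly_continuous_on {a..b} \<phi>"
    using \<phi> by (rule compact_uniformly_continuous) simp
  then obtain d where d: "d > 0" "\<And>s t. s \<in> {a..b} \<Longrightarrow> t \<in> {a..b} \<Longrightarrow> dist t s < d \<Longrightarrow> dist (\<phi> t) (\<phi> s) < \<epsilon>"
    using \<epsilon>(1) unfolding uniformly_continuous_on_def by metis
  obtain n0 :: nat where "(b - a) / d < real n0" using reals_Archimedean2 by blast
  then have n: "(b - a) / d < real (Suc n0)" "Suc n0 > 0" by auto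
  define n where "n = Suc n0"
  note n = n[folded n_def]
  define \<tau> where "\<tau> i = a + (b - a) * real i / real n" for i
  have \<tau>0: "\<tau> 0 = a" "\<tau> n = b" using n by (auto simp: \<tau>_def)
  have \<tau>mono: "\<tau> i \<le> \<tau> j" if "i \<le> j" for i j
    unfolding \<tau>_def using that \<open>a \<le> b\<close> n by (intro add_left_mono divide_right_mono mult_left_mono) auto
  have \<tau>ab: "\<tau> i \<in> {a..b}" if "i \<le> n" for i using \<tau>mono[of 0 i] \<tau>mono[OF that] \<tau>0 by auto
  have \<tau>step: "\<tau> (Suc i) - \<tau> i < d" for i
  proof -
    have "\<tau> (Suc i) - \<tau> i = (b - a) / real n" unfolding \<tau>_def by (simp add: diff_divide_distrib[symmetric] right_diff_distrib[symmetric])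
    also have "\<dots> < d" using n d(1) by (simp add: field_simps)
    finally show ?thesis .
  qed
  define S where "S k = (\<Sum>i<n. \<phi> (\<tau> i) \<bullet> (integral {a..\<tau> (Suc i)} (g k) - integral {a..\<tau> i} (g k)))" for k
  \<comment> \<open>The error of replacing \<open>\<phi>\<close> by its value at the left grid
    point, accumulated over the first m cells: on each cell \<open>\<phi>\<close> varies by less
    than \<open>\<epsilon>\<close>.\<close>
  have est: "\<bar>integral {a..\<tau> m} (\<lambda>t. \<phi> t \<bullet> g k t)
      - (\<Sum>i<m. \<phi> (\<tau> i) \<bullet> (integral {a..\<tau> (Suc i)} (g k) - integral {a..\<tau> i} (g k)))\<bar>
      \<le> \<epsilon> * integral {a..\<tau> m} (\<lambda>t. norm (g k t))" if "m \<le> n" for m k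
    using that
  proof (induction m)
    case 0
    then show ?case by (simp add: \<tau>0)
  next
    case (Suc m)
    let ?I = "{\<tau> m..\<tau> (Suc m)}"
    have m: "a \<le> \<tau> m" "\<tau> m \<le> \<tau> (Suc m)" "\<tau> (Suc m) \<le> b"
      using \<tau>ab[of m] \<tau>ab[of "Suc m"] \<tau>mono[of m "Suc m"] Suc.prems by auto
    have sub: "{a..\<tau> (Suc m)} \<subseteq> {a..b}" "?I \<subseteq> {a..b}" using m by auto
    note comb = HK_integral_combine[OF m(1,2)]
    have "integral ?I (\<lambda>t. \<phi> t \<bullet> g k t) - \<phi> (\<tau> m) \<bullet> integral ?I (g k)
       = integral ?I (\<lambda>t. (\<phi> t - \<phi> (\<tau> m)) \<bullet> g k t)"
    proof -
      have "((\<lambda>t. \<phi> (\<tau> m) \<bullet> g k t) has_integral \<phi> (\<tau> m) \<bullet> integral ?I (g k)) ?I"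
        using has_integral_linear[OF integrable_integral[OF gi[OF sub(2)]] bounded_linear_inner_right]
        by (simp add: o_def)
      from has_integral_diff[OF integrable_integral[OF \<phi>gi[OF sub(2), of k]] this]
      show ?thesis by (simp add: inner_diff_left integral_unique)
    qed
    moreover have "norm (integral ?I (\<lambda>t. (\<phi> t - \<phi> (\<tau> m)) \<bullet> g k t))
        \<le> integral ?I (\<lambda>t. \<epsilon> * norm (g k t))"
    proof (rule integral_norm_bound_integral)
      have "(\<lambda>t. \<phi> t \<bullet> g k t - \<phi> (\<tau> m) \<bullet> g k t) integrable_on ?I"
        using integrable_linear[OF gi[OF sub(2)] bounded_linear_inner_right]
        by (intro HK_integrable_diff \<phi>gi sub) (simp add: o_def)
      then show "(\<lambda>t. (\<phi> t - \<phi> (\<tau> m)) \<bullet> g k t) integrable_on ?I"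
        by (simp add: inner_diff_left)
      show "(\<lambda>t. \<epsilon> * norm (g k t)) integrable_on ?I"
        using ngi[OF sub(2)] by (rule integrable_on_mult_right)
      fix t assume t: "t \<in> ?I"
      have "dist (\<phi> t) (\<phi> (\<tau> m)) < \<epsilon>"
        using d(2)[of "\<tau> m" t] \<tau>step[of m] t m by (auto simp: dist_real_def)
      then have "norm (\<phi> t - \<phi> (\<tau> m)) * norm (g k t) \<le> \<epsilon> * norm (g k t)"
        by (intro mult_right_mono) (auto simp: dist_norm)
      then show "norm ((\<phi> t - \<phi> (\<tau> m)) \<bullet> g k t) \<le> \<epsilon> * norm (g k t)"
        using Cauchy_Schwarz_ineq2[of "\<phi> t - \<phi> (\<tau> m)" "g k t"] unfolding real_norm_def by linarith
    qed
    moreover have "integral ?I (\<lambda>t. \<epsilon> * norm (g k t)) = \<epsilon> * integral ?I (\<lambda>t. norm (g k t))"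
      by (rule integral_mult_right)
    moreover note comb[OF \<phi>gi[OF sub(1)], of k] comb[OF gi[OF sub(1)], of k] comb[OF ngi[OF sub(1)], of k]
    moreover have "\<bar>integral {a..\<tau> m} (\<lambda>t. \<phi> t \<bullet> g k t)
      - (\<Sum>i<m. \<phi> (\<tau> i) \<bullet> (integral {a..\<tau> (Suc i)} (g k) - integral {a..\<tau> i} (g k)))\<bar>
      \<le> \<epsilon> * integral {a..\<tau> m} (\<lambda>t. norm (g k t))" using Suc by simp
    moreover have "\<epsilon> * (integral {a..\<tau> m} (\<lambda>t. norm (g k t)) + integral ?I (\<lambda>t. norm (g k t)))
      = \<epsilon> * integral {a..\<tau> m} (\<lambda>t. norm (g k t)) + \<epsilon> * integral ?I (\<lambda>t. norm (g k t))"
      by (rule distrib_left)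
    moreover have "integral {a..\<tau> (Suc m)} (g k) - integral {a..\<tau> m} (g k) = integral ?I (g k)"
      using comb[OF gi[OF sub(1)], of k] by (simp add: algebra_simps)
    ultimately show ?case unfolding sum.lessThan_Suc real_norm_def by (smt (verit))
  qed
  have "S \<longlonglongrightarrow> (\<Sum>i<n. \<phi> (\<tau> i) \<bullet> (0 - 0))"
    unfolding S_def by (intro tendsto_intros lim \<tau>ab) auto
  then have "S \<longlonglongrightarrow> 0" by simp
  then obtain k0 where k0: "\<And>k. k \<ge> k0 \<Longrightarrow> norm (S k - 0) < e / 2"
    using LIMSEQ_D[of S 0 "e / 2"] e by auto
  show "\<exists>no. \<forall>k\<ge>no. norm (integral {a..b} (\<lambda>t. \<phi> t \<bullet> g k t) - 0) < e"
  proof (intro exI[of _ k0] allI impI)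
    fix k assume "k0 \<le> k"
    have "\<epsilon> * integral {a..b} (\<lambda>t. norm (g k t)) \<le> \<epsilon> * B" using B \<epsilon>(1) by (intro mult_left_mono) auto
    then show "norm (integral {a..b} (\<lambda>t. \<phi> t \<bullet> g k t) - 0) < e"
      using est[of n k] k0[OF \<open>k0 \<le> k\<close>] \<epsilon>(2) unfolding \<tau>0 S_def real_norm_def by linarith
  qed
qed

text \<open>\<open>H\<close> need not be uniformly continuous globally. From some index on all
  arguments lie in the ball of radius R + 1, which is compact.\<close>

lemma uniform_limit_continuous_composition:
  fixes H :: "'c::euclidean_space \<times> 'a::euclidean_space \<Rightarrow> 'b::metric_space"
  assumes H: "continuous_on UNIV H" and y: "continuous_on {a..b::real} y" and x0: "continuous_on {a..b} x0"
    and x: "uniform_limit {a..b} x x0 sequentially"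
  shows "uniform_limit {a..b} (\<lambda>k t. H (y t, x k t)) (\<lambda>t. H (y t, x0 t)) sequentially"
proof (rule uniform_limitI)
  fix e :: real assume e: "e > 0"
  obtain R where R: "\<And>t. t \<in> {a..b} \<Longrightarrow> norm (y t, x0 t) \<le> R"
    using continuous_on_Icc_bounded[OF continuous_on_Pair[OF y x0]] by blast
  have "uniformly_continuous_on (cball 0 (R + 1)) H"
    by (rule compact_uniformly_continuous[OF continuous_on_subset[OF H]]) auto
  then obtain d where d: "d > 0" "\<And>z z'. z \<in> cball 0 (R + 1) \<Longrightarrow> z' \<in> cball 0 (R + 1) \<Longrightarrow> dist z' z < d \<Longrightarrow> dist (H z') (H z) < e"
    unfolding uniformly_continuous_on_def using e by metis
  have "\<forall>\<^sub>F k in sequentially. \<forall>t\<in>{a..b}. dist (x k t) (x0 t) < min d 1"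
    using x d(1) by (intro uniform_limitD) auto
  then show "\<forall>\<^sub>F k in sequentially. \<forall>t\<in>{a..b}. dist (H (y t, x k t)) (H (y t, x0 t)) < e"
  proof eventually_elim
    case (elim k)
    show ?case
    proof
      fix t assume t: "t \<in> {a..b}"
      have dd: "dist (y t, x k t) (y t, x0 t) < min d 1" using elim t by (auto simp: dist_Pair_Pair)
      have "norm (y t, x k t) \<le> norm (y t, x0 t) + dist (y t, x k t) (y t, x0 t)"
        by (metis dist_norm norm_triangle_sub add.commute)
      then have "(y t, x k t) \<in> cball 0 (R + 1)" "(y t, x0 t) \<in> cball 0 (R + 1)"
        using R[OF t] dd by auto
      then show "dist (H (y t, x k t)) (H (y t, x0 t)) < e" using d(2) dd by auto
    qed
  qed
qed

lemma
  fixes H :: "real \<Rightarrow> 'a::euclidean_space \<Rightarrow> 'a \<Rightarrow> real \<Rightarrow> 'b::metric_space"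
  assumes H: "continuous_on UNIV (\<lambda>(t, x, p, r). H t x p r)"
    and p: "continuous_on {a..b} p" and q: "continuous_on {a..b} q" and y: "continuous_on {a..b} y"
  shows continuous_on_integrand: "continuous_on {a..b} (\<lambda>t. H t (y t) (p t) (q t))"
    and uniform_limit_integrand: "uniform_limit {a..b} x y sequentially \<Longrightarrow>
      uniform_limit {a..b} (\<lambda>k t. H t (x k t) (p t) (q t)) (\<lambda>t. H t (y t) (p t) (q t)) sequentially"
proof -
  have "continuous_on {a..b} (\<lambda>t. (\<lambda>(t, x, p, r). H t x p r) (t, y t, p t, q t))"
    by (rule continuous_on_compose2[OF H]) (auto intro!: continuous_intros p q y)
  then show "continuous_on {a..b} (\<lambda>t. H t (y t) (p t) (q t))" by simp
  have "continuous_on UNIV (\<lambda>z. (\<lambda>(t, x, p, r). H t x p r) (fst (fst z), snd z, fst (snd (fst z)), snd (snd (fst z))))"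
    by (rule continuous_on_compose2[OF H]) (auto intro!: continuous_intros)
  moreover have "continuous_on {a..b} (\<lambda>t. (t, p t, q t))" by (intro continuous_intros p q)
  ultimately show "uniform_limit {a..b} (\<lambda>k t. H t (x k t) (p t) (q t)) (\<lambda>t. H t (y t) (p t) (q t)) sequentially"
    if "uniform_limit {a..b} x y sequentially"
    using uniform_limit_continuous_composition[OF _ _ y that] by fastforce
qed

section \<open>Lower limits of bounded sequences of functions\<close>

definition tail_inf :: "(nat \<Rightarrow> real \<Rightarrow> real) \<Rightarrow> nat \<Rightarrow> real \<Rightarrow> real" where
  "tail_inf u m t = (INF k\<in>{m..}. u k t)"

text \<open>The lower limit, written with real suprema and infima; it has this meaning for bounded
  sequences, hence the bound \<open>M\<close> in the facts that follow. It is reached through tail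
  infima because they increase with m, so a monotone integrand evaluated at them increases as
  well.\<close>

definition lower_limit :: "(nat \<Rightarrow> real \<Rightarrow> real) \<Rightarrow> real \<Rightarrow> real" where
  "lower_limit u t = (SUP m. tail_inf u m t)"

lemma
  assumes "\<And>k. \<bar>u k t\<bar> \<le> M"
  shows tail_inf_le: "m \<le> k \<Longrightarrow> tail_inf u m t \<le> u k t"
    and abs_tail_inf_le: "\<bar>tail_inf u m t\<bar> \<le> M"
    and tail_inf_mono: "m \<le> n \<Longrightarrow> tail_inf u m t \<le> tail_inf u n t"
    and tail_inf_tendsto: "(\<lambda>m. tail_inf u m t) \<longlonglongrightarrow> lower_limit u t"
    and abs_lower_limit_le: "\<bar>lower_limit u t\<bar> \<le> M"
    and tail_inf_geI: "(\<And>k. m \<le> k \<Longrightarrow> c \<le> u k t) \<Longrightarrow> c \<le> tail_inf u m t"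
    and tail_inf_le_lower_limit: "tail_inf u m t \<le> lower_limit u t"
proof -
  have bd: "bdd_below ((\<lambda>k. u k t) ` {m..})" for m
    using assms by (intro bdd_belowI[of _ "-M"]) (auto simp: abs_le_iff minus_le_iff)
  show le: "tail_inf u m t \<le> u k t" if "m \<le> k" for m k
    unfolding tail_inf_def using bd that by (intro cINF_lower) auto
  show geI: "c \<le> tail_inf u m t" if "\<And>k. m \<le> k \<Longrightarrow> c \<le> u k t" for c m
    unfolding tail_inf_def using that by (intro cINF_greatest) auto
  have M: "- M \<le> u k t" "u k t \<le> M" for k using assms[of k] by auto
  then show ab: "\<bar>tail_inf u m t\<bar> \<le> M" for m
  proof -
    have "tail_inf u m t \<le> M" using le[of m m] M(2)[of m] by simp
    moreover have "- M \<le> tail_inf u m t" by (rule geI) (rule M(1))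
    ultimately show ?thesis by simp
  qed
  show mono: "tail_inf u m t \<le> tail_inf u n t" if "m \<le> n" for m n
    using le that by (intro geI) auto
  have bdd: "bdd_above (range (\<lambda>m. tail_inf u m t))"
    using ab by (intro bdd_aboveI[of _ M]) (auto simp: abs_le_iff)
  show lim: "(\<lambda>m. tail_inf u m t) \<longlonglongrightarrow> lower_limit u t"
    unfolding lower_limit_def using mono by (intro LIMSEQ_incseq_SUP bdd) (auto simp: incseq_def)
  show "\<bar>lower_limit u t\<bar> \<le> M"
    using tendsto_rabs[OF lim] ab by (intro LIMSEQ_le_const2) auto
  show "tail_inf u m t \<le> lower_limit u t"
    unfolding lower_limit_def using bdd by (intro cSUP_upper) auto
qed

lemma tail_inf_measurable:
  assumes "\<And>k. u k \<in> borel_measurable (lebesgue_on {a..b})" "\<And>k t. t \<in> {a..b} \<Longrightarrow> \<bar>u k t\<bar> \<le> M"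
  shows "tail_inf u m \<in> borel_measurable (lebesgue_on {a..b})"
    and "lower_limit u \<in> borel_measurable (lebesgue_on {a..b})"
proof -
  have "tail_inf u m = (\<lambda>t. INF k\<in>{m..}. u k t)" for m by (simp add: tail_inf_def fun_eq_iff)
  moreover have "bdd_below ((\<lambda>k. u k t) ` {m..})" if "t \<in> {a..b}" for m t
    using assms(2)[OF that] by (intro bdd_belowI[of _ "-M"]) (auto simp: abs_le_iff minus_le_iff)
  ultimately show m: "tail_inf u m \<in> borel_measurable (lebesgue_on {a..b})" for m
    using assms(1) by (auto intro!: borel_measurable_cINF simp: countable_Collect)
  show "lower_limit u \<in> borel_measurable (lebesgue_on {a..b})"
  proof (rule borel_measurable_LIMSEQ_metric[OF m])
    show "(\<lambda>i. tail_inf u i t) \<longlonglongrightarrow> lower_limit u t" if "t \<in> space (lebesgue_on {a..b})" for t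
      using assms(2)[of t] that by (intro tail_inf_tendsto) auto
  qed
qed

lemma bounded_on_compact_arguments:
  fixes H :: "real \<Rightarrow> 'a::euclidean_space \<Rightarrow> 'a \<Rightarrow> real \<Rightarrow> 'b::real_normed_vector"
  assumes H: "continuous_on UNIV (\<lambda>(t, x, p, r). H t x p r)" and x: "continuous_on {a..b} x"
  obtains C where "\<And>t p r. t \<in> {a..b} \<Longrightarrow> norm p \<le> R \<Longrightarrow> \<bar>r\<bar> \<le> M \<Longrightarrow> norm (H t (x t) p r) \<le> C" "C \<ge> 0"
proof -
  let ?K = "{a..b} \<times> cball (0::'a) R \<times> {-M..M}"
  have "continuous_on ?K (\<lambda>z. (\<lambda>(t, x, p, r). H t x p r) (fst z, x (fst z), fst (snd z), snd (snd z)))"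
    by (rule continuous_on_compose2[OF H])
       (auto intro!: continuous_intros continuous_on_compose2[OF x])
  then have "bounded ((\<lambda>z. (\<lambda>(t, x, p, r). H t x p r) (fst z, x (fst z), fst (snd z), snd (snd z))) ` ?K)"
    by (intro compact_imp_bounded compact_continuous_image compact_Times) auto
  then obtain C where C: "\<forall>w \<in> (\<lambda>z. (\<lambda>(t, x, p, r). H t x p r) (fst z, x (fst z), fst (snd z), snd (snd z))) ` ?K. norm w \<le> C"
    unfolding bounded_iff by blast
  show thesis
  proof
    fix t p r assume "t \<in> {a..b}" "norm (p::'a) \<le> R" "\<bar>r::real\<bar> \<le> M"
    then have "(t, p, r) \<in> ?K" by (auto simp: abs_le_iff minus_le_iff)
    from bspec[OF C imageI[OF this]] show "norm (H t (x t) p r) \<le> max 0 C" by simp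
  qed simp
qed

lemma continuous_composition_measurable:
  fixes H :: "real \<Rightarrow> 'a::euclidean_space \<Rightarrow> 'a \<Rightarrow> real \<Rightarrow> 'b::euclidean_space"
  assumes H: "continuous_on UNIV (\<lambda>(t, x, p, r). H t x p r)"
    and x: "continuous_on {a..b} x" and p: "p \<in> borel_measurable (lebesgue_on {a..b})"
    and r: "r \<in> borel_measurable (lebesgue_on {a..b})"
  shows "(\<lambda>t. H t (x t) (p t) (r t)) \<in> borel_measurable (lebesgue_on {a..b})"
proof -
  have t: "(\<lambda>t. t) \<in> borel_measurable (lebesgue_on {a..b})" "x \<in> borel_measurable (lebesgue_on {a..b})"
    using x by (auto intro!: continuous_imp_measurable_on_sets_lebesgue continuous_intros)
  have "(\<lambda>t. (t, x t, p t, r t)) \<in> borel_measurable (lebesgue_on {a..b})"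
    using t p r by (intro borel_measurable_Pair)
  then show ?thesis
    using measurable_compose[OF _ borel_measurable_continuous_onI[OF H], of "\<lambda>t. (t, x t, p t, r t)"] by simp
qed

lemma absolutely_integrable_imp_measurable:
  fixes g :: "real \<Rightarrow> 'a::euclidean_space"
  shows "g absolutely_integrable_on {a..b} \<Longrightarrow> g \<in> borel_measurable (lebesgue_on {a..b})"
  using Equivalence_Lebesgue_Henstock_Integration.absolutely_integrable_measurable[of "{a..b}" g] by simp

section \<open>Lower semicontinuity for integrands convex in the velocity and monotone in the
  state\<close>

locale convex_integrand =
  fixes F :: "real \<Rightarrow> 'a::euclidean_space \<Rightarrow> 'a \<Rightarrow> real \<Rightarrow> real"
    and P :: "real \<Rightarrow> 'a \<Rightarrow> 'a \<Rightarrow> real \<Rightarrow> 'a"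
    and a b C \<Lambda> M :: real
  assumes ab: "a \<le> b"
    and F_cont: "continuous_on UNIV (\<lambda>(t, x, p, r). F t x p r)"
    and P_cont: "continuous_on UNIV (\<lambda>(t, x, p, r). P t x p r)"
    and subgradient: "\<And>t x p q r. F t x p r + P t x p r \<bullet> (q - p) \<le> F t x q r"
    and F_mono: "\<And>t x p r s. t \<in> {a..b} \<Longrightarrow> r \<le> s \<Longrightarrow> F t x p r \<le> F t x p s"
    and F_lip: "\<And>t x p r s. t \<in> {a..b} \<Longrightarrow> r \<le> s \<Longrightarrow> F t x p s \<le> F t x p r + \<Lambda> * (s - r)"
    and F_lower: "\<And>t x p r. t \<in> {a..b} \<Longrightarrow> \<bar>r\<bar> \<le> M \<Longrightarrow> - C \<le> F t x p r"

text \<open>Weak convergence of the velocities is recorded as convergence of their primitives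
  together with an L1 bound. The functions \<open>u k\<close> are only measurable and uniformly
  bounded; no convergence of them is assumed.\<close>

locale convergent_curves = convex_integrand F P a b C \<Lambda> M
  for F :: "real \<Rightarrow> 'a::euclidean_space \<Rightarrow> 'a \<Rightarrow> real \<Rightarrow> real" and P a b C \<Lambda> M +
  fixes x v :: "nat \<Rightarrow> real \<Rightarrow> 'a" and x0 v0 :: "real \<Rightarrow> 'a" and u :: "nat \<Rightarrow> real \<Rightarrow> real" and B c :: real
  assumes x_cont: "\<And>k. continuous_on {a..b} (x k)" and x0_cont: "continuous_on {a..b} x0"
    and x_lim: "uniform_limit {a..b} x x0 sequentially"
    and v: "\<And>k. v k absolutely_integrable_on {a..b}" and v0: "v0 absolutely_integrable_on {a..b}"
    and v_bound: "\<And>k. integral {a..b} (\<lambda>t. norm (v k t)) \<le> B"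
    and v_lim: "\<And>s. s \<in> {a..b} \<Longrightarrow> (\<lambda>k. integral {a..s} (v k)) \<longlonglongrightarrow> integral {a..s} v0"
    and u_meas: "\<And>k. u k \<in> borel_measurable (lebesgue_on {a..b})"
    and u_bound: "\<And>k t. t \<in> {a..b} \<Longrightarrow> \<bar>u k t\<bar> \<le> M"
    and F_int: "\<And>k. (\<lambda>t. F t (x k t) (v k t) (u k t)) integrable_on {a..b}"
    and F_le: "\<exists>\<^sub>F k in sequentially. integral {a..b} (\<lambda>t. F t (x k t) (v k t) (u k t)) \<le> c"
begin

lemma M_nonneg: "0 \<le> M"
  using u_bound[of a 0] ab by (auto intro: order_trans[OF abs_ge_zero])

lemma v_int: "v k integrable_on {a..b}" "(\<lambda>t. norm (v k t)) integrable_on {a..b}"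
  "v0 integrable_on {a..b}" "(\<lambda>t. norm (v0 t)) integrable_on {a..b}"
  using v v0 by (auto simp: absolutely_integrable_on_def)

lemma P_inner_integrable:
  assumes x: "continuous_on {a..b} y" and p: "p \<in> borel_measurable (lebesgue_on {a..b})"
    and r: "r \<in> borel_measurable (lebesgue_on {a..b})"
    and R: "\<And>t. t \<in> {a..b} \<Longrightarrow> norm (p t) \<le> R" "\<And>t. t \<in> {a..b} \<Longrightarrow> \<bar>r t\<bar> \<le> M'"
    and w: "w absolutely_integrable_on {a..b}"
  shows "(\<lambda>t. P t (y t) (p t) (r t) \<bullet> w t) absolutely_integrable_on {a..b}"
proof -
  obtain D where D: "\<And>t p r. t \<in> {a..b} \<Longrightarrow> norm p \<le> R \<Longrightarrow> \<bar>r\<bar> \<le> M' \<Longrightarrow> norm (P t (y t) p r) \<le> D"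
    using bounded_on_compact_arguments[OF P_cont x] by metis
  show ?thesis
    by (rule absolutely_integrable_inner_bounded[OF continuous_composition_measurable[OF P_cont x p r] D w])
       (use R in auto)
qed

text \<open>With \<open>p\<close> and \<open>q\<close> fixed and continuous, the minorant is affine
  in the velocity and its coefficients converge uniformly, so weak convergence suffices for the
  limit. The penalty involves only the tail infimum from m on, hence it does not change with
  k.\<close>

lemma test_inequality:
  assumes p: "continuous_on UNIV p" and q: "continuous_on UNIV q"
  shows "integral {a..b} (\<lambda>t. F t (x0 t) (p t) (q t) + P t (x0 t) (p t) (q t) \<bullet> (v0 t - p t))
    - \<Lambda> * integral {a..b} (\<lambda>t. max 0 (q t - tail_inf u m t)) \<le> c"
proof -
  have pq: "continuous_on {a..b} p" "continuous_on {a..b} q" using p q by (auto intro: continuous_on_subset)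
  have pq_meas: "p \<in> borel_measurable (lebesgue_on {a..b})" "q \<in> borel_measurable (lebesgue_on {a..b})"
    using pq by (auto intro!: continuous_imp_measurable_on_sets_lebesgue)
  have p_abs: "p absolutely_integrable_on {a..b}" using absolutely_integrable_continuous_real[OF pq(1)] .
  obtain R where R: "\<And>t. t \<in> {a..b} \<Longrightarrow> norm (p t) \<le> R"
    using continuous_on_Icc_bounded[OF pq(1)] by blast
  obtain Q where Q: "\<And>t. t \<in> {a..b} \<Longrightarrow> \<bar>q t\<bar> \<le> Q"
    using continuous_on_Icc_bounded[OF pq(2)] unfolding real_norm_def by blast
  define f where "f y t = F t (y t) (p t) (q t)" for y t
  define g where "g y t = P t (y t) (p t) (q t)" for y t
  have f_cont: "continuous_on {a..b} (f y)" and g_cont: "continuous_on {a..b} (g y)"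
    if "continuous_on {a..b} y" for y
    unfolding f_def[abs_def] g_def[abs_def]
    by (rule continuous_on_integrand[OF F_cont pq that], rule continuous_on_integrand[OF P_cont pq that])
  have f_unif: "uniform_limit {a..b} (\<lambda>k. f (x k)) (f x0) sequentially"
    and g_unif: "uniform_limit {a..b} (\<lambda>k. g (x k)) (g x0) sequentially"
    unfolding f_def[abs_def] g_def[abs_def]
    by (rule uniform_limit_integrand[OF F_cont pq x0_cont x_lim], rule uniform_limit_integrand[OF P_cont pq x0_cont x_lim])
  have gw: "(\<lambda>t. g y t \<bullet> w t) integrable_on {a..b}"
    if "continuous_on {a..b} y" "w absolutely_integrable_on {a..b}" for y w
    using P_inner_integrable[OF that(1) pq_meas R Q that(2)] unfolding g_def absolutely_integrable_on_def by blast
  note fi = integrable_continuous_real[OF f_cont]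
  define A where "A k = integral {a..b} (\<lambda>t. f (x k) t + g (x k) t \<bullet> (v k t - p t))" for k
  define A0 where "A0 = integral {a..b} (\<lambda>t. f x0 t + g x0 t \<bullet> (v0 t - p t))"
  define D where "D = \<Lambda> * integral {a..b} (\<lambda>t. max 0 (q t - tail_inf u m t))"
  have vp: "(\<lambda>t. v k t - p t) absolutely_integrable_on {a..b}" for k
    using v p_abs by (rule set_integral_diff)
  have v0p: "(\<lambda>t. v0 t - p t) absolutely_integrable_on {a..b}"
    using v0 p_abs by (rule set_integral_diff)
  have vv0: "(\<lambda>t. v k t - v0 t) absolutely_integrable_on {a..b}" for k
    using v v0 by (rule set_integral_diff)
  have tail_int: "(\<lambda>t. max 0 (q t - tail_inf u m t)) integrable_on {a..b}"
  proof -
    have "(\<lambda>t. max 0 (q t - tail_inf u m t)) absolutely_integrable_on {a..b}"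
    proof (rule measurable_bounded_by_integrable_imp_absolutely_integrable[where g = "\<lambda>_. Q + M"])
      show "(\<lambda>t. max 0 (q t - tail_inf u m t)) \<in> borel_measurable (lebesgue_on {a..b})"
        using pq_meas(2) tail_inf_measurable(1)[where u = u and m = m, OF u_meas u_bound]
        by (intro borel_measurable_max borel_measurable_diff) auto
      show "norm (max 0 (q t - tail_inf u m t)) \<le> Q + M" if "t \<in> {a..b}" for t
        using Q[OF that] abs_tail_inf_le[where u = u and t = t and m = m, OF u_bound[OF that]] by auto
    qed auto
    then show ?thesis using absolutely_integrable_on_def by blast
  qed
  have lower: "A k - D \<le> integral {a..b} (\<lambda>t. F t (x k t) (v k t) (u k t))" if "m \<le> k" for k
  proof -
    have i1: "(\<lambda>t. f (x k) t + g (x k) t \<bullet> (v k t - p t)) integrable_on {a..b}"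
      by (intro HK_integrable_add fi gw x_cont vp)
    have i2: "(\<lambda>t. \<Lambda> * max 0 (q t - tail_inf u m t)) integrable_on {a..b}"
      using tail_int by (rule integrable_on_mult_right)
    have "A k - D = integral {a..b} (\<lambda>t. (f (x k) t + g (x k) t \<bullet> (v k t - p t)) - \<Lambda> * max 0 (q t - tail_inf u m t))"
      unfolding A_def D_def HK_integral_diff[OF i1 i2] by simp
    also have "\<dots> \<le> integral {a..b} (\<lambda>t. F t (x k t) (v k t) (u k t))"
    proof (rule integral_le[OF HK_integrable_diff[OF i1 i2] F_int])
      fix t assume t: "t \<in> {a..b}"
      have tk: "tail_inf u m t \<le> u k t" using tail_inf_le[where u = u and t = t, OF u_bound[OF t] that] .
      \<comment> \<open>An intermediate state: descending from \<open>q t\<close> to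
        \<open>s\<close> costs \<open>\<Lambda>\<close> times the positive part, and ascending from
        \<open>s\<close> to \<open>u k t\<close> is free by monotonicity.\<close>
      define s where "s = min (q t) (tail_inf u m t)"
      have "f (x k) t + g (x k) t \<bullet> (v k t - p t) \<le> F t (x k t) (v k t) (q t)"
        unfolding f_def g_def by (rule subgradient)
      also have "\<dots> \<le> F t (x k t) (v k t) s + \<Lambda> * (q t - s)"
        by (rule F_lip[OF t]) (simp add: s_def)
      also have "F t (x k t) (v k t) s \<le> F t (x k t) (v k t) (u k t)"
        using tk by (intro F_mono[OF t]) (simp add: s_def)
      also have "q t - s = max 0 (q t - tail_inf u m t)" by (auto simp: s_def)
      finally show "(f (x k) t + g (x k) t \<bullet> (v k t - p t)) - \<Lambda> * max 0 (q t - tail_inf u m t)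
        \<le> F t (x k t) (v k t) (u k t)" by linarith
    qed
    finally show ?thesis .
  qed
  \<comment> \<open>Three limits and a constant. The difference of coefficients is uniformly small
    against L1-bounded velocities (\<open>?I2\<close>), and the limit coefficient is continuous and
    tested against a weakly null sequence (\<open>?I3\<close>).\<close>
  have A_lim: "A \<longlonglongrightarrow> A0"
  proof -
    let ?I2 = "\<lambda>k. integral {a..b} (\<lambda>t. (g (x k) t - g x0 t) \<bullet> (v k t - p t))"
    let ?I3 = "\<lambda>k. integral {a..b} (\<lambda>t. g x0 t \<bullet> (v k t - v0 t))"
    let ?I4 = "integral {a..b} (\<lambda>t. g x0 t \<bullet> (v0 t - p t))"
    obtain I J where IJ: "\<And>n. (f (x n) has_integral I n) {a..b}" "(f x0 has_integral J) {a..b}" "I \<longlonglongrightarrow> J"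
      using uniform_limit_integral[OF f_unif f_cont[OF x_cont]] by auto
    have I1: "(\<lambda>k. integral {a..b} (f (x k))) \<longlonglongrightarrow> integral {a..b} (f x0)"
      using IJ(3) unfolding integral_unique[OF IJ(1)] integral_unique[OF IJ(2)] .
    define E where "E = B + integral {a..b} (\<lambda>t. norm (p t))"
    have pn: "(\<lambda>t. norm (p t)) integrable_on {a..b}"
      by (intro integrable_continuous_real continuous_intros pq)
    have vpn: "(\<lambda>t. norm (v k t - p t)) integrable_on {a..b}" for k
      using vp[of k] by (auto simp: absolutely_integrable_on_def)
    have E: "integral {a..b} (\<lambda>t. norm (v k t - p t)) \<le> E" for k
    proof -
      have "integral {a..b} (\<lambda>t. norm (v k t - p t)) \<le> integral {a..b} (\<lambda>t. norm (v k t) + norm (p t))"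
        by (intro integral_le vpn HK_integrable_add v_int pn norm_triangle_ineq4)
      then show ?thesis
        unfolding HK_integral_add[OF v_int(2) pn] E_def using v_bound[of k] by linarith
    qed
    have I2: "(\<lambda>k. ?I2 k) \<longlonglongrightarrow> 0"
    proof (rule LIMSEQ_I)
      fix e :: real assume e: "e > 0"
      have "0 \<le> integral {a..b} (\<lambda>t. norm (v 0 t - p t))" by (rule integral_nonneg[OF vpn]) auto
      then have E0: "0 \<le> E" using E[of 0] by linarith
      define \<epsilon> where "\<epsilon> = e / (2 * (E + 1))"
      have \<epsilon>: "\<epsilon> > 0" "\<epsilon> * E < e" using e E0 by (auto simp: \<epsilon>_def field_simps add_nonneg_pos)
      have "\<forall>\<^sub>F k in sequentially. \<forall>t\<in>{a..b}. dist (g (x k) t) (g x0 t) < \<epsilon>"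
        using g_unif \<epsilon>(1) by (rule uniform_limitD)
      then obtain k0 where k0: "\<And>k t. k \<ge> k0 \<Longrightarrow> t \<in> {a..b} \<Longrightarrow> dist (g (x k) t) (g x0 t) < \<epsilon>"
        unfolding eventually_sequentially by blast
      show "\<exists>no. \<forall>k\<ge>no. norm (?I2 k - 0) < e"
      proof (intro exI[of _ k0] allI impI)
        fix k assume k: "k0 \<le> k"
        have "norm (?I2 k)
          \<le> integral {a..b} (\<lambda>t. \<epsilon> * norm (v k t - p t))"
        proof (rule integral_norm_bound_integral)
          show "(\<lambda>t. (g (x k) t - g x0 t) \<bullet> (v k t - p t)) integrable_on {a..b}"
            unfolding inner_diff_left[of "g (x k) _"]
            by (intro HK_integrable_diff gw vp x_cont x0_cont)
          show "(\<lambda>t. \<epsilon> * norm (v k t - p t)) integrable_on {a..b}" using vpn by (rule integrable_on_mult_right)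
          fix t assume t: "t \<in> {a..b}"
          have "norm (g (x k) t - g x0 t) * norm (v k t - p t) \<le> \<epsilon> * norm (v k t - p t)"
            using k0[OF k t] by (intro mult_right_mono) (auto simp: dist_norm)
          then show "norm ((g (x k) t - g x0 t) \<bullet> (v k t - p t)) \<le> \<epsilon> * norm (v k t - p t)"
            using Cauchy_Schwarz_ineq2[of "g (x k) t - g x0 t" "v k t - p t"] unfolding real_norm_def by linarith
        qed
        also have "\<dots> = \<epsilon> * integral {a..b} (\<lambda>t. norm (v k t - p t))" by (rule integral_mult_right)
        also have "\<dots> \<le> \<epsilon> * E" using E \<epsilon>(1) by (intro mult_left_mono) auto
        finally show "norm (?I2 k - 0) < e"
          using \<epsilon>(2) by simp
      qed
    qed
    have I3: "(\<lambda>k. ?I3 k) \<longlonglongrightarrow> 0"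
    proof (rule integral_inner_continuous_tendsto_0[OF g_cont[OF x0_cont] ab vv0])
      have n: "(\<lambda>t. norm (v k t - v0 t)) integrable_on {a..b}" for k
        using vv0[of k] by (auto simp: absolutely_integrable_on_def)
      show "integral {a..b} (\<lambda>t. norm (v k t - v0 t)) \<le> B + integral {a..b} (\<lambda>t. norm (v0 t))" for k
      proof -
        have "integral {a..b} (\<lambda>t. norm (v k t - v0 t)) \<le> integral {a..b} (\<lambda>t. norm (v k t) + norm (v0 t))"
          by (intro integral_le n HK_integrable_add v_int norm_triangle_ineq4)
        then show ?thesis
          unfolding HK_integral_add[OF v_int(2,4)] using v_bound[of k] by linarith
      qed
      fix s assume s: "s \<in> {a..b}"
      have sub: "{a..s} \<subseteq> {a..b}" using s by auto
      have "integral {a..s} (\<lambda>t. v k t - v0 t) = integral {a..s} (v k) - integral {a..s} v0" for k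
        by (intro HK_integral_diff
            absolutely_integrable_subinterval[OF v sub]
            absolutely_integrable_subinterval[OF v0 sub])
      moreover have "(\<lambda>k. integral {a..s} (v k) - integral {a..s} v0) \<longlonglongrightarrow> 0"
        using tendsto_diff[OF v_lim[OF s] tendsto_const[of "integral {a..s} v0"]] by simp
      ultimately show "(\<lambda>k. integral {a..s} (\<lambda>t. v k t - v0 t)) \<longlonglongrightarrow> 0" by simp
    qed
    have Ak: "A k = integral {a..b} (f (x k)) + ?I2 k
      + ?I3 k + ?I4" for k
    proof -
      have j1: "f (x k) integrable_on {a..b}" by (rule fi[OF x_cont])
      have j2: "(\<lambda>t. (g (x k) t - g x0 t) \<bullet> (v k t - p t)) integrable_on {a..b}"
        unfolding inner_diff_left[of "g (x k) _"]
        by (intro HK_integrable_diff gw vp x_cont x0_cont)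
      note j3 = gw[OF x0_cont vv0, of k] and j4 = gw[OF x0_cont v0p]
      have "((\<lambda>t. f (x k) t + (g (x k) t - g x0 t) \<bullet> (v k t - p t) + g x0 t \<bullet> (v k t - v0 t) + g x0 t \<bullet> (v0 t - p t))
        has_integral integral {a..b} (f (x k)) + ?I2 k
      + ?I3 k + ?I4) {a..b}"
        by (intro has_integral_add integrable_integral j1 j2 j3 j4)
      then show ?thesis
        unfolding A_def by (intro integral_unique) (simp add: algebra_simps)
    qed
    have lim: "(\<lambda>k. integral {a..b} (f (x k)) + ?I2 k
      + ?I3 k + ?I4)
      \<longlonglongrightarrow> integral {a..b} (f x0) + 0 + 0 + ?I4"
      by (intro tendsto_add I1 I2 I3 tendsto_const)
    have A0: "A0 = integral {a..b} (f x0) + ?I4"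
      unfolding A0_def by (rule HK_integral_add[OF fi[OF x0_cont] gw[OF x0_cont v0p]])
    show ?thesis unfolding A0 using lim by (simp add: Ak[abs_def])
  qed
  \<comment> \<open>The upper bound \<open>c\<close> holds only for infinitely many k, so it cannot
    be passed to the limit as an eventual inequality. If the claim failed, it would be violated from
    some index on.\<close>
  have "A0 - D \<le> c"
  proof (rule ccontr)
    assume "\<not> A0 - D \<le> c"
    then have "\<forall>\<^sub>F k in sequentially. c + D < A k"
      using order_tendstoD(1)[OF A_lim, of "c + D"] by simp
    then have "\<forall>\<^sub>F k in sequentially. \<not> integral {a..b} (\<lambda>t. F t (x k t) (v k t) (u k t)) \<le> c"
      using eventually_ge_at_top[of m]
    proof eventually_elim
      case (elim k)
      then show ?case using lower[of k] by linarith
    qed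
    then show False using F_le by (simp add: frequently_def)
  qed
  then show ?thesis unfolding A0_def D_def f_def g_def .
qed

text \<open>The bound is linear in the norm of \<open>v0\<close>, hence integrable, and justifies
  the limit from continuous to measurable test functions. In the limit \<open>q\<close> is the tail
  infimum itself, so the penalty disappears.\<close>

lemma bounded_measurable_test_inequality:
  fixes m :: nat
  assumes p: "p \<in> borel_measurable (lebesgue_on {a..b})" "\<And>t. t \<in> {a..b} \<Longrightarrow> norm (p t) \<le> R" "0 \<le> R"
  defines "h \<equiv> \<lambda>t. F t (x0 t) (p t) (tail_inf u m t) + P t (x0 t) (p t) (tail_inf u m t) \<bullet> (v0 t - p t)"
  shows "h integrable_on {a..b}" "integral {a..b} h \<le> c"
proof -
  have tail_meas: "tail_inf u m \<in> borel_measurable (lebesgue_on {a..b})"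
    by (rule tail_inf_measurable(1)[where u = u and m = m, OF u_meas u_bound])
  have tail_bound: "norm (tail_inf u m t) \<le> M" if "t \<in> {a..b}" for t
    using abs_tail_inf_le[where u = u and t = t and m = m, OF u_bound[OF that]] by simp
  obtain N1 pj where pj: "negligible N1" "\<And>n::nat. continuous_on UNIV (pj n)" "\<And>n t. norm (pj n t) \<le> R"
    "\<And>t. t \<in> {a..b} - N1 \<Longrightarrow> (\<lambda>n. pj n t) \<longlonglongrightarrow> p t"
    using bounded_measurable_continuous_approximation[OF p] by metis
  obtain N2 qj where qj: "negligible N2" "\<And>n::nat. continuous_on UNIV (qj n)" "\<And>n t. norm (qj n t) \<le> M"
    "\<And>t. t \<in> {a..b} - N2 \<Longrightarrow> (\<lambda>n. qj n t) \<longlonglongrightarrow> tail_inf u m t"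
    using bounded_measurable_continuous_approximation[OF tail_meas tail_bound M_nonneg] by metis
  obtain D1 where D1: "\<And>t p r. t \<in> {a..b} \<Longrightarrow> norm p \<le> R \<Longrightarrow> \<bar>r\<bar> \<le> M \<Longrightarrow> norm (F t (x0 t) p r) \<le> D1"
    using bounded_on_compact_arguments[OF F_cont x0_cont] by metis
  obtain D2 where D2: "\<And>t p r. t \<in> {a..b} \<Longrightarrow> norm p \<le> R \<Longrightarrow> \<bar>r\<bar> \<le> M \<Longrightarrow> norm (P t (x0 t) p r) \<le> D2" "0 \<le> D2"
    using bounded_on_compact_arguments[OF P_cont x0_cont] by metis
  let ?P = "\<lambda>j t. P t (x0 t) (pj j t) (qj j t) \<bullet> (v0 t - pj j t)" and ?F = "\<lambda>j t. F t (x0 t) (pj j t) (qj j t)"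
  define hj where "hj j t = ?F j t + ?P j t" for j t
  define ej where "ej j t = max 0 (qj j t - tail_inf u m t)" for j t
  have pq_meas: "pj j \<in> borel_measurable (lebesgue_on {a..b})" "qj j \<in> borel_measurable (lebesgue_on {a..b})" for j
    using pj(2) qj(2) by (auto intro!: continuous_imp_measurable_on_sets_lebesgue intro: continuous_on_subset)
  have pv: "(\<lambda>t. v0 t - pj j t) absolutely_integrable_on {a..b}" for j
    using v0 absolutely_integrable_continuous_real[OF continuous_on_subset[OF pj(2)]] by (rule set_integral_diff) simp
  have N: "negligible (N1 \<union> N2)" using pj(1) qj(1) by (rule negligible_Un)
  have bound: "norm (hj j t) \<le> D1 + D2 * (norm (v0 t) + R)" if t: "t \<in> {a..b}" for j t
  proof -
    have "norm (?P j t) \<le> norm (P t (x0 t) (pj j t) (qj j t)) * norm (v0 t - pj j t)"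
      by (simp add: Cauchy_Schwarz_ineq2)
    also have "\<dots> \<le> D2 * (norm (v0 t) + R)"
      using D2(1)[OF t pj(3)[of j t], of "qj j t"] D2(2) qj(3)[of j t] norm_triangle_ineq4[of "v0 t" "pj j t"] pj(3)[of j t]
      by (intro mult_mono) auto
    finally show ?thesis
      using D1[OF t pj(3)[of j t], of "qj j t"] qj(3)[of j t] norm_triangle_ineq[of "?F j t"
        "?P j t"] unfolding hj_def real_norm_def by linarith
  qed
  have dom: "(\<lambda>t. D1 + D2 * (norm (v0 t) + R)) integrable_on {a..b}"
    by (intro HK_integrable_add integrable_on_mult_right v_int integrable_const_ivl)
  have hj_int: "hj j integrable_on {a..b}" for j
  proof -
    have "hj j \<in> borel_measurable (lebesgue_on {a..b})"
    proof -
      have "(\<lambda>t. ?P j t) \<in> borel_measurable (lebesgue_on {a..b})"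
        using continuous_composition_measurable[OF P_cont x0_cont pq_meas] absolutely_integrable_imp_measurable[OF pv, of j]
        by (intro borel_measurable_inner) auto
      then show ?thesis
        unfolding hj_def[abs_def] using continuous_composition_measurable[OF F_cont x0_cont pq_meas, of j j]
        by (intro borel_measurable_add)
    qed
    from measurable_bounded_by_integrable_imp_absolutely_integrable[OF this _ dom bound]
    show ?thesis by (auto simp: absolutely_integrable_on_def)
  qed
  have conv: "(\<lambda>j. hj j t) \<longlonglongrightarrow> h t" if t: "t \<in> {a..b} - (N1 \<union> N2)" for t
  proof -
    have z: "(\<lambda>j. (t, x0 t, pj j t, qj j t)) \<longlonglongrightarrow> (t, x0 t, p t, tail_inf u m t)"
      using t pj(4) qj(4) by (intro tendsto_Pair tendsto_const) auto
    have "(\<lambda>j. ?F j t) \<longlonglongrightarrow> F t (x0 t) (p t) (tail_inf u m t)"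
      using continuous_on_tendsto_compose[OF F_cont z] by simp
    moreover have "(\<lambda>j. P t (x0 t) (pj j t) (qj j t)) \<longlonglongrightarrow> P t (x0 t) (p t) (tail_inf u m t)"
      using continuous_on_tendsto_compose[OF P_cont z] by simp
    ultimately show ?thesis
      unfolding hj_def h_def using t pj(4)[of t] by (intro tendsto_intros) auto
  qed
  note dc = dominated_convergence_negligible[OF hj_int dom N bound conv]
  show "h integrable_on {a..b}" by (rule dc(1))
  have e_bound: "norm (ej j t) \<le> M + M" if t: "t \<in> {a..b}" for j t
    using tail_bound[OF t] qj(3)[of j t] by (auto simp: ej_def)
  have e_int: "ej j integrable_on {a..b}" for j
  proof -
    have "ej j \<in> borel_measurable (lebesgue_on {a..b})"
      unfolding ej_def[abs_def] using pq_meas(2) tail_meas by (intro borel_measurable_max borel_measurable_diff) auto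
    from measurable_bounded_by_integrable_imp_absolutely_integrable[OF this _ integrable_const_ivl e_bound]
    show ?thesis by (auto simp: absolutely_integrable_on_def)
  qed
  have e_conv: "(\<lambda>j. ej j t) \<longlonglongrightarrow> 0" if t: "t \<in> {a..b} - (N1 \<union> N2)" for t
  proof -
    have "(\<lambda>j. max 0 (qj j t - tail_inf u m t)) \<longlonglongrightarrow> max 0 (tail_inf u m t - tail_inf u m t)"
      using t qj(4)[of t] by (intro tendsto_max tendsto_diff tendsto_const) auto
    then show ?thesis by (simp add: ej_def)
  qed
  have "(\<lambda>j. integral {a..b} (hj j) - \<Lambda> * integral {a..b} (ej j)) \<longlonglongrightarrow> integral {a..b} h - \<Lambda> * integral {a..b} (\<lambda>t. 0)"
    by (intro tendsto_intros dc(2) dominated_convergence_negligible(2)[OF e_int integrable_const_ivl N e_bound e_conv])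
  moreover have "integral {a..b} (hj j) - \<Lambda> * integral {a..b} (ej j) \<le> c" for j
    unfolding hj_def ej_def by (rule test_inequality[OF pj(2) qj(2)])
  ultimately show "integral {a..b} h \<le> c"
    using LIMSEQ_le_const2 by fastforce
qed

text \<open>A single index n serves both as truncation level for \<open>v0\<close> and as index of
  the tail infimum. The part of the integrand where \<open>v0\<close> is at most n in norm increases
  with n, the rest is dominated and vanishes. Integrability of \<open>H\<close> is a conclusion,
  drawn from monotone convergence; admissibility of the limit curve will rest on it.\<close>

theorem lower_semicontinuity:
  defines "H \<equiv> \<lambda>t. F t (x0 t) (v0 t) (lower_limit u t)"
  shows "H integrable_on {a..b}" "integral {a..b} H \<le> c"
proof -
  have tb: "\<bar>tail_inf u m t\<bar> \<le> M" if "t \<in> {a..b}" for t m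
    using abs_tail_inf_le[where u = u and t = t and m = m, OF u_bound[OF that]] .
  have tail_meas: "tail_inf u m \<in> borel_measurable (lebesgue_on {a..b})" for m
    by (rule tail_inf_measurable(1)[where u = u and m = m, OF u_meas u_bound])
  have v0_meas: "v0 \<in> borel_measurable (lebesgue_on {a..b})" by (rule absolutely_integrable_imp_measurable[OF v0])
  define S where "S n = {t. norm (v0 t) \<le> real n}" for n :: nat
  \<comment> \<open>Truncating to 0 keeps the linear minorant bounded by a multiple of \<^term>\<open>1 + norm (v0 t)\<close> where \<^term>\<open>v0 t\<close> is large.\<close>
  define p where "p n t = (if t \<in> S n then v0 t else 0)" for n t
  have p_meas: "p n \<in> borel_measurable (lebesgue_on {a..b})" for n
    unfolding p_def[abs_def] S_def using v0_meas by (auto intro!: measurable_If_set measurable_If)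
  have p_bound: "norm (p n t) \<le> real n" for n t by (simp add: p_def S_def)
  define h where "h n t = F t (x0 t) (p n t) (tail_inf u n t) + P t (x0 t) (p n t) (tail_inf u n t) \<bullet> (v0 t - p n t)" for n t
  have h: "h n integrable_on {a..b}" "integral {a..b} (h n) \<le> c" for n
    using bounded_measurable_test_inequality[OF p_meas p_bound, of n n] unfolding h_def[abs_def] by auto
  define \<phi> where "\<phi> n t = (if t \<in> S n then F t (x0 t) (v0 t) (tail_inf u n t) + C else 0)" for n t
  define \<psi> where "\<psi> n t = (if t \<in> S n then 0 else F t (x0 t) 0 (tail_inf u n t) + P t (x0 t) 0 (tail_inf u n t) \<bullet> v0 t + C)" for n t
  have h_split: "h n t + C = \<phi> n t + \<psi> n t" for n t by (simp add: h_def \<phi>_def \<psi>_def p_def)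
  obtain D1 where D1: "\<And>t p r. t \<in> {a..b} \<Longrightarrow> norm p \<le> 0 \<Longrightarrow> \<bar>r\<bar> \<le> M \<Longrightarrow> norm (F t (x0 t) p r) \<le> D1" "0 \<le> D1"
    using bounded_on_compact_arguments[OF F_cont x0_cont] by metis
  obtain D2 where D2: "\<And>t p r. t \<in> {a..b} \<Longrightarrow> norm p \<le> 0 \<Longrightarrow> \<bar>r\<bar> \<le> M \<Longrightarrow> norm (P t (x0 t) p r) \<le> D2" "0 \<le> D2"
    using bounded_on_compact_arguments[OF P_cont x0_cont] by metis
  have \<psi>_bound: "norm (\<psi> n t) \<le> (D1 + \<bar>C\<bar>) + D2 * norm (v0 t)" if t: "t \<in> {a..b}" for n t
  proof -
    have "norm (P t (x0 t) 0 (tail_inf u n t) \<bullet> v0 t) \<le> norm (P t (x0 t) 0 (tail_inf u n t)) * norm (v0 t)"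
      by (simp add: Cauchy_Schwarz_ineq2)
    also have "\<dots> \<le> D2 * norm (v0 t)" using D2(1)[OF t _ tb[OF t]] by (intro mult_right_mono) auto
    finally have "norm (P t (x0 t) 0 (tail_inf u n t) \<bullet> v0 t) \<le> D2 * norm (v0 t)" .
    moreover have "norm (F t (x0 t) 0 (tail_inf u n t)) \<le> D1" using D1(1)[OF t _ tb[OF t]] by simp
    moreover have "0 \<le> D2 * norm (v0 t)" using D2 by simp
    ultimately show ?thesis using D1(2) unfolding \<psi>_def real_norm_def by auto
  qed
  have dom: "(\<lambda>t. (D1 + \<bar>C\<bar>) + D2 * norm (v0 t)) integrable_on {a..b}"
    by (intro HK_integrable_add integrable_on_mult_right v_int integrable_const_ivl)
  have S_sets: "{t \<in> space (lebesgue_on {a..b}). t \<in> S n} \<in> sets (lebesgue_on {a..b})" for n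
    unfolding S_def using v0_meas by measurable
  have \<psi>_meas: "\<psi> n \<in> borel_measurable (lebesgue_on {a..b})" for n
  proof -
    have "(\<lambda>t. F t (x0 t) 0 (tail_inf u n t) + P t (x0 t) 0 (tail_inf u n t) \<bullet> v0 t + C) \<in> borel_measurable (lebesgue_on {a..b})"
      by (intro borel_measurable_add borel_measurable_inner borel_measurable_const v0_meas
          continuous_composition_measurable[OF F_cont x0_cont] continuous_composition_measurable[OF P_cont x0_cont] tail_meas)
    then show ?thesis unfolding \<psi>_def[abs_def] by (intro measurable_If S_sets) auto
  qed
  have \<psi>_int: "\<psi> n integrable_on {a..b}" for n
    using measurable_bounded_by_integrable_imp_absolutely_integrable[OF \<psi>_meas _ dom \<psi>_bound]
    by (auto simp: absolutely_integrable_on_def)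
  have "\<forall>\<^sub>F n in sequentially. t \<in> S n" for t
  proof -
    obtain m :: nat where "norm (v0 t) \<le> real m" using real_arch_simple by blast
    then show ?thesis unfolding S_def by (intro eventually_sequentiallyI[of m]) auto
  qed
  note S_ev = this
  have "(\<lambda>n. \<psi> n t) \<longlonglongrightarrow> 0" for t
    by (rule tendsto_eventually) (use S_ev[of t] in eventually_elim, simp add: \<psi>_def)
  then have \<psi>_lim: "(\<lambda>n. integral {a..b} (\<psi> n)) \<longlonglongrightarrow> integral {a..b} (\<lambda>t. 0)"
    by (intro dominated_convergence(2)[OF \<psi>_int dom \<psi>_bound])
  have \<phi>_eq: "\<phi> n = (\<lambda>t. (h n t + C) - \<psi> n t)" for n using h_split[of n] by (auto simp: fun_eq_iff algebra_simps)
  have hC: "(\<lambda>t. h n t + C) integrable_on {a..b}" for n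
    by (intro HK_integrable_add h integrable_const_ivl)
  have \<phi>_int: "\<phi> n integrable_on {a..b}" for n
    unfolding \<phi>_eq by (intro HK_integrable_diff hC \<psi>_int)
  have \<phi>_le: "integral {a..b} (\<phi> n) \<le> c + C * (b - a) - integral {a..b} (\<psi> n)" for n
    unfolding \<phi>_eq HK_integral_diff[OF hC \<psi>_int]
      HK_integral_add[OF h(1) integrable_const_ivl]
    using h(2)[of n] ab by simp
  have tl: "tail_inf u n t \<le> tail_inf u (Suc n) t" if "t \<in> {a..b}" for n t
    using tail_inf_mono[where u = u and t = t and m = n and n = "Suc n", OF u_bound[OF that]] by simp
  \<comment> \<open>Two effects: at a point already in \<open>S n\<close> the tail infimum grows and
    \<open>F\<close> is monotone; at a point that enters at the next index the value jumps from 0 to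
    F + C, which is nonnegative. This is the purpose of the shift by \<open>C\<close>.\<close>
  have \<phi>_mono: "\<phi> n t \<le> \<phi> (Suc n) t" if t: "t \<in> {a..b}" for n t
    using F_mono[OF t tl[OF t, of n], of "x0 t" "v0 t"] F_lower[OF t tb[OF t], of "x0 t" "v0 t" "Suc n"]
    by (auto simp: \<phi>_def S_def)
  have \<phi>_nonneg: "0 \<le> \<phi> n t" if t: "t \<in> {a..b}" for n t
    using F_lower[OF t tb[OF t], of "x0 t" "v0 t" n] by (auto simp: \<phi>_def)
  have \<phi>_lim: "(\<lambda>n. \<phi> n t) \<longlonglongrightarrow> H t + C" if t: "t \<in> {a..b}" for t
  proof -
    have "(\<lambda>n. tail_inf u n t) \<longlonglongrightarrow> lower_limit u t"
      by (rule tail_inf_tendsto[where u = u and t = t, OF u_bound[OF t]])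
    then have z: "(\<lambda>n. (t, x0 t, v0 t, tail_inf u n t)) \<longlonglongrightarrow> (t, x0 t, v0 t, lower_limit u t)"
      by (intro tendsto_Pair tendsto_const)
    have "(\<lambda>n. F t (x0 t) (v0 t) (tail_inf u n t) + C) \<longlonglongrightarrow> H t + C"
      using continuous_on_tendsto_compose[OF F_cont z] unfolding H_def by (intro tendsto_add tendsto_const) simp
    then show ?thesis
      by (rule Lim_transform_eventually) (use S_ev[of t] in eventually_elim, simp add: \<phi>_def)
  qed
  have "bounded (range (\<lambda>n. integral {a..b} (\<phi> n)))"
  proof -
    obtain E where E: "\<And>n. norm (integral {a..b} (\<psi> n)) \<le> E"
      using convergent_imp_bounded[OF \<psi>_lim] unfolding bounded_iff by auto
    have "norm (integral {a..b} (\<phi> n)) \<le> c + C * (b - a) + E" for n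
    proof -
      have "0 \<le> integral {a..b} (\<phi> n)" by (rule integral_nonneg[OF \<phi>_int \<phi>_nonneg])
      then show ?thesis using \<phi>_le[of n] E[of n] unfolding real_norm_def by linarith
    qed
    then show ?thesis unfolding bounded_iff by blast
  qed
  note mc = monotone_convergence_increasing[OF \<phi>_int \<phi>_mono \<phi>_lim this]
  from mc have "(\<lambda>t. (H t + C) - C) integrable_on {a..b}"
    by (intro HK_integrable_diff integrable_const_ivl) auto
  then show Hi: "H integrable_on {a..b}" by simp
  have "integral {a..b} (\<lambda>t. H t + C) \<le> c + C * (b - a) - 0"
  proof (rule LIMSEQ_le)
    show "(\<lambda>n. integral {a..b} (\<phi> n)) \<longlonglongrightarrow> integral {a..b} (\<lambda>t. H t + C)" using mc by simp
    show "(\<lambda>n. c + C * (b - a) - integral {a..b} (\<psi> n)) \<longlonglongrightarrow> c + C * (b - a) - 0"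
      using tendsto_diff[OF tendsto_const \<psi>_lim] by simp
    show "\<exists>N. \<forall>n\<ge>N. integral {a..b} (\<phi> n) \<le> c + C * (b - a) - integral {a..b} (\<psi> n)" using \<phi>_le by blast
  qed
  then show "integral {a..b} H \<le> c"
    unfolding HK_integral_add[OF Hi integrable_const_ivl] using ab by simp
qed

end

subsection \<open>Gronwall's inequality and Caratheodory equations\<close>

lemma FTC_AE:
  fixes f :: "real \<Rightarrow> 'a::euclidean_space"
  assumes f: "absolutely_continuous_on {a..b} f" and ab: "a < b" and N: "negligible N"
    and g: "\<And>t. t \<in> {a..b} - N \<Longrightarrow> (f has_vector_derivative g t) (at t within {a..b})"
  shows "g absolutely_integrable_on {a..b}"
    and "\<And>s t. a \<le> s \<Longrightarrow> s \<le> t \<Longrightarrow> t \<le> b \<Longrightarrow> (g has_integral f t - f s) {s..t}"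
proof -
  let ?f' = "\<lambda>t. vector_derivative f (at t within {a..b})"
  have eq: "?f' t = g t" if t: "t \<in> {a..b} - N" for t
    using vector_derivative_within_closed_interval[OF ab _ g[OF t]] t by blast
  obtain N' where F: "?f' absolutely_integrable_on {a..b}"
    "\<And>s t. a \<le> s \<Longrightarrow> s \<le> t \<Longrightarrow> t \<le> b \<Longrightarrow> (?f' has_integral f t - f s) {s..t}"
    using AC_FTC[OF f ab] by metis
  show "g absolutely_integrable_on {a..b}"
    by (rule absolutely_integrable_spike[OF F(1) N]) (use eq in auto)
  fix s t assume st: "a \<le> s" "s \<le> t" "t \<le> b"
  show "(g has_integral f t - f s) {s..t}"
    by (rule has_integral_spike[OF N _ F(2)[OF st]]) (use eq st in auto)
qed

lemma AE_lebesgue_negligibleE: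
  assumes "AE t in lebesgue. Q t"
  obtains N where "negligible N" "\<And>t. t \<notin> N \<Longrightarrow> Q t"
  using assms unfolding eventually_ae_filter by (auto simp: negligible_iff_null_sets)

lemma AE_lebesgue_negligibleI:
  "negligible N \<Longrightarrow> (\<And>t. t \<notin> N \<Longrightarrow> Q t) \<Longrightarrow> AE t in lebesgue. Q t"
  unfolding eventually_ae_filter by (auto simp: negligible_iff_null_sets)

lemma has_integral_exp_weight:
  assumes "\<kappa> > (0::real)" "a \<le> t"
  shows "((\<lambda>s. exp (\<kappa> * (s - a))) has_integral (exp (\<kappa> * (t - a)) - 1) / \<kappa>) {a..t}"
proof -
  have "((\<lambda>s. exp (\<kappa> * (s - a))) has_integral exp (\<kappa> * (t - a)) / \<kappa> - exp (\<kappa> * (a - a)) / \<kappa>) {a..t}"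
    by (rule fundamental_theorem_of_calculus[OF assms(2)])
       (use assms in \<open>auto simp flip: has_real_derivative_iff_has_vector_derivative intro!: derivative_eq_intros\<close>)
  then show ?thesis by (simp add: diff_divide_distrib)
qed

text \<open>Comparing \<^term>\<open>y\<close> with the supremum of \<^term>\<open>\<lambda>t. y t * exp (- 2 * K * (t - a))\<close> makes one
  application of the integral inequality enough; no regularity beyond integrability is used.\<close>

lemma Gronwall_bounded:
  fixes y :: "real \<Rightarrow> real"
  assumes K: "K > 0" and A: "A \<ge> 0"
    and bound: "\<And>t. t \<in> {a..b} \<Longrightarrow> y t \<le> Y"
    and y_int: "y integrable_on {a..b}"
    and le: "\<And>t. t \<in> {a..b} \<Longrightarrow> y t \<le> A + K * integral {a..t} y"
    and t: "t \<in> {a..b}"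
  shows "y t \<le> 2 * A * exp (2 * K * (t - a))"
proof -
  define z where "z s = y s * exp (- (2 * K * (s - a)))" for s
  have "z s \<le> max 0 Y" if s: "s \<in> {a..b}" for s
  proof -
    have "z s \<le> max 0 Y * exp (- (2 * K * (s - a)))"
      unfolding z_def using bound[OF s] by (intro mult_right_mono) auto
    also have "\<dots> \<le> max 0 Y * 1"
      using s K by (intro mult_left_mono) auto
    finally show ?thesis by simp
  qed
  then have bdd: "bdd_above (z ` {a..b})" by (auto intro!: bdd_aboveI[of _ "max 0 Y"])
  \<comment> \<open>The maximum with 0 makes \<open>S\<close> nonnegative, so that the bound A + S /
    2 obtained below for \<open>z\<close> is one for \<open>S\<close> itself.\<close>
  define S where "S = max 0 (SUP s\<in>{a..b}. z s)"
  have zS: "z s \<le> S" if "s \<in> {a..b}" for s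
    unfolding S_def using cSUP_upper[OF that bdd] by simp
  have yS: "y s \<le> S * exp (2 * K * (s - a))" if "s \<in> {a..b}" for s
  proof -
    have "y s = z s * exp (2 * K * (s - a))" by (simp add: z_def exp_minus)
    then show ?thesis using zS[OF that] by (simp add: mult_right_mono)
  qed
  \<comment> \<open>The exponential rate 2 K is twice the rate of the integral inequality, which
    produces the factor 1/2. Absorbing S / 2 gives S at most 2 A, the constant of the
    conclusion.\<close>
  have "z s \<le> A + S / 2" if s: "s \<in> {a..b}" for s
  proof -
    have hi: "((\<lambda>r. S * exp (2 * K * (r - a))) has_integral S * ((exp (2 * K * (s - a)) - 1) / (2 * K))) {a..s}"
      using has_integral_exp_weight[of "2 * K" a s] K s by (intro has_integral_mult_right) auto
    have "y integrable_on {a..s}" using y_int s by (auto intro: integrable_on_subinterval)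
    then have "integral {a..s} y \<le> S * ((exp (2 * K * (s - a)) - 1) / (2 * K))"
      using hi s by (intro has_integral_le[OF integrable_integral hi]) (auto intro: yS)
    then have "K * integral {a..s} y \<le> K * (S * ((exp (2 * K * (s - a)) - 1) / (2 * K)))"
      using K by (intro mult_left_mono) auto
    also have "\<dots> = S / 2 * exp (2 * K * (s - a)) - S / 2" using K by (simp add: field_simps)
    finally have "y s \<le> A + S / 2 * exp (2 * K * (s - a))"
      using le[OF s] by (simp add: S_def)
    moreover have "A \<le> A * exp (2 * K * (s - a))"
      using A K s by (simp add: mult_le_cancel_left1)
    ultimately have "y s \<le> (A + S / 2) * exp (2 * K * (s - a))" by (simp add: algebra_simps)
    then have "z s \<le> (A + S / 2) * exp (2 * K * (s - a)) * exp (- (2 * K * (s - a)))"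
      unfolding z_def by (intro mult_right_mono) auto
    then show ?thesis by (simp add: mult.assoc mult_exp_exp)
  qed
  then have "(SUP s\<in>{a..b}. z s) \<le> A + S / 2" using t by (intro cSUP_least) auto
  moreover have "0 \<le> A + S / 2" using A by (simp add: S_def)
  ultimately have "S \<le> A + S / 2" unfolding S_def by simp
  then have "S \<le> 2 * A" by simp
  then have "S * exp (2 * K * (t - a)) \<le> 2 * A * exp (2 * K * (t - a))" by (intro mult_right_mono) auto
  then show ?thesis using yS[OF t] by linarith
qed

text \<open>Banach's fixed point theorem for the Picard operator. The exponential weight is moved
  into the unknown, the fixed point being the solution divided by the weight, so that the ordinary
  supremum distance of bounded continuous functions can be used.\<close>

lemma Picard_Caratheodory:
  fixes l :: "real \<Rightarrow> real \<Rightarrow> real"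
  assumes ab: "a \<le> b" and K: "K > 0"
    and lip: "\<And>t r s. t \<in> {a..b} \<Longrightarrow> \<bar>l t r - l t s\<bar> \<le> K * \<bar>r - s\<bar>"
    and meas: "\<And>w. continuous_on {a..b} w \<Longrightarrow> (\<lambda>t. l t (w t)) \<in> borel_measurable (lebesgue_on {a..b})"
    and int0: "(\<lambda>t. l t 0) absolutely_integrable_on {a..b}"
  obtains w where "(\<lambda>t. l t (w t)) absolutely_integrable_on {a..b}"
    "\<And>t. t \<in> {a..b} \<Longrightarrow> w t = u + integral {a..t} (\<lambda>s. l s (w s))"
proof -
  have int: "(\<lambda>t. l t (w t)) absolutely_integrable_on {a..b}" if w: "continuous_on {a..b} w" for w
  proof (rule measurable_bounded_by_integrable_imp_absolutely_integrable[OF meas[OF w]])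
    have "(\<lambda>t. K * \<bar>w t\<bar>) integrable_on {a..b}"
      by (intro integrable_continuous_real continuous_intros w)
    moreover have "(\<lambda>t. norm (l t 0)) integrable_on {a..b}"
      using int0 unfolding absolutely_integrable_on_def by blast
    ultimately show "(\<lambda>t. norm (l t 0) + K * \<bar>w t\<bar>) integrable_on {a..b}"
      by (intro HK_integrable_add)
    show "norm (l t (w t)) \<le> norm (l t 0) + K * \<bar>w t\<bar>" if "t \<in> {a..b}" for t
      using lip[OF that, of "w t" 0] by auto
  qed auto
  \<comment> \<open>Integrating K times the weight yields the factor K / \<kappa>, so this choice
    makes the contraction constant 1/2.\<close>
  define \<kappa> where "\<kappa> = 2 * K"
  have \<kappa>: "\<kappa> > 0" using K by (simp add: \<kappa>_def)
  define c where "c t = max a (min b t)" for t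
  have c: "c t \<in> {a..b}" "t \<in> {a..b} \<Longrightarrow> c t = t" for t using ab by (auto simp: c_def)
  have c_cont: "continuous_on UNIV c" unfolding c_def by (intro continuous_intros)
  \<comment> \<open>With the exponential weight the Picard operator contracts on the whole interval at once.\<close>
  define W where "W z s = exp (\<kappa> * (s - a)) * apply_bcontfun z s" for z s
  have W_cont: "continuous_on T (W z)" for z T
    unfolding W_def[abs_def] by (intro continuous_intros) auto
  define G where "G z t = exp (- (\<kappa> * (t - a))) * (u + integral {a..t} (\<lambda>s. l s (W z s)))" for z t
  have G_cont: "continuous_on {a..b} (G z)" for z
    unfolding G_def[abs_def]
    by (intro continuous_intros indefinite_integral_continuous_1) (use int[OF W_cont] in \<open>auto simp: absolutely_integrable_on_def\<close>)
  \<comment> \<open>The function space consists of functions on the whole line; outside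
    \<open>{a..b}\<close> the image is continued by its boundary values.\<close>
  define T where "T z = Bcontfun (\<lambda>t. G z (c t))" for z
  have T: "apply_bcontfun (T z) t = G z (c t)" for z t
  proof -
    have "continuous_on UNIV (\<lambda>t. G z (c t))"
      by (rule continuous_on_compose2[OF G_cont c_cont]) (use c in auto)
    moreover have "bounded (range (\<lambda>t. G z (c t)))"
    proof (rule bounded_subset)
      show "bounded (G z ` {a..b})" using compact_continuous_image[OF G_cont] by (intro compact_imp_bounded) auto
      show "range (\<lambda>t. G z (c t)) \<subseteq> G z ` {a..b}" using c by auto
    qed
    ultimately have "(\<lambda>t. G z (c t)) \<in> bcontfun" by (simp add: bcontfun_def)
    then show ?thesis unfolding T_def by (simp add: Bcontfun_inverse)
  qed
  have "dist (T z1) (T z2) \<le> 1/2 * dist z1 z2" for z1 z2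
  proof (rule dist_bound)
    fix x :: real
    define t where "t = c x"
    have t: "t \<in> {a..b}" using c by (simp add: t_def)
    have i: "(\<lambda>s. l s (W z s)) integrable_on {a..t}" for z
      using t by (intro absolutely_integrable_subinterval[OF int[OF W_cont]]) auto
    have hi: "((\<lambda>s. K * dist z1 z2 * exp (\<kappa> * (s - a))) has_integral K * dist z1 z2 * ((exp (\<kappa> * (t - a)) - 1) / \<kappa>)) {a..t}"
      using has_integral_exp_weight[OF \<kappa>, of a t] t by (intro has_integral_mult_right) auto
    have "norm (integral {a..t} (\<lambda>s. l s (W z1 s) - l s (W z2 s))) \<le> integral {a..t} (\<lambda>s. K * dist z1 z2 * exp (\<kappa> * (s - a)))"
    proof (rule integral_norm_bound_integral)
      show "(\<lambda>s. l s (W z1 s) - l s (W z2 s)) integrable_on {a..t}"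
        by (intro HK_integrable_diff i)
      show "(\<lambda>s. K * dist z1 z2 * exp (\<kappa> * (s - a))) integrable_on {a..t}" using hi by (rule has_integral_integrable)
      fix s assume s: "s \<in> {a..t}"
      have "norm (l s (W z1 s) - l s (W z2 s)) \<le> K * \<bar>W z1 s - W z2 s\<bar>"
        using lip[of s] s t by auto
      also have "\<bar>W z1 s - W z2 s\<bar> = exp (\<kappa> * (s - a)) * dist (apply_bcontfun z1 s) (apply_bcontfun z2 s)"
        unfolding W_def dist_real_def by (simp add: right_diff_distrib[symmetric] abs_mult)
      also have "K * \<dots> \<le> K * (exp (\<kappa> * (s - a)) * dist z1 z2)"
        using K by (intro mult_left_mono dist_bounded) auto
      finally show "norm (l s (W z1 s) - l s (W z2 s)) \<le> K * dist z1 z2 * exp (\<kappa> * (s - a))"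
        by (simp add: mult_ac)
    qed
    also have "\<dots> = K * dist z1 z2 * ((exp (\<kappa> * (t - a)) - 1) / \<kappa>)" using hi by (rule integral_unique)
    also have "\<dots> \<le> 1/2 * dist z1 z2 * exp (\<kappa> * (t - a))"
    proof -
      have "K * dist z1 z2 * ((exp (\<kappa> * (t - a)) - 1) / \<kappa>) = 1/2 * dist z1 z2 * exp (\<kappa> * (t - a)) - dist z1 z2 / 2"
        using K unfolding \<kappa>_def by (simp add: field_simps)
      then show ?thesis by simp
    qed
    finally have *: "\<bar>integral {a..t} (\<lambda>s. l s (W z1 s) - l s (W z2 s))\<bar> \<le> 1/2 * dist z1 z2 * exp (\<kappa> * (t - a))"
      by simp
    have "dist (apply_bcontfun (T z1) x) (apply_bcontfun (T z2) x)
      = exp (- (\<kappa> * (t - a))) * \<bar>integral {a..t} (\<lambda>s. l s (W z1 s) - l s (W z2 s))\<bar>"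
      unfolding T t_def[symmetric] G_def dist_real_def
      by (simp add: right_diff_distrib[symmetric] abs_mult HK_integral_diff[OF i i])
    also have "\<dots> \<le> exp (- (\<kappa> * (t - a))) * (1/2 * dist z1 z2 * exp (\<kappa> * (t - a)))"
      using * by (intro mult_left_mono) auto
    also have "\<dots> = 1/2 * dist z1 z2" by (simp add: exp_minus)
    finally show "dist (apply_bcontfun (T z1) x) (apply_bcontfun (T z2) x) \<le> 1/2 * dist z1 z2" .
  qed
  then have "\<exists>!z. T z = z" by (intro banach_fix_type[of "1/2"]) auto
  then obtain z where z: "T z = z" by blast
  show thesis
  proof (rule that[of "W z"])
    show "(\<lambda>t. l t (W z t)) absolutely_integrable_on {a..b}" by (rule int[OF W_cont])
    fix t assume t: "t \<in> {a..b}"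
    have "W z t = exp (\<kappa> * (t - a)) * apply_bcontfun (T z) t" by (simp add: W_def z)
    also have "\<dots> = exp (\<kappa> * (t - a)) * G z t" by (simp add: T c(2)[OF t])
    also have "\<dots> = u + integral {a..t} (\<lambda>s. l s (W z s))"
      by (simp add: G_def exp_minus mult.assoc[symmetric])
    finally show "W z t = u + integral {a..t} (\<lambda>s. l s (W z s))" .
  qed
qed

subsection \<open>Consequences of the structural conditions\<close>

lemma C1_imp_continuous: "C1 f \<Longrightarrow> continuous_on UNIV f"
  unfolding C1_def by (metis differentiableI continuous_on_eq_continuous_at differentiable_imp_continuous_within open_UNIV)

lemma linear_euclidean_functional:
  fixes h :: "'a::euclidean_space \<Rightarrow> real"
  assumes "linear h"
  shows "(\<Sum>b\<in>Basis. h b *\<^sub>R b) \<bullet> w = h w"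
proof -
  have "h w = h (\<Sum>b\<in>Basis. (w \<bullet> b) *\<^sub>R b)" by (simp add: euclidean_representation)
  also have "\<dots> = (\<Sum>b\<in>Basis. (w \<bullet> b) * h b)"
    by (simp add: linear_sum[OF assms] linear_scale[OF assms])
  finally show ?thesis by (simp add: inner_sum_left inner_commute[of w] mult.commute)
qed

text \<open>For 0 < h < 1 convexity bounds the difference quotient from p towards q by f q - f p;
  the derivative is its limit as h tends to 0.\<close>

lemma convex_subgradient:
  fixes f :: "'a::real_normed_vector \<Rightarrow> real"
  assumes f: "strictly_convex f" and d: "(f has_derivative f') (at p)"
  shows "f p + f' (q - p) \<le> f q"
proof (cases "p = q")
  case True
  then show ?thesis using linear_0[OF has_derivative_linear[OF d]] by simp
next
  case False
  define g where "g s = f (p + s *\<^sub>R (q - p))" for s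
  have "(g has_derivative (\<lambda>s. f' (s *\<^sub>R (q - p)))) (at 0)"
    unfolding g_def
    by (rule has_derivative_compose[of "\<lambda>s. p + s *\<^sub>R (q - p)" "\<lambda>s. s *\<^sub>R (q - p)" 0 UNIV f f'])
       (auto intro!: derivative_eq_intros d)
  then have "(g has_real_derivative f' (q - p)) (at 0)"
    by (simp add: has_field_derivative_def linear_scale[OF has_derivative_linear[OF d]] mult_commute_abs)
  then have "((\<lambda>h. (g (0 + h) - g 0) / h) \<longlongrightarrow> f' (q - p)) (at 0)" by (simp add: DERIV_def)
  then have "((\<lambda>h. (g (0 + h) - g 0) / h) \<longlongrightarrow> f' (q - p)) (at_right 0)"
    by (rule tendsto_mono[rotated]) (simp add: at_le)
  moreover have "\<forall>\<^sub>F h in at_right 0. (g (0 + h) - g 0) / h \<le> f q - f p"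
  proof -
    have "\<forall>\<^sub>F h::real in at_right 0. 0 < h \<and> h < 1"
      unfolding eventually_at_right[OF zero_less_one] by (intro exI[of _ 1]) auto
    then show ?thesis
    proof eventually_elim
      case (elim h)
      have "p + h *\<^sub>R (q - p) = h *\<^sub>R q + (1 - h) *\<^sub>R p" by (simp add: algebra_simps)
      then have "g h < h * f q + (1 - h) * f p"
        using f False elim unfolding strictly_convex_def g_def by metis
      then show ?case using elim by (simp add: g_def field_simps)
    qed
  qed
  ultimately have "f' (q - p) \<le> f q - f p" by (intro tendsto_upperbound) auto
  then show ?thesis by simp
qed

text \<open>\<open>P\<close> is the partial gradient of L in the velocity. Its components are values
  of the total derivative on basis vectors in the velocity slot, so it is jointly continuous in all
  arguments because L is of class C1.\<close>

lemma lagrangian_subgradient: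
  fixes L :: "'n::finite lagrangian"
  assumes C: "C1 (\<lambda>(t, x, v, r). L t x v r)" and L1: "L1 L"
  obtains P where "continuous_on UNIV (\<lambda>(t, x, v, r). P t x v r :: real^'n)"
    "\<And>t x p q r. L t x p r + P t x p r \<bullet> (q - p) \<le> L t x q r"
proof -
  obtain f' where f': "\<And>z. ((\<lambda>(t, x, v, r). L t x v r) has_derivative blinfun_apply (f' z)) (at z)" "continuous_on UNIV f'"
    using C unfolding C1_def by blast
  define P where "P t x v r = (\<Sum>b\<in>Basis. blinfun_apply (f' (t, x, v, r)) (0, 0, b, 0) *\<^sub>R b)" for t x v r
  show thesis
  proof
    have "continuous_on UNIV (\<lambda>z. \<Sum>b\<in>Basis. blinfun_apply (f' z) (0, 0, b, 0) *\<^sub>R b)"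
      by (intro continuous_intros f'(2))
    then show "continuous_on UNIV (\<lambda>(t, x, v, r). P t x v r)"
      by (rule continuous_on_eq) (auto simp: P_def)
    fix t x p q r
    have "((\<lambda>v. (\<lambda>(t, x, v, r). L t x v r) (t, x, v, r)) has_derivative (\<lambda>w. blinfun_apply (f' (t, x, p, r)) (0, 0, w, 0))) (at p)"
      by (rule has_derivative_compose[OF _ f'(1)]) (auto intro!: derivative_eq_intros)
    then have d: "((\<lambda>v. L t x v r) has_derivative (\<lambda>w. blinfun_apply (f' (t, x, p, r)) (0, 0, w, 0))) (at p)" by simp
    have "P t x p r \<bullet> (q - p) = blinfun_apply (f' (t, x, p, r)) (0, 0, q - p, 0)"
      unfolding P_def by (rule linear_euclidean_functional[OF has_derivative_linear[OF d]])
    moreover have "strictly_convex (\<lambda>v. L t x v r)" using L1 by (simp add: L1_def)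
    ultimately show "L t x p r + P t x p r \<bullet> (q - p) \<le> L t x q r"
      using convex_subgradient[OF _ d] by simp
  qed
qed

text \<open>The open set where the inequality fails inside the interval is negligible, hence empty;
  the endpoints follow by closure. The functions of t in (L2) and (L3) are bounded only almost
  everywhere, and this extends the resulting estimates on L to every t.\<close>

lemma AE_le_imp_le_on_interval:
  fixes f :: "real \<Rightarrow> real"
  assumes f: "continuous_on UNIV f" and ab: "a < b" and ae: "AE t in lebesgue. t \<in> {a..b} \<longrightarrow> f t \<le> c"
    and t: "t \<in> {a..b}"
  shows "f t \<le> c"
proof -
  obtain N where N: "negligible N" "\<And>t. t \<notin> N \<Longrightarrow> t \<in> {a..b} \<longrightarrow> f t \<le> c"
    using AE_lebesgue_negligibleE[OF ae] by metis
  have "open ({a<..<b} \<inter> f -` {c<..})"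
    using f by (intro continuous_open_preimage) (auto intro: continuous_on_subset)
  moreover have "negligible ({a<..<b} \<inter> f -` {c<..})"
    by (rule negligible_subset[OF N(1)]) (use N(2) in force)
  ultimately have "{a<..<b} \<inter> f -` {c<..} = {}" using open_not_negligible by blast
  then have "f s \<le> c" if "s \<in> {a<..<b}" for s using that by (auto simp: not_less)
  moreover have "closure {a<..<b} = {a..b}" using ab by simp
  ultimately show ?thesis
    using continuous_le_on_closure[of "{a<..<b}" f t c] f t by (auto intro: continuous_on_subset)
qed

lemma lagrangian_Lipschitz:
  fixes L :: "'n::finite lagrangian"
  assumes C: "C1 (\<lambda>(t, x, v, r). L t x v r)" and L3: "L3 L" and ab: "a < b"
  obtains K where "K > 0" "\<And>t x v r s. t \<in> {a..b} \<Longrightarrow> \<bar>L t x v r - L t x v s\<bar> \<le> K * \<bar>r - s\<bar>"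
proof -
  obtain f' where f': "\<And>z. ((\<lambda>(t, x, v, r). L t x v r) has_derivative blinfun_apply (f' z)) (at z)"
    using C unfolding C1_def by blast
  obtain K where K: "Linf_loc K" "\<And>t x v r. \<bar>deriv (\<lambda>r. L t x v r) r\<bar> \<le> K t"
    using L3 unfolding L3_def by blast
  obtain M where M: "AE t in lebesgue. t \<in> {a..b} \<longrightarrow> \<bar>K t\<bar> \<le> M"
    using K(1) unfolding Linf_loc_def by (metis compact_Icc)
  \<comment> \<open>Adding 1 makes the constant positive: it is the rate in Gronwall's inequality
    and in the Picard weight.\<close>
  define K0 where "K0 = max M 0 + 1"
  have d: "((\<lambda>r. L t x v r) has_real_derivative deriv (\<lambda>r. L t x v r) r) (at r)" for t x v r
  proof -
    have "((\<lambda>r. (\<lambda>(t, x, v, r). L t x v r) (t, x, v, r)) has_derivative (\<lambda>h. blinfun_apply (f' (t, x, v, r)) (0, 0, 0, h))) (at r)"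
      by (rule has_derivative_compose[OF _ f']) (auto intro!: derivative_eq_intros)
    then have "(\<lambda>r. L t x v r) differentiable (at r)" by (auto simp: differentiable_def)
    then show ?thesis by (simp add: DERIV_deriv_iff_real_differentiable)
  qed
  show thesis
  proof
    show "K0 > 0" by (simp add: K0_def)
    fix t x v r s assume t: "t \<in> {a..b}"
    have "continuous_on UNIV (\<lambda>t. (\<lambda>(t, x, v, r). L t x v r) (t, x, v, r) - (\<lambda>(t, x, v, r). L t x v r) (t, x, v, s))"
      by (intro continuous_on_diff continuous_on_compose2[OF C1_imp_continuous[OF C]]) (auto intro!: continuous_intros)
    then have c: "continuous_on UNIV (\<lambda>t. \<bar>L t x v r - L t x v s\<bar>)"
      by (intro continuous_on_rabs) simp
    show "\<bar>L t x v r - L t x v s\<bar> \<le> K0 * \<bar>r - s\<bar>"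
    proof (rule AE_le_imp_le_on_interval[OF c ab _ t])
      show "AE t in lebesgue. t \<in> {a..b} \<longrightarrow> \<bar>L t x v r - L t x v s\<bar> \<le> K0 * \<bar>r - s\<bar>"
        using M
      proof eventually_elim
        case (elim t)
        show ?case
        proof
          assume "t \<in> {a..b}"
          then have "K t \<le> K0" using elim by (auto simp: K0_def)
          then have "norm (deriv (\<lambda>r. L t x v r) r) \<le> K0" for r using K(2)[of t x v r] by simp
          then have "norm (L t x v r - L t x v s) \<le> K0 * norm (r - s)"
            by (intro field_differentiable_bound[of UNIV "\<lambda>r. L t x v r" "deriv (\<lambda>r. L t x v r)"])
               (auto intro: d)
          then show "\<bar>L t x v r - L t x v s\<bar> \<le> K0 * \<bar>r - s\<bar>" by simp
        qed
      qed
    qed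
  qed
qed

text \<open>Superlinearity gives \<theta>(s) at least n s for s > R n. For larger speeds the norm is
  therefore at most (L + C) / n, and for the others R n suffices because L + C is nonnegative. With
  n free, this linear form turns a bound on the integral of L into equi-integrability of the
  velocities.\<close>

lemma lagrangian_coercive:
  fixes L :: "'n::finite lagrangian"
  assumes C: "C1 (\<lambda>(t, x, v, r). L t x v r)" and L2: "L2 L" and ab: "a < b"
  obtains C R where "C \<ge> 0" "\<And>t x v. t \<in> {a..b} \<Longrightarrow> - C \<le> L t x v 0"
    "\<And>n::nat. 0 \<le> R n"
    "\<And>n t x v. t \<in> {a..b} \<Longrightarrow> 0 < n \<Longrightarrow> norm v \<le> R n + (L t x v 0 + C) / real n"
proof -
  obtain \<theta> c where \<theta>: "superlinear \<theta>" and c: "Linf_loc c" and le: "\<And>t x v. \<theta> (norm v) - c t \<le> L t x v 0"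
    using L2 unfolding L2_def by blast
  obtain M where M: "AE t in lebesgue. t \<in> {a..b} \<longrightarrow> \<bar>c t\<bar> \<le> M"
    using c unfolding Linf_loc_def by (metis compact_Icc)
  define C0 where "C0 = max M 0"
  have low: "\<theta> (norm v) \<le> L t x v 0 + C0" if t: "t \<in> {a..b}" for t x v
  proof -
    have "continuous_on UNIV (\<lambda>t. (\<lambda>(t, x, v, r). L t x v r) (t, x, v, 0))"
      by (intro continuous_on_compose2[OF C1_imp_continuous[OF C]]) (auto intro!: continuous_intros)
    then have cont: "continuous_on UNIV (\<lambda>t. \<theta> (norm v) - L t x v 0)"
      by (intro continuous_intros) simp
    have "\<theta> (norm v) - L t x v 0 \<le> C0"
    proof (rule AE_le_imp_le_on_interval[OF cont ab _ t])
      show "AE t in lebesgue. t \<in> {a..b} \<longrightarrow> \<theta> (norm v) - L t x v 0 \<le> C0"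
        using M
      proof eventually_elim
        case (elim t)
        then show ?case using le[of v t x] by (auto simp: C0_def)
      qed
    qed
    then show ?thesis by simp
  qed
  have \<theta>0: "0 \<le> \<theta> (norm v)" for v :: "real^'n" using \<theta> by (simp add: superlinear_def)
  have "\<exists>R\<ge>0. \<forall>s>R. real n \<le> \<theta> s / s" for n
  proof -
    have "\<forall>\<^sub>F s in at_top. real n \<le> \<theta> s / s"
      using \<theta> unfolding superlinear_def filterlim_at_top by blast
    then obtain R where "\<And>s. s \<ge> R \<Longrightarrow> real n \<le> \<theta> s / s" unfolding eventually_at_top_linorder by blast
    then show ?thesis by (intro exI[of _ "max R 0"]) auto
  qed
  then obtain R where R: "\<And>n. 0 \<le> R n" "\<And>n s. s > R n \<Longrightarrow> real n \<le> \<theta> s / s" by metis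
  show thesis
  proof (rule that[of C0 R])
    show "0 \<le> C0" by (simp add: C0_def)
    show "- C0 \<le> L t x v 0" if "t \<in> {a..b}" for t x v
      using low[OF that, of v x] \<theta>0[of v] by linarith
    show "0 \<le> R n" for n by (rule R(1))
    fix n t x v assume t: "t \<in> {a..b}" and n: "0 < (n::nat)"
    show "norm v \<le> R n + (L t x v 0 + C0) / real n"
    proof (cases "norm v \<le> R n")
      case True
      have "0 \<le> (L t x v 0 + C0) / real n" using low[OF t, of v x] \<theta>0[of v] by simp
      then show ?thesis using True by linarith
    next
      case False
      then have v: "norm v > 0" using R(1)[of n] by linarith
      have "real n \<le> \<theta> (norm v) / norm v" using False by (intro R(2)) simp
      then have "real n * norm v \<le> \<theta> (norm v)" using v by (simp add: pos_le_divide_eq)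
      also have "\<dots> \<le> L t x v 0 + C0" by (rule low[OF t])
      finally have "norm v \<le> (L t x v 0 + C0) / real n" using n by (simp add: field_simps)
      then show ?thesis using R(1)[of n] by linarith
    qed
  qed
qed

subsection \<open>State equations\<close>

text \<open>The properties of L on the fixed interval from which the existence argument proceeds:
  (L1) enters through \<open>P\<close>, (L2) through \<open>C\<close> and \<open>R\<close>, (L3)
  through \<open>K\<close>, all valid at every time in \<open>{a..b}\<close>.\<close>

locale regular_lagrangian =
  fixes L :: "'n::finite lagrangian" and P :: "real \<Rightarrow> real^'n \<Rightarrow> real^'n \<Rightarrow> real \<Rightarrow> real^'n"
    and a b K C :: real and R :: "nat \<Rightarrow> real"
  assumes ab: "a < b"
    and L_cont: "continuous_on UNIV (\<lambda>(t, x, v, r). L t x v r)"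
    and P_cont: "continuous_on UNIV (\<lambda>(t, x, v, r). P t x v r)"
    and L_subgradient: "\<And>t x p q r. L t x p r + P t x p r \<bullet> (q - p) \<le> L t x q r"
    and K: "K > 0"
    and L_lip: "\<And>t x v r s. t \<in> {a..b} \<Longrightarrow> \<bar>L t x v r - L t x v s\<bar> \<le> K * \<bar>r - s\<bar>"
    and C: "C \<ge> 0"
    and L_lower: "\<And>t x v. t \<in> {a..b} \<Longrightarrow> - C \<le> L t x v 0"
    and R: "\<And>n. 0 \<le> R n"
    and L_coercive: "\<And>n t x v. t \<in> {a..b} \<Longrightarrow> 0 < n \<Longrightarrow> norm v \<le> R n + (L t x v 0 + C) / real n"
begin

definition weight :: "real \<Rightarrow> real" where
  "weight t = exp (K * (t - a))"

lemma weight_ge_1: "a \<le> t \<Longrightarrow> 1 \<le> weight t"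
  using K by (simp add: weight_def)

lemma weight_mono: "s \<le> t \<Longrightarrow> weight s \<le> weight t"
  using K by (simp add: weight_def)

lemma weight_pos: "0 < weight t"
  by (simp add: weight_def)

lemma L_ge: "t \<in> {a..b} \<Longrightarrow> - C - K * \<bar>r\<bar> \<le> L t x v r"
  using L_lip[of t x v r 0] L_lower[of t x v] by (auto simp: abs_le_iff)

lemma L_measurable:
  assumes "continuous_on {a..b} \<xi>" "p \<in> borel_measurable (lebesgue_on {a..b})" "r \<in> borel_measurable (lebesgue_on {a..b})"
  shows "(\<lambda>t. L t (\<xi> t) (p t) (r t)) \<in> borel_measurable (lebesgue_on {a..b})"
  by (rule continuous_composition_measurable[OF L_cont assms])

lemma velocity_integral:
  assumes "absolutely_continuous_on {a..b} \<xi>"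
  shows "velocity a b \<xi> absolutely_integrable_on {a..b}"
    and "\<And>s t. a \<le> s \<Longrightarrow> s \<le> t \<Longrightarrow> t \<le> b \<Longrightarrow> (velocity a b \<xi> has_integral \<xi> t - \<xi> s) {s..t}"
  using AC_FTC[OF assms ab] unfolding velocity_def[abs_def] by metis+

section \<open>A single solution of the state equation: integral identities and a priori
  bounds\<close>

context
  fixes u :: real and \<xi> :: "real \<Rightarrow> real^'n" and w :: "real \<Rightarrow> real"
  assumes sol: "caratheodory_solution L a b u \<xi> w"
begin

lemma solution_AC: "absolutely_continuous_on {a..b} w"
  and solution_initial: "w a = u"
  using sol by (auto simp: caratheodory_solution_def)

lemma solution_continuous: "continuous_on {a..b} w"
  by (rule AC_imp_continuous_on[OF solution_AC])

abbreviation (input) rhs :: "real \<Rightarrow> real" where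
  "rhs s \<equiv> L s (\<xi> s) (velocity a b \<xi> s) (w s)"

lemma solution_derivative:
  obtains N where "negligible N" "\<And>s. s \<in> {a..b} - N \<Longrightarrow>
    (w has_vector_derivative rhs s) (at s within {a..b})"
proof -
  have "AE s in lebesgue. s \<in> {a..b} \<longrightarrow>
      (w has_real_derivative rhs s) (at s within {a..b})"
    using sol by (simp add: caratheodory_solution_def)
  then obtain N where "negligible N" "\<And>s. s \<notin> N \<Longrightarrow> s \<in> {a..b} \<longrightarrow>
      (w has_real_derivative rhs s) (at s within {a..b})"
    using AE_lebesgue_negligibleE by blast
  then show thesis
    using that[of N] by (auto simp: has_real_derivative_iff_has_vector_derivative)
qed

lemma solution_integral:
  shows "(\<lambda>s. rhs s) absolutely_integrable_on {a..b}"
    and "\<And>s t. a \<le> s \<Longrightarrow> s \<le> t \<Longrightarrow> t \<le> b \<Longrightarrow>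
      ((\<lambda>s. rhs s) has_integral w t - w s) {s..t}"
proof -
  obtain N where N: "negligible N" "\<And>s. s \<in> {a..b} - N \<Longrightarrow>
    (w has_vector_derivative rhs s) (at s within {a..b})"
    using solution_derivative by blast
  note F = FTC_AE[OF solution_AC ab N]
  show "(\<lambda>s. rhs s) absolutely_integrable_on {a..b}"
    by (rule F(1))
  show "((\<lambda>s. rhs s) has_integral w t - w s) {s..t}"
    if "a \<le> s" "s \<le> t" "t \<le> b" for s t
    by (rule F(2)[OF _ that])
qed

text \<open>The weight is Lipschitz on \<open>{a..b}\<close> and the solution is absolutely
  continuous and bounded, so their product is absolutely continuous and is the integral of its
  derivative, given by the product rule.\<close>

lemma weighted_solution_integral:
  assumes "a \<le> s" "s \<le> t" "t \<le> b"
  shows "((\<lambda>s. weight s * (rhs s + K * w s)) has_integral weight t * w t - weight s * w s) {s..t}"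
proof -
  obtain N where N: "negligible N" "\<And>s. s \<in> {a..b} - N \<Longrightarrow>
    (w has_vector_derivative rhs s) (at s within {a..b})"
    using solution_derivative by blast
  obtain W where W: "\<And>s. s \<in> {a..b} \<Longrightarrow> \<bar>w s\<bar> \<le> W"
    using continuous_on_Icc_bounded[OF solution_continuous] unfolding real_norm_def by blast
  have W0: "0 \<le> W" using W[of a] ab by auto
  \<comment> \<open>The inequality 1 + x \<le> exp x at x = K (s - t) bounds the weight at s from
    below by that at t.\<close>
  have wlip: "weight t - weight s \<le> K * weight b * (t - s)" if "a \<le> s" "s \<le> t" "t \<le> b" for s t
  proof -
    have "weight t * (1 + K * (s - t)) \<le> weight t * exp (K * (s - t))"
      using weight_pos[of t] by (intro mult_left_mono exp_ge_add_one_self) auto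
    also have "\<dots> = weight s" by (simp add: weight_def mult_exp_exp algebra_simps)
    finally have "weight t * (1 + K * (s - t)) \<le> weight s" .
    then have "weight t - weight s \<le> weight t * (K * (t - s))" by (simp add: algebra_simps)
    also have "\<dots> \<le> weight b * (K * (t - s))"
      using that K by (intro mult_right_mono weight_mono) auto
    finally show ?thesis by (simp add: mult_ac)
  qed
  have "absolutely_continuous_on {a..b} (\<lambda>t. weight t * w t)"
  proof (rule AC_dominated[OF solution_AC solution_AC, where C = "weight b + K * weight b * W"])
    fix s t assume st: "s \<in> {a..b}" "t \<in> {a..b}" "s \<le> t"
    have "weight t * w t - weight s * w s = weight t * (w t - w s) + (weight t - weight s) * w s"
      by (simp add: algebra_simps)
    then have "norm (weight t * w t - weight s * w s) \<le> \<bar>weight t\<bar> * \<bar>w t - w s\<bar> + \<bar>weight t - weight s\<bar> * \<bar>w s\<bar>"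
      unfolding real_norm_def using abs_triangle_ineq[of "weight t * (w t - w s)" "(weight t - weight s) * w s"]
      by (simp add: abs_mult)
    also have "\<dots> \<le> weight b * \<bar>w t - w s\<bar> + (K * weight b * (t - s)) * W"
      using st wlip[of s t] weight_mono[of t b] weight_mono[of s t] weight_pos[of t] W[of s] K weight_pos[of b]
      by (intro add_mono mult_mono) auto
    also have "\<dots> \<le> (weight b + K * weight b * W) * \<bar>w t - w s\<bar> + (weight b + K * weight b * W) * (t - s)"
    proof -
      have "0 \<le> K * weight b * W" using K weight_pos[of b] W0 by simp
      then have "0 \<le> (K * weight b * W) * \<bar>w t - w s\<bar>" "0 \<le> weight b * (t - s)"
        using st weight_pos[of b] by auto
      then show ?thesis by (simp add: algebra_simps)
    qed
    also have "\<dots> \<le> (weight b + K * weight b * W) * norm (w t - w s) + (weight b + K * weight b * W) * norm (w t - w s)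
      + (weight b + K * weight b * W) * (t - s)"
      using K weight_pos[of b] W0 by simp
    finally show "norm (weight t * w t - weight s * w s) \<le> \<dots>" .
  qed
  then show ?thesis
  proof (rule FTC_AE(2)[OF _ ab N(1) _ assms])
    fix s assume s: "s \<in> {a..b} - N"
    have "(weight has_real_derivative K * weight s) (at s within {a..b})"
      unfolding weight_def[abs_def] by (auto intro!: derivative_eq_intros)
    from DERIV_mult[OF this N(2)[OF s, folded has_real_derivative_iff_has_vector_derivative]]
    show "((\<lambda>t. weight t * w t) has_vector_derivative weight s * (rhs s + K * w s)) (at s within {a..b})"
      by (simp add: has_real_derivative_iff_has_vector_derivative[symmetric] algebra_simps)
  qed
qed

text \<open>The lower bound propagates forward from \<open>u\<close> by Gronwall's inequality for
  the weighted negative part of the solution; \<open>M1\<close> is the resulting constant, with rate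
  2 K. An upper bound cannot propagate forward, as L grows with the velocity. Integrating the lower
  bound on L over [t,b] instead bounds the state at t by the state at b.\<close>

lemma solution_bounds:
  defines "M1 \<equiv> 2 * (\<bar>u\<bar> + C * weight b * (b - a)) * exp (2 * (2 * K) * (b - a))"
  assumes t: "t \<in> {a..b}"
  shows "- M1 \<le> w t" and "w t \<le> weight b * \<bar>w b\<bar> + (C + 2 * K * M1) * weight b * (b - a)"
proof -
  define A where "A = \<bar>u\<bar> + C * weight b * (b - a)"
  have A: "A \<ge> 0" using C weight_pos[of b] ab by (simp add: A_def)
  have M1: "M1 \<ge> 0" using A unfolding M1_def A_def[symmetric] by simp
  define y where "y s = weight s * max 0 (- w s)" for s
  have y_cont: "continuous_on {a..b} y"
    unfolding y_def[abs_def] weight_def by (intro continuous_intros solution_continuous)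
  have yi: "y integrable_on {a..s}" if "s \<in> {a..b}" for s
    using that by (intro integrable_continuous_real continuous_on_subset[OF y_cont]) auto
  obtain Y where Y: "\<And>s. s \<in> {a..b} \<Longrightarrow> \<bar>y s\<bar> \<le> Y"
    using continuous_on_Icc_bounded[OF y_cont] unfolding real_norm_def by blast
  have low: "- M1 \<le> w t" if t: "t \<in> {a..b}" for t
  proof -
    have "y t \<le> 2 * A * exp (2 * (2 * K) * (t - a))"
    proof (rule Gronwall_bounded[of "2 * K" A a b y Y, OF _ A _ _ _ t])
      show "0 < 2 * K" using K by simp
      show "y s \<le> Y" if "s \<in> {a..b}" for s using Y[OF that] by simp
      show "y integrable_on {a..b}" using yi[of b] ab by simp
      fix s assume s: "s \<in> {a..b}"
      have "integral {a..s} (\<lambda>r. - (C * weight b) - 2 * K * y r) \<le> weight s * w s - weight a * w a"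
      proof (rule has_integral_le[OF integrable_integral weighted_solution_integral])
        show "(\<lambda>r. - (C * weight b) - 2 * K * y r) integrable_on {a..s}"
          by (intro HK_integrable_diff integrable_on_mult_right yi s integrable_const_ivl)
        fix r assume r: "r \<in> {a..s}"
        then have r': "r \<in> {a..b}" using s by auto
        have "weight r * (- C - K * \<bar>w r\<bar> + K * w r) \<le> weight r * (rhs r + K * w r)"
          using L_ge[OF r', of "w r" "\<xi> r" "velocity a b \<xi> r"] weight_pos[of r] by (intro mult_left_mono) auto
        \<comment> \<open>Here K |w| - K w is 2 K times the negative part of w, so only the negative
          part enters the estimate.\<close>
        moreover have "weight r * (- C - K * \<bar>w r\<bar> + K * w r) = - (C * weight r) - 2 * K * y r"
          by (auto simp: y_def abs_if max_def algebra_simps)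
        moreover have "C * weight r \<le> C * weight b" using C r' by (intro mult_left_mono weight_mono) auto
        ultimately show "- (C * weight b) - 2 * K * y r \<le> weight r * (rhs r + K * w r)"
          by linarith
      qed (use s in auto)
      moreover have "integral {a..s} (\<lambda>r. - (C * weight b) - 2 * K * y r) = - (C * weight b) * (s - a) - 2 * K * integral {a..s} y"
      proof -
        have "((\<lambda>r. - (C * weight b) - 2 * K * y r) has_integral (s - a) *\<^sub>R (- (C * weight b)) - 2 * K * integral {a..s} y) {a..s}"
          using has_integral_const_real[of "- (C * weight b)" a s] s
          by (intro has_integral_diff has_integral_mult_right integrable_integral yi) auto
        then show ?thesis by (simp add: integral_unique mult.commute)
      qed
      moreover have "C * weight b * (s - a) \<le> C * weight b * (b - a)"
        using C weight_pos[of b] s by (intro mult_left_mono) auto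
      moreover have "weight a * w a = u" by (simp add: weight_def solution_initial)
      ultimately have "- (weight s * w s) \<le> A + 2 * K * integral {a..s} y" unfolding A_def by (smt (verit) mult_minus_left)
      moreover have "0 \<le> integral {a..s} y"
        by (rule integral_nonneg[OF yi[OF s]]) (simp add: y_def weight_pos less_imp_le)
      moreover have "y s = max 0 (- (weight s * w s))"
        using weight_pos[of s] by (simp add: y_def max_def mult_le_0_iff zero_le_mult_iff)
      ultimately show "y s \<le> A + 2 * K * integral {a..s} y" using A K by simp
    qed
    also have "\<dots> \<le> M1"
      unfolding M1_def A_def[symmetric] using A K t by (intro mult_left_mono) auto
    finally have "weight t * max 0 (- w t) \<le> M1" by (simp add: y_def)
    moreover have "1 * max 0 (- w t) \<le> weight t * max 0 (- w t)"
      using weight_ge_1[of t] t by (intro mult_right_mono) auto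
    ultimately show ?thesis by simp
  qed
  show "- M1 \<le> w t" by (rule low[OF t])
  define C' where "C' = C + 2 * K * M1"
  have C': "C' \<ge> 0" using C K M1 by (simp add: C'_def)
  have "integral {t..b} (\<lambda>r. - (C' * weight b)) \<le> weight b * w b - weight t * w t"
  proof (rule has_integral_le[OF integrable_integral weighted_solution_integral])
    fix r assume r: "r \<in> {t..b}"
    then have r': "r \<in> {a..b}" using t by auto
    \<comment> \<open>A number not below - M1 satisfies |w| \<le> w + 2 M1, so the lower bound just
      proved controls the absolute value by w itself.\<close>
    have "K * \<bar>w r\<bar> \<le> K * (w r + 2 * M1)" using low[OF r'] M1 K by (intro mult_left_mono) auto
    then have "- C' \<le> rhs r + K * w r"
      using L_ge[OF r', of "w r" "\<xi> r" "velocity a b \<xi> r"] by (simp add: C'_def algebra_simps)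
    then have "weight r * (- C') \<le> weight r * (rhs r + K * w r)"
      using weight_pos[of r] by (intro mult_left_mono) auto
    moreover have "C' * weight r \<le> C' * weight b" using C' r' by (intro mult_left_mono weight_mono) auto
    ultimately show "- (C' * weight b) \<le> weight r * (rhs r + K * w r)"
      by (simp add: mult.commute)
  qed (use t in \<open>auto intro: integrable_const_ivl\<close>)
  then have "weight t * w t \<le> weight b * w b + (b - t) * (C' * weight b)" using t by (simp add: mult_ac)
  moreover have "(b - t) * (C' * weight b) \<le> (b - a) * (C' * weight b)"
    using t C' weight_pos[of b] by (intro mult_right_mono) auto
  moreover have "weight b * w b \<le> weight b * \<bar>w b\<bar>" using weight_pos[of b] by (intro mult_left_mono) auto
  ultimately have *: "weight t * w t \<le> weight b * \<bar>w b\<bar> + C' * weight b * (b - a)" by (simp add: mult_ac)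
  show "w t \<le> weight b * \<bar>w b\<bar> + (C + 2 * K * M1) * weight b * (b - a)"
  proof (cases "w t \<le> 0")
    case True
    have "0 \<le> weight b * \<bar>w b\<bar> + C' * weight b * (b - a)" using weight_pos[of b] C' ab by simp
    then show ?thesis using True unfolding C'_def by linarith
  next
    case False
    then have "1 * w t \<le> weight t * w t" using weight_ge_1[of t] t by (intro mult_right_mono) auto
    then show ?thesis using * unfolding C'_def by linarith
  qed
qed

end

section \<open>Existence of states and admissible curves\<close>

lemma solution_exists:
  assumes \<xi>: "absolutely_continuous_on {a..b} \<xi>"
    and int: "(\<lambda>s. L s (\<xi> s) (velocity a b \<xi> s) 0) absolutely_integrable_on {a..b}"
  shows "\<exists>w. caratheodory_solution L a b u \<xi> w"
proof -
  have meas: "velocity a b \<xi> \<in> borel_measurable (lebesgue_on {a..b})"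
    by (rule absolutely_integrable_imp_measurable[OF velocity_integral(1)[OF \<xi>]])
  have "(\<lambda>t. L t (\<xi> t) (velocity a b \<xi> t) (w t)) \<in> borel_measurable (lebesgue_on {a..b})"
    if "continuous_on {a..b} w" for w
    by (rule L_measurable[OF AC_imp_continuous_on[OF \<xi>] meas
          continuous_imp_measurable_on_sets_lebesgue[OF that]]) simp
  from Picard_Caratheodory[of a b K "\<lambda>t. L t (\<xi> t) (velocity a b \<xi> t)" u, OF less_imp_le[OF ab] K L_lip this int]
  obtain w where w: "(\<lambda>t. L t (\<xi> t) (velocity a b \<xi> t) (w t)) absolutely_integrable_on {a..b}"
    "\<And>t. t \<in> {a..b} \<Longrightarrow> w t = u + integral {a..t} (\<lambda>s. L s (\<xi> s) (velocity a b \<xi> s) (w s))"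
    by blast
  define g where "g s = L s (\<xi> s) (velocity a b \<xi> s) (w s)" for s
  note w = w[folded g_def]
  have "absolutely_continuous_on {a..b} w"
    by (rule AC_dominated[OF AC_indefinite_integral[OF w(1)]
          AC_indefinite_integral[OF w(1)], where C = 1]) (simp add: w(2))
  moreover have "w a = u" using w(2)[of a] ab by simp
  moreover obtain N where N: "negligible N"
    "\<And>t. t \<in> {a..b} - N \<Longrightarrow> ((\<lambda>t. integral {a..t} g) has_vector_derivative g t) (at t within {a..b})"
    using has_vector_derivative_indefinite_integral_AE[OF set_lebesgue_integral_eq_integral(1)[OF w(1)]] by metis
  have "(w has_vector_derivative g t) (at t within {a..b})" if t: "t \<in> {a..b} - N" for t
  proof -
    have "((\<lambda>t. u + integral {a..t} g) has_vector_derivative 0 + g t) (at t within {a..b})"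
      by (intro has_vector_derivative_add has_vector_derivative_const N(2)[OF t])
    then have "((\<lambda>t. u + integral {a..t} g) has_vector_derivative g t) (at t within {a..b})" by simp
    then show ?thesis
      by (rule has_vector_derivative_transform[rotated 2]) (use t w(2) in blast)+
  qed
  then have "AE s in lebesgue. s \<in> {a..b} \<longrightarrow> (w has_real_derivative g s) (at s within {a..b})"
    by (intro AE_lebesgue_negligibleI[OF N(1)]) (auto simp: has_real_derivative_iff_has_vector_derivative)
  ultimately show ?thesis unfolding caratheodory_solution_def g_def by blast
qed

text \<open>Needed so that the infimum is taken over a nonempty set. The affine curve works because
  L along it, with constant velocity, is continuous.\<close>

lemma straight_line_admissible: "admissible L a b u x y \<noteq> {}"
proof -
  define v where "v = (y - x) /\<^sub>R (b - a)"
  define \<xi> where "\<xi> t = x + (t - a) *\<^sub>R v" for t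
  have AC: "absolutely_continuous_on {a..b} \<xi>"
  proof (rule AC_dominated[OF AC_id AC_id, where C = "norm v"])
    fix s t :: real assume "s \<le> t"
    have "\<xi> t - \<xi> s = (t - s) *\<^sub>R v" by (simp add: \<xi>_def algebra_simps)
    then show "norm (\<xi> t - \<xi> s) \<le> norm v * norm (t - s) + norm v * norm (t - s) + norm v * (t - s)"
      using \<open>s \<le> t\<close> by (simp add: mult.commute)
  qed
  have "\<xi> \<in> curves a b x y" using AC ab by (simp add: curves_def \<xi>_def v_def)
  moreover have v: "velocity a b \<xi> s = v" if "s \<in> {a..b}" for s
    unfolding velocity_def
  proof (rule vector_derivative_within_closed_interval[OF ab that])
    show "(\<xi> has_vector_derivative v) (at s within {a..b})"
      unfolding \<xi>_def[abs_def] by (auto intro!: derivative_eq_intros)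
  qed
  have "(\<lambda>s. L s (\<xi> s) (velocity a b \<xi> s) 0) absolutely_integrable_on {a..b}"
  proof -
    have "continuous_on {a..b} (\<lambda>s. (\<lambda>(t, x, v, r). L t x v r) (s, \<xi> s, v, 0))"
      by (rule continuous_on_compose2[OF L_cont])
         (auto intro!: continuous_intros AC_imp_continuous_on[OF AC])
    then have "(\<lambda>s. L s (\<xi> s) v 0) absolutely_integrable_on {a..b}"
      by (intro absolutely_integrable_continuous_real) simp
    then show ?thesis by (rule absolutely_integrable_spike[of _ _ "{}"]) (auto simp: v)
  qed
  then have "\<exists>w. caratheodory_solution L a b u \<xi> w" by (rule solution_exists[OF AC])
  ultimately show ?thesis unfolding admissible_def by blast
qed

lemma J_eq:
  assumes "\<xi> \<in> admissible L a b u x y"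
  shows "caratheodory_solution L a b u \<xi> (u_sol L a b u \<xi>)" "J L a b u \<xi> = u_sol L a b u \<xi> b - u"
proof -
  show sol: "caratheodory_solution L a b u \<xi> (u_sol L a b u \<xi>)"
    using assms someI_ex[of "caratheodory_solution L a b u \<xi>"] unfolding admissible_def u_sol_def by blast
  show "J L a b u \<xi> = u_sol L a b u \<xi> b - u"
    unfolding J_def set_lebesgue_integral_eq_integral(2)[OF solution_integral(1)[OF sol]]
    using solution_integral(2)[OF sol, of a b] ab solution_initial[OF sol] by (simp add: integral_unique)
qed

end

subsection \<open>Compactness and existence of minimizers\<close>

context regular_lagrangian
begin

lemma K_mult_bounds:
  assumes "\<bar>r\<bar> \<le> M"
  shows "K * \<bar>r\<bar> \<le> K * M" "- (K * M) \<le> K * r" "K * r \<le> K * M"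
proof -
  show *: "K * \<bar>r\<bar> \<le> K * M" using K assms by (intro mult_left_mono) auto
  have "\<bar>K * r\<bar> = K * \<bar>r\<bar>" using K by (simp add: abs_mult)
  then show "- (K * M) \<le> K * r" "K * r \<le> K * M" using * by linarith+
qed

section \<open>The weighted integrand and comparison with supersolutions\<close>

definition weighted_integrand :: "real \<Rightarrow> real^'n \<Rightarrow> real^'n \<Rightarrow> real \<Rightarrow> real" where
  "weighted_integrand t x p r = weight t * (L t x p r + K * r)"

definition weighted_gradient :: "real \<Rightarrow> real^'n \<Rightarrow> real^'n \<Rightarrow> real \<Rightarrow> real^'n" where
  "weighted_gradient t x p r = weight t *\<^sub>R P t x p r"

lemma weighted_integrand_mono:
  assumes "t \<in> {a..b}" "r \<le> s"
  shows "weighted_integrand t x p r \<le> weighted_integrand t x p s"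
proof -
  have "L t x p r - L t x p s \<le> K * (s - r)" using L_lip[OF assms(1), of x p r s] assms(2) by (auto simp: abs_le_iff)
  then show ?thesis
    unfolding weighted_integrand_def using weight_pos[of t] by (intro mult_left_mono) (auto simp: algebra_simps)
qed

lemma weighted_integrand_Lipschitz:
  assumes "t \<in> {a..b}" "r \<le> s"
  shows "weighted_integrand t x p s \<le> weighted_integrand t x p r + weight t * (2 * K * (s - r))"
proof -
  have "L t x p s - L t x p r \<le> K * (s - r)" using L_lip[OF assms(1), of x p s r] assms(2) by (auto simp: abs_le_iff)
  then have "weight t * (L t x p s + K * s) \<le> weight t * (L t x p r + K * r + 2 * K * (s - r))"
    using weight_pos[of t] by (intro mult_left_mono) (auto simp: algebra_simps)
  then show ?thesis unfolding weighted_integrand_def by (simp add: distrib_left)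
qed

text \<open>Semicontinuity will be applied on every initial interval, hence the free endpoint
  \<open>T\<close>. The constants contain the largest weight on \<open>{a..b}\<close>, so they do
  not depend on \<open>T\<close>. The factor 2 in 2 K combines the Lipschitz constant of L with the
  added term K r.\<close>

lemma convex_integrand_weighted:
  assumes T: "a \<le> T" "T \<le> b" and M: "0 \<le> M"
  shows "convex_integrand weighted_integrand weighted_gradient a T (weight b * (C + 2 * K * M)) (weight b * (2 * K)) M"
proof
  show "a \<le> T" by fact
  have "continuous_on UNIV (\<lambda>z. weight (fst z) * ((\<lambda>(t, x, v, r). L t x v r) z + K * snd (snd (snd z))))"
    unfolding weight_def by (intro continuous_intros L_cont)
  then show "continuous_on UNIV (\<lambda>(t, x, p, r). weighted_integrand t x p r)"
    by (rule continuous_on_eq) (auto simp: weighted_integrand_def)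
  have "continuous_on UNIV (\<lambda>z. weight (fst z) *\<^sub>R (\<lambda>(t, x, v, r). P t x v r) z)"
    unfolding weight_def by (intro continuous_intros P_cont)
  then show "continuous_on UNIV (\<lambda>(t, x, p, r). weighted_gradient t x p r)"
    by (rule continuous_on_eq) (auto simp: weighted_gradient_def)
  show "weighted_integrand t x p r + weighted_gradient t x p r \<bullet> (q - p) \<le> weighted_integrand t x q r" for t x p q r
  proof -
    have "weight t * (L t x p r + P t x p r \<bullet> (q - p) + K * r) \<le> weight t * (L t x q r + K * r)"
      using L_subgradient[of t x p r q] weight_pos[of t] by (intro mult_left_mono) auto
    then show ?thesis by (simp add: weighted_integrand_def weighted_gradient_def algebra_simps)
  qed
  fix t x p assume t: "t \<in> {a..T}"
  then have t': "t \<in> {a..b}" using T by auto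
  have wt: "weight t \<le> weight b" "0 < weight t" using t' weight_mono weight_pos by auto
  fix r s :: real
  show "weighted_integrand t x p r \<le> weighted_integrand t x p s" if "r \<le> s"
    using weighted_integrand_mono[OF t' that] .
  show "weighted_integrand t x p s \<le> weighted_integrand t x p r + weight b * (2 * K) * (s - r)" if "r \<le> s"
  proof -
    have "weight t * (2 * K * (s - r)) \<le> weight b * (2 * K * (s - r))"
      using wt K that by (intro mult_right_mono) auto
    then show ?thesis using weighted_integrand_Lipschitz[OF t' that, of x p] by (simp add: mult.assoc)
  qed
  show "- (weight b * (C + 2 * K * M)) \<le> weighted_integrand t x p r" if r: "\<bar>r\<bar> \<le> M"
  proof -
    have "- (C + 2 * K * M) \<le> L t x p r + K * r"
      using L_ge[OF t', of r x p] K_mult_bounds[OF r] by linarith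
    then have "weight t * (- (C + 2 * K * M)) \<le> weighted_integrand t x p r"
      unfolding weighted_integrand_def using wt by (intro mult_left_mono) auto
    moreover have "weight t * (C + 2 * K * M) \<le> weight b * (C + 2 * K * M)"
      using wt C K M by (intro mult_right_mono) auto
    ultimately show ?thesis unfolding mult_minus_right by linarith
  qed
qed

text \<open>The hypothesis on \<^term>\<open>z\<close> says that it is a supersolution of the integrated equation; only
  measurability and boundedness of \<^term>\<open>z\<close> are available, since it arises as a pointwise lower limit.\<close>

lemma solution_le_supersolution:
  assumes sol: "caratheodory_solution L a b u \<xi> w"
    and z_meas: "z \<in> borel_measurable (lebesgue_on {a..b})" and z_bound: "\<And>t. t \<in> {a..b} \<Longrightarrow> \<bar>z t\<bar> \<le> M"
    and z_int: "\<And>t. t \<in> {a..b} \<Longrightarrow> (\<lambda>s. weighted_integrand s (\<xi> s) (velocity a b \<xi> s) (z s)) integrable_on {a..t}"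
    and z_super: "\<And>t. t \<in> {a..b} \<Longrightarrow>
      integral {a..t} (\<lambda>s. weighted_integrand s (\<xi> s) (velocity a b \<xi> s) (z s)) \<le> weight t * z t - u"
    and t: "t \<in> {a..b}"
  shows "w t \<le> z t"
proof -
  let ?Fz = "\<lambda>r. weighted_integrand r (\<xi> r) (velocity a b \<xi> r) (z r)"
    and ?Fw = "\<lambda>r. weighted_integrand r (\<xi> r) (velocity a b \<xi> r) (w r)"
  obtain W where W: "\<And>s. s \<in> {a..b} \<Longrightarrow> \<bar>w s\<bar> \<le> W"
    using continuous_on_Icc_bounded[OF solution_continuous[OF sol]] unfolding real_norm_def by blast
  \<comment> \<open>The weighted excess of the solution over the supersolution. It need not be
    continuous, since \<open>z\<close> is only measurable; the Gronwall inequality above allows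
    this.\<close>
  define y where "y s = weight s * max 0 (w s - z s)" for s
  have y_bound: "norm (y s) \<le> weight b * (W + M)" if s: "s \<in> {a..b}" for s
  proof -
    have "0 \<le> max 0 (w s - z s)" "max 0 (w s - z s) \<le> W + M" using W[OF s] z_bound[OF s] by auto
    then have "weight s * max 0 (w s - z s) \<le> weight b * (W + M)"
      using weight_mono[of s b] weight_pos[of b] s by (intro mult_mono) auto
    then show ?thesis using weight_pos[of s] by (simp add: y_def)
  qed
  have "y \<in> borel_measurable (lebesgue_on {a..b})"
  proof -
    have "weight \<in> borel_measurable (lebesgue_on {a..b})"
      unfolding weight_def[abs_def] by (intro continuous_imp_measurable_on_sets_lebesgue continuous_intros) auto
    moreover have "w \<in> borel_measurable (lebesgue_on {a..b})"
      by (intro continuous_imp_measurable_on_sets_lebesgue solution_continuous[OF sol]) auto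
    ultimately show ?thesis
      unfolding y_def[abs_def] using z_meas
      by (intro borel_measurable_times borel_measurable_max borel_measurable_diff) auto
  qed
  from measurable_bounded_by_integrable_imp_absolutely_integrable[OF this _ integrable_const_ivl y_bound]
  have y_abs: "y absolutely_integrable_on {a..b}" by simp
  then have y_int: "y integrable_on {a..s}" if "s \<in> {a..b}" for s
    by (rule absolutely_integrable_subinterval) (use that in auto)
  \<comment> \<open>Both functions start from the same value u, so the additive constant in
    Gronwall's inequality is 0 and the excess vanishes.\<close>
  have "y t \<le> 2 * 0 * exp (2 * (2 * K) * (t - a))"
  proof (rule Gronwall_bounded[of "2 * K" 0 a b y "weight b * (W + M)", OF _ _ _ _ _ t])
    show "y s \<le> weight b * (W + M)" if "s \<in> {a..b}" for s using y_bound[OF that] by simp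
    show "y integrable_on {a..b}" using y_int[of b] ab by simp
    fix s assume s: "s \<in> {a..b}"
    have hw: "(?Fw has_integral weight s * w s - weight a * w a) {a..s}"
      unfolding weighted_integrand_def using s by (intro weighted_solution_integral[OF sol]) auto
    have hz: "((\<lambda>r. ?Fz r + 2 * K * y r) has_integral
      integral {a..s} ?Fz + 2 * K * integral {a..s} y) {a..s}"
      by (intro has_integral_add has_integral_mult_right integrable_integral z_int y_int s)
    have "weight s * w s - weight a * w a \<le> integral {a..s} ?Fz + 2 * K * integral {a..s} y"
    proof (rule has_integral_le[OF hw hz])
      fix r assume r: "r \<in> {a..s}"
      then have r': "r \<in> {a..b}" using s by auto
      show "?Fw r \<le> ?Fz r + 2 * K * y r"
      proof (cases "w r \<le> z r")
        case True
        then show ?thesis using weighted_integrand_mono[OF r' True] by (simp add: y_def)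
      next
        case False
        then show ?thesis
          using weighted_integrand_Lipschitz[OF r', of "z r" "w r" "\<xi> r" "velocity a b \<xi> r"] by (simp add: y_def mult_ac)
      qed
    qed
    moreover have "weight a * w a = u" by (simp add: weight_def solution_initial[OF sol])
    ultimately have "weight s * (w s - z s) \<le> 2 * K * integral {a..s} y"
      using z_super[OF s] by (simp add: algebra_simps)
    moreover have "0 \<le> integral {a..s} y"
      by (rule integral_nonneg[OF y_int[OF s]]) (simp add: y_def weight_pos less_imp_le)
    ultimately show "y s \<le> 0 + 2 * K * integral {a..s} y"
      using K by (auto simp: y_def max_def)
  qed (use K in auto)
  then show ?thesis using weight_pos[of t] by (simp add: y_def mult_le_0_iff split: if_splits)
qed

end

section \<open>Compactness of curves whose states are uniformly bounded\<close>

locale bounded_solutions = regular_lagrangian L P a b K C R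
  for L :: "'n::finite lagrangian" and P a b K C R +
  fixes u M :: real and x y :: "real^'n" and \<xi> :: "nat \<Rightarrow> real \<Rightarrow> real^'n" and w :: "nat \<Rightarrow> real \<Rightarrow> real"
  assumes \<xi>: "\<And>k. \<xi> k \<in> curves a b x y"
    and w: "\<And>k. caratheodory_solution L a b u (\<xi> k) (w k)"
    and w_bound: "\<And>k t. t \<in> {a..b} \<Longrightarrow> \<bar>w k t\<bar> \<le> M"
begin

text \<open>Chosen so that L + D is nonnegative along curves whose states are bounded by
  \<open>M\<close>.\<close>

definition D where "D = C + K * M"

definition total where "total = 2 * M + D * (b - a)"

text \<open>The derivative of the state, shifted to be nonnegative. Its integral is an increment of
  the state plus \<open>D\<close> times the length, hence at most \<open>total\<close> for every k,
  and it dominates the coercivity bound of the velocity.\<close>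

definition rate where "rate k s = L s (\<xi> k s) (velocity a b (\<xi> k) s) (w k s) + D"

lemma AC: "absolutely_continuous_on {a..b} (\<xi> k)"
  using \<xi>[of k] by (simp add: curves_def)

lemma rate_nonneg: "s \<in> {a..b} \<Longrightarrow> 0 \<le> rate k s"
  using L_ge[of s "w k s" "\<xi> k s" "velocity a b (\<xi> k) s"] K_mult_bounds(1)[OF w_bound[of s k]]
  by (simp add: rate_def D_def)

lemma rate_integrable: "rate k integrable_on {a..b}"
  and rate_total: "integral {a..b} (rate k) \<le> total"
proof -
  have "(rate k has_integral (w k b - w k a) + (b - a) *\<^sub>R D) {a..b}"
    unfolding rate_def[abs_def]
    using has_integral_const_real[of D a b] ab by (intro has_integral_add solution_integral(2)[OF w]) auto
  moreover have "w k b - w k a \<le> 2 * M" using w_bound[of a k] w_bound[of b k] ab by auto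
  ultimately show "rate k integrable_on {a..b}" "integral {a..b} (rate k) \<le> total"
    by (auto simp: total_def integral_unique mult.commute)
qed

lemma integral_rate_le:
  assumes "a \<le> p" "q \<le> b"
  shows "integral {p..q} (rate k) \<le> total"
proof -
  have sub: "{p..q} \<subseteq> {a..b}" using assms by auto
  have "integral {p..q} (rate k) \<le> integral {a..b} (rate k)"
    by (rule integral_subset_le[OF sub integrable_on_subinterval[OF rate_integrable sub] rate_integrable])
       (use rate_nonneg in auto)
  then show ?thesis using rate_total[of k] by simp
qed

lemma velocity_le:
  assumes s: "s \<in> {a..b}" and n: "0 < n"
  shows "norm (velocity a b (\<xi> k) s) \<le> R n + rate k s / real n"
proof -
  have "K * \<bar>w k s\<bar> \<le> K * M" using K w_bound[OF s] by (intro mult_left_mono) auto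
  then have "L s (\<xi> k s) (velocity a b (\<xi> k) s) 0 + C \<le> rate k s"
    using L_lip[OF s, of "\<xi> k s" "velocity a b (\<xi> k) s" 0 "w k s"] by (auto simp: rate_def D_def abs_le_iff)
  then have "(L s (\<xi> k s) (velocity a b (\<xi> k) s) 0 + C) / real n \<le> rate k s / real n"
    by (intro divide_right_mono) auto
  then show ?thesis using L_coercive[OF s n, of "velocity a b (\<xi> k) s" "\<xi> k s"] by linarith
qed

lemma norm_increment_le:
  assumes "a \<le> p" "p \<le> q" "q \<le> b" and n: "0 < n"
  shows "norm (\<xi> k q - \<xi> k p) \<le> R n * (q - p) + integral {p..q} (rate k) / real n"
proof -
  have sub: "{p..q} \<subseteq> {a..b}" using assms by auto
  have ri: "rate k integrable_on {p..q}" by (rule integrable_on_subinterval[OF rate_integrable sub])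
  have hv: "(velocity a b (\<xi> k) has_integral \<xi> k q - \<xi> k p) {p..q}"
    using velocity_integral(2)[OF AC assms(1-3)] .
  have hb: "((\<lambda>s. R n + rate k s / real n) has_integral (q - p) *\<^sub>R R n + integral {p..q} (rate k) / real n) {p..q}"
    using has_integral_const_real[of "R n" p q] assms(2)
    by (intro has_integral_add has_integral_divide integrable_integral ri) auto
  have "norm (integral {p..q} (velocity a b (\<xi> k))) \<le> integral {p..q} (\<lambda>s. R n + rate k s / real n)"
    by (rule integral_norm_bound_integral[OF has_integral_integrable[OF hv] has_integral_integrable[OF hb]])
       (use sub velocity_le[OF _ n] in auto)
  then show ?thesis unfolding integral_unique[OF hv] integral_unique[OF hb] by (simp add: mult.commute)
qed

text \<open>Absolute continuity uniformly in k: choose n to make the last term small, then the total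
  length to make the first small. It is stated for whole families of intervals so that it survives
  the passage to a pointwise limit.\<close>

lemma sum_increments_le:
  assumes E: "E division_of T" "T \<subseteq> {a..b}" and n: "0 < n"
  shows "(\<Sum>I\<in>E. norm (\<xi> k (Sup I) - \<xi> k (Inf I))) \<le> R n * (\<Sum>I\<in>E. Sup I - Inf I) + total / real n"
proof -
  note I = division_of_real_interval[OF E(1)]
  have "(\<Sum>I\<in>E. norm (\<xi> k (Sup I) - \<xi> k (Inf I))) \<le> (\<Sum>I\<in>E. R n * (Sup I - Inf I) + integral I (rate k) / real n)"
  proof (rule sum_mono)
    fix J assume J: "J \<in> E"
    have "integral J (rate k) = integral {Inf J..Sup J} (rate k)"
      using arg_cong[OF I(1)[OF J], of "\<lambda>S. integral S (rate k)"] .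
    moreover have "a \<le> Inf J" "Sup J \<le> b" using I(3,4)[OF J] E(2) by auto
    ultimately show "norm (\<xi> k (Sup J) - \<xi> k (Inf J)) \<le> R n * (Sup J - Inf J) + integral J (rate k) / real n"
      using norm_increment_le[OF _ I(2)[OF J] _ n, of k] by simp
  qed
  also have "\<dots> = R n * (\<Sum>I\<in>E. Sup I - Inf I) + (\<Sum>I\<in>E. integral I (rate k)) / real n"
    by (simp add: sum.distrib sum_distrib_left sum_divide_distrib)
  also have "(\<Sum>I\<in>E. integral I (rate k)) = integral T (rate k)"
    by (rule integral_combine_division_topdown[symmetric, OF integrable_on_subdivision[OF E(1) rate_integrable E(2)] E(1)])
  also have "integral T (rate k) \<le> integral {a..b} (rate k)"
    by (rule integral_subset_le[OF E(2) integrable_on_subdivision[OF E(1) rate_integrable E(2)] rate_integrable]) (use rate_nonneg in auto)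
  also have "\<dots> \<le> total" by (rule rate_total)
  finally show ?thesis using n by (simp add: divide_right_mono)
qed

lemma small_total:
  assumes "e > 0"
  obtains n where "0 < n" "total / real n < e"
proof -
  obtain n0 :: nat where n0: "total / e < real n0" using reals_Archimedean2 by blast
  show thesis
  proof (rule that[of "Suc n0"])
    have "total < real n0 * e" using n0 assms by (simp add: pos_divide_less_eq)
    also have "\<dots> \<le> real (Suc n0) * e" using assms by simp
    finally show "total / real (Suc n0) < e" by (simp add: pos_divide_less_eq mult.commute)
  qed simp
qed

lemma integral_velocity_bound:
  "integral {a..b} (\<lambda>s. norm (velocity a b (\<xi> k) s)) \<le> R 1 * (b - a) + total"
proof -
  have hb: "((\<lambda>s. R 1 + rate k s / real 1) has_integral (b - a) *\<^sub>R R 1 + integral {a..b} (rate k) / real 1) {a..b}"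
    using has_integral_const_real[of "R 1" a b] ab
    by (intro has_integral_add has_integral_divide integrable_integral rate_integrable) auto
  have "(\<lambda>s. norm (velocity a b (\<xi> k) s)) integrable_on {a..b}"
    using velocity_integral(1)[OF AC[of k]] by (auto simp: absolutely_integrable_on_def)
  then have "integral {a..b} (\<lambda>s. norm (velocity a b (\<xi> k) s)) \<le> integral {a..b} (\<lambda>s. R 1 + rate k s / real 1)"
    by (rule integral_le[OF _ has_integral_integrable[OF hb]]) (rule velocity_le, auto)
  then show ?thesis unfolding integral_unique[OF hb] using rate_total[of k] by (simp add: mult.commute)
qed

text \<open>The increment bound for a single interval gives equicontinuity and boundedness for the
  Arzela-Ascoli theorem; the bound for families gives absolute continuity of the limit.\<close>

lemma convergent_subsequence:
  obtains \<xi>0 \<rho> where "strict_mono (\<rho> :: nat \<Rightarrow> nat)" "uniform_limit {a..b} (\<lambda>k. \<xi> (\<rho> k)) \<xi>0 sequentially"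
    "\<xi>0 \<in> curves a b x y"
proof -
  have half: "c * (e / (2 * c)) = e / 2" if "c > 0" for c e :: real using that by simp
  have \<xi>a: "\<xi> k a = x" "\<xi> k b = y" for k using \<xi>[of k] by (auto simp: curves_def)
  obtain \<xi>0 and \<rho> :: "nat \<Rightarrow> nat" where g: "continuous_on {a..b} \<xi>0" "strict_mono \<rho>"
    "\<And>e. 0 < e \<Longrightarrow> \<exists>N. \<forall>n t. n \<ge> N \<and> t \<in> {a..b} \<longrightarrow> norm (\<xi> (\<rho> n) t - \<xi>0 t) < e"
  proof (rule Arzela_Ascoli[of "{a..b}" \<xi> "norm x + (R 1 * (b - a) + total)"])
    fix k t assume t: "t \<in> {a..b}"
    have "norm (\<xi> k t - \<xi> k a) \<le> R 1 * (t - a) + integral {a..t} (rate k) / real 1"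
      using norm_increment_le[of a t 1 k] t by auto
    also have "integral {a..t} (rate k) \<le> total" using t by (intro integral_rate_le) auto
    also have "R 1 * (t - a) \<le> R 1 * (b - a)" using R t by (intro mult_left_mono) auto
    finally have "norm (\<xi> k t - \<xi> k a) \<le> R 1 * (b - a) + total" by simp
    then show "norm (\<xi> k t) \<le> norm x + (R 1 * (b - a) + total)"
      using norm_triangle_sub[of "\<xi> k t" "\<xi> k a"] by (simp add: \<xi>a)
  next
    fix s e :: real assume s: "s \<in> {a..b}" and e: "0 < e"
    obtain n where n: "0 < n" "total / real n < e / 2" using small_total[of "e / 2"] e by auto
    have Rn: "0 < R n + 1" using R[of n] by simp
    show "\<exists>d>0. \<forall>k t. t \<in> {a..b} \<and> norm (s - t) < d \<longrightarrow> norm (\<xi> k s - \<xi> k t) < e"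
    \<comment> \<open>With \<open>n\<close> fixed by the rate term, this radius leaves at most e / 2
      for the term with R n; adding 1 covers R n = 0.\<close>
    proof (intro exI[of _ "e / (2 * (R n + 1))"] conjI allI impI)
      show "0 < e / (2 * (R n + 1))" using e Rn by simp
      have key: "norm (\<xi> k q - \<xi> k p) < e" if "a \<le> p" "p \<le> q" "q \<le> b" "q - p < e / (2 * (R n + 1))" for k p q
      proof -
        have "integral {p..q} (rate k) / real n \<le> total / real n"
          using that by (intro divide_right_mono integral_rate_le) auto
        moreover have "R n * (q - p) \<le> (R n + 1) * (e / (2 * (R n + 1)))"
          using that R[of n] by (intro mult_mono) auto
        moreover have "(R n + 1) * (e / (2 * (R n + 1))) = e / 2" by (rule half[OF Rn])
        ultimately show ?thesis using norm_increment_le[OF that(1-3) n(1), of k] n(2) by linarith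
      qed
      fix k t assume t: "t \<in> {a..b} \<and> norm (s - t) < e / (2 * (R n + 1))"
      then show "norm (\<xi> k s - \<xi> k t) < e"
        using key[of t s k] key[of s t k] s by (cases "s \<le> t") (auto simp: norm_minus_commute)
    qed
  qed (auto intro: that)
  have unif: "uniform_limit {a..b} (\<lambda>k. \<xi> (\<rho> k)) \<xi>0 sequentially"
    unfolding uniform_limit_iff eventually_sequentially dist_norm using g(3) by blast
  have ptw: "(\<lambda>k. \<xi> (\<rho> k) t) \<longlonglongrightarrow> \<xi>0 t" if "t \<in> {a..b}" for t
    using tendsto_uniform_limitI[OF unif that] .
  have "absolutely_continuous_on {a..b} \<xi>0"
    unfolding absolutely_continuous_on_def
  proof (intro allI impI)
    fix e :: real assume e: "e > 0"
    obtain n where n: "0 < n" "total / real n < e / 2" using small_total[of "e / 2"] e by auto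
    have Rn: "0 < R n + 1" using R[of n] by simp
    show "\<exists>\<delta>>0. \<forall>E T. E division_of T \<and> T \<subseteq> {a..b} \<and> (\<Sum>I\<in>E. Sup I - Inf I) < \<delta> \<longrightarrow>
       (\<Sum>I\<in>E. norm (\<xi>0 (Sup I) - \<xi>0 (Inf I))) < e"
    proof (intro exI[of _ "e / (2 * (R n + 1))"] conjI allI impI)
      show "0 < e / (2 * (R n + 1))" using e Rn by simp
      fix E T assume *: "E division_of T \<and> T \<subseteq> {a..b} \<and> (\<Sum>I\<in>E. Sup I - Inf I) < e / (2 * (R n + 1))"
      then have E: "E division_of T" "T \<subseteq> {a..b}" by auto
      note I = division_of_real_interval[OF E(1)]
      \<comment> \<open>For a fixed finite family pointwise convergence of the curves is enough, and
        the threshold on its length does not depend on k.\<close>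
      have "(\<lambda>k. \<Sum>I\<in>E. norm (\<xi> (\<rho> k) (Sup I) - \<xi> (\<rho> k) (Inf I))) \<longlonglongrightarrow> (\<Sum>I\<in>E. norm (\<xi>0 (Sup I) - \<xi>0 (Inf I)))"
        by (intro tendsto_sum tendsto_norm tendsto_diff ptw subsetD[OF E(2)] I(3,4))
      moreover have "(\<Sum>I\<in>E. norm (\<xi> (\<rho> k) (Sup I) - \<xi> (\<rho> k) (Inf I))) \<le> e / 2 + total / real n" for k
      proof -
        have "R n * (\<Sum>I\<in>E. Sup I - Inf I) \<le> (R n + 1) * (e / (2 * (R n + 1)))"
          using * R[of n] I(2) by (intro mult_mono sum_nonneg) auto
        moreover have "(R n + 1) * (e / (2 * (R n + 1))) = e / 2" by (rule half[OF Rn])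
        ultimately show ?thesis using sum_increments_le[OF E n(1), of "\<rho> k"] by linarith
      qed
      ultimately have "(\<Sum>I\<in>E. norm (\<xi>0 (Sup I) - \<xi>0 (Inf I))) \<le> e / 2 + total / real n"
        by (intro LIMSEQ_le_const2) auto
      then show "(\<Sum>I\<in>E. norm (\<xi>0 (Sup I) - \<xi>0 (Inf I))) < e" using n(2) by linarith
    qed
  qed
  moreover have "\<xi>0 a = x" "\<xi>0 b = y"
    using LIMSEQ_unique[OF ptw[of a]] LIMSEQ_unique[OF ptw[of b]] ab by (auto simp: \<xi>a)
  ultimately show thesis using that[OF g(2) unif] by (simp add: curves_def)
qed

end

section \<open>Passage to the limit and existence of a minimizer\<close>

context regular_lagrangian
begin

text \<open>Uniform convergence does not by itself make the limit curve admissible, because L along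
  it might fail to be integrable. Integrability comes from the semicontinuity theorem on the whole
  interval; its inequality on every initial interval supplies the supersolution for the
  comparison.\<close>

lemma limit_curve:
  assumes \<xi>: "\<And>k. \<xi> k \<in> curves a b x y" and w: "\<And>k. caratheodory_solution L a b u (\<xi> k) (w k)"
    and w_bound: "\<And>k t. t \<in> {a..b} \<Longrightarrow> \<bar>w k t\<bar> \<le> M" and lim: "(\<lambda>k. w k b) \<longlonglongrightarrow> m"
  obtains \<xi>0 where "\<xi>0 \<in> admissible L a b u x y" "\<And>w0. caratheodory_solution L a b u \<xi>0 w0 \<Longrightarrow> w0 b \<le> m"
proof -
  interpret bs: bounded_solutions L P a b K C R u M x y \<xi> w
    by unfold_locales (use \<xi> w w_bound in auto)
  obtain \<xi>0 \<rho> where \<rho>: "strict_mono (\<rho> :: nat \<Rightarrow> nat)" and unif: "uniform_limit {a..b} (\<lambda>k. \<xi> (\<rho> k)) \<xi>0 sequentially"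
    and \<xi>0: "\<xi>0 \<in> curves a b x y"
    using bs.convergent_subsequence by blast
  have M: "0 \<le> M" using w_bound[of a 0] ab by (auto intro: order_trans[OF abs_ge_zero])
  have AC0: "absolutely_continuous_on {a..b} \<xi>0" using \<xi>0 by (simp add: curves_def)
  define v0 where "v0 = velocity a b \<xi>0"
  define v where "v k = velocity a b (\<xi> (\<rho> k))" for k
  define uk where "uk k = w (\<rho> k)" for k
  have uk: "caratheodory_solution L a b u (\<xi> (\<rho> k)) (uk k)" for k unfolding uk_def by (rule w)
  have uk_bound: "\<bar>uk k t\<bar> \<le> M" if "t \<in> {a..b}" for k t unfolding uk_def by (rule w_bound[OF that])
  have uk_meas: "uk k \<in> borel_measurable (lebesgue_on {a..b})" for k
    by (intro continuous_imp_measurable_on_sets_lebesgue solution_continuous[OF uk]) auto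
  define z where "z = lower_limit uk"
  have z_bound: "\<bar>z t\<bar> \<le> M" if "t \<in> {a..b}" for t
    unfolding z_def by (rule abs_lower_limit_le[where u = uk and t = t, OF uk_bound[OF that]])
  have z_meas: "z \<in> borel_measurable (lebesgue_on {a..b})"
    unfolding z_def by (rule tail_inf_measurable(2)[where u = uk, OF uk_meas uk_bound])
  have curve_cont: "continuous_on {a..b} (\<xi> (\<rho> k))" "continuous_on {a..b} \<xi>0" for k
    using AC_imp_continuous_on bs.AC AC0 by blast+
  have v_abs: "v k absolutely_integrable_on {a..b}" "v0 absolutely_integrable_on {a..b}" for k
    unfolding v_def v0_def using velocity_integral(1) bs.AC AC0 by blast+
  let ?H = "\<lambda>s. weighted_integrand s (\<xi>0 s) (v0 s) (z s)"
  have lsc: "?H integrable_on {a..t} \<and>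
      integral {a..t} ?H \<le> weight t * z t - u"
    if t: "t \<in> {a..b}" for t
  proof -
    have t': "a \<le> t" "t \<le> b" using t by auto
    have sub: "{a..t} \<subseteq> {a..b}" using t' by auto
    have hw: "((\<lambda>s. weighted_integrand s (\<xi> (\<rho> k) s) (v k s) (uk k s)) has_integral weight t * uk k t - u) {a..t}" for k
      using weighted_solution_integral[OF uk, of a t k] t' solution_initial[OF uk, of k]
      by (simp add: weighted_integrand_def v_def weight_def)
    have vn: "(\<lambda>s. norm (v k s)) integrable_on {a..b}" for k
      using v_abs(1)[of k] by (auto simp: absolutely_integrable_on_def)
    \<comment> \<open>At a fixed t the bound with the exact lower limit might hold for no index, so
      it is relaxed by \<open>e\<close>, which is removed afterwards.\<close>
    have cc: "convergent_curves weighted_integrand weighted_gradient a t (weight b * (C + 2 * K * M)) (weight b * (2 * K)) M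
        (\<lambda>k. \<xi> (\<rho> k)) v \<xi>0 v0 uk (R 1 * (b - a) + bs.total) (weight t * (z t + e) - u)" if e: "e > 0" for e
    proof (intro convergent_curves.intro convex_integrand_weighted[OF t' M] convergent_curves_axioms.intro)
      fix k
      show "continuous_on {a..t} (\<xi> (\<rho> k))" "continuous_on {a..t} \<xi>0"
        using curve_cont sub continuous_on_subset by blast+
      show "uniform_limit {a..t} (\<lambda>k. \<xi> (\<rho> k)) \<xi>0 sequentially" by (rule uniform_limit_on_subset[OF unif sub])
      show "v k absolutely_integrable_on {a..t}" "v0 absolutely_integrable_on {a..t}"
        using set_integrable_subset[OF v_abs(1) _ sub] set_integrable_subset[OF v_abs(2) _ sub] by auto
      have "integral {a..t} (\<lambda>s. norm (v k s)) \<le> integral {a..b} (\<lambda>s. norm (v k s))"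
        by (rule integral_subset_le[OF sub integrable_on_subinterval[OF vn sub] vn]) auto
      also have "\<dots> \<le> R 1 * (b - a) + bs.total" unfolding v_def by (rule bs.integral_velocity_bound)
      finally show "integral {a..t} (\<lambda>s. norm (v k s)) \<le> R 1 * (b - a) + bs.total" .
      show "uk k \<in> borel_measurable (lebesgue_on {a..t})"
        by (intro continuous_imp_measurable_on_sets_lebesgue continuous_on_subset[OF solution_continuous[OF uk] sub]) auto
      show "(\<lambda>s. weighted_integrand s (\<xi> (\<rho> k) s) (v k s) (uk k s)) integrable_on {a..t}"
        using hw by (rule has_integral_integrable)
      show "\<bar>uk k s\<bar> \<le> M" if "s \<in> {a..t}" for s using uk_bound that sub by blast
      show "(\<lambda>k. integral {a..s} (v k)) \<longlonglongrightarrow> integral {a..s} v0" if s: "s \<in> {a..t}" for s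
      proof -
        have s': "s \<in> {a..b}" "a \<in> {a..b}" using s sub ab by auto
        have "integral {a..s} (v k) = \<xi> (\<rho> k) s - \<xi> (\<rho> k) a" for k
          unfolding v_def using s' by (intro integral_unique velocity_integral(2)[OF bs.AC]) auto
        moreover have "integral {a..s} v0 = \<xi>0 s - \<xi>0 a"
          unfolding v0_def using s' by (intro integral_unique velocity_integral(2)[OF AC0]) auto
        ultimately show ?thesis
          using tendsto_diff[OF tendsto_uniform_limitI[OF unif s'(1)] tendsto_uniform_limitI[OF unif s'(2)]] by simp
      qed
      \<comment> \<open>Otherwise all late states at t exceed the lower limit by at least
        \<open>e\<close>, and so does one of the tail infima, which is impossible.\<close>
      show "\<exists>\<^sub>F k in sequentially. integral {a..t} (\<lambda>s. weighted_integrand s (\<xi> (\<rho> k) s) (v k s) (uk k s)) \<le> weight t * (z t + e) - u"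
        unfolding integral_unique[OF hw]
      proof (rule ccontr)
        assume "\<not> (\<exists>\<^sub>F k in sequentially. weight t * uk k t - u \<le> weight t * (z t + e) - u)"
        then have "\<forall>\<^sub>F k in sequentially. z t + e \<le> uk k t"
          unfolding not_frequently
        proof (rule eventually_mono)
          fix k assume "\<not> weight t * uk k t - u \<le> weight t * (z t + e) - u"
          then have "weight t * (z t + e) \<le> weight t * uk k t" by simp
          then show "z t + e \<le> uk k t" using weight_pos[of t] by simp
        qed
        then obtain m where m: "\<And>k. m \<le> k \<Longrightarrow> z t + e \<le> uk k t" unfolding eventually_sequentially by blast
        have "z t + e \<le> tail_inf uk m t" by (rule tail_inf_geI[where u = uk and t = t, OF uk_bound[OF t] m])
        also have "\<dots> \<le> z t" unfolding z_def by (rule tail_inf_le_lower_limit[where u = uk and t = t, OF uk_bound[OF t]])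
        finally show False using e by simp
      qed
    qed
    note semi = convergent_curves.lower_semicontinuity[OF cc, folded z_def]
    have "integral {a..t} ?H \<le> (weight t * z t - u) + e" if e: "e > 0" for e
      using semi(2)[of "e / weight t"] e weight_pos[of t] by (simp add: distrib_left)
    then have "integral {a..t} ?H \<le> weight t * z t - u"
      by (rule field_le_epsilon)
    then show ?thesis using semi(1)[of 1] by simp
  qed
  have v0_meas: "v0 \<in> borel_measurable (lebesgue_on {a..b})" by (rule absolutely_integrable_imp_measurable[OF v_abs(2)])
  \<comment> \<open>An integrable majorant is obtained from \<open>?H\<close>: the state argument is
    moved from \<open>z\<close> to 0 by the Lipschitz bound.\<close>
  have "(\<lambda>s. L s (\<xi>0 s) (v0 s) 0) absolutely_integrable_on {a..b}"
  proof (rule measurable_bounded_by_integrable_imp_absolutely_integrable)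
    show "(\<lambda>s. L s (\<xi>0 s) (v0 s) 0) \<in> borel_measurable (lebesgue_on {a..b})"
      by (rule L_measurable[OF curve_cont(2) v0_meas]) simp
    show "(\<lambda>s. ?H s + weight b * (2 * C + 4 * K * M)) integrable_on {a..b}"
      using lsc[of b] ab by (intro HK_integrable_add integrable_const_ivl) auto
    fix s assume s: "s \<in> {a..b}"
    note KM = K_mult_bounds[OF z_bound[OF s]]
    \<comment> \<open>The shift C + 2 K M makes \<open>g\<close> nonnegative, so multiplying it by
      the weight only enlarges it. It is needed once more to pass from L at \<open>z\<close> to the
      absolute value of L at 0; hence the constant 2 C + 4 K M in the majorant.\<close>
    define g where "g = L s (\<xi>0 s) (v0 s) (z s) + K * z s + (C + 2 * K * M)"
    have lip: "\<bar>L s (\<xi>0 s) (v0 s) 0 - L s (\<xi>0 s) (v0 s) (z s)\<bar> \<le> K * \<bar>z s\<bar>"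
      using L_lip[OF s, of "\<xi>0 s" "v0 s" 0 "z s"] by simp
    have "0 \<le> g"
      using L_ge[OF s, of "z s" "\<xi>0 s" "v0 s"] KM unfolding g_def by linarith
    moreover have "0 \<le> K * M" using K M by simp
    then have "norm (L s (\<xi>0 s) (v0 s) 0) \<le> g + (C + 2 * K * M)"
      using lip L_lower[OF s, of "\<xi>0 s" "v0 s"] KM C unfolding g_def real_norm_def by linarith
    moreover have "1 * g \<le> weight s * g" using weight_ge_1[of s] s \<open>0 \<le> g\<close> by (intro mult_right_mono) auto
    moreover have "weight s * g = ?H s + weight s * (C + 2 * K * M)"
      by (simp add: g_def weighted_integrand_def algebra_simps)
    moreover have "weight s * (C + 2 * K * M) \<le> weight b * (C + 2 * K * M)"
      using weight_mono[of s b] s C K M by (intro mult_right_mono) auto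
    moreover have "1 * (C + 2 * K * M) \<le> weight b * (C + 2 * K * M)"
      using weight_ge_1[of b] ab C K M by (intro mult_right_mono) auto
    ultimately show "norm (L s (\<xi>0 s) (v0 s) 0) \<le> ?H s + weight b * (2 * C + 4 * K * M)"
      by (simp add: algebra_simps)
  qed simp
  then have "\<exists>w0. caratheodory_solution L a b u \<xi>0 w0" unfolding v0_def by (rule solution_exists[OF AC0])
  then have adm: "\<xi>0 \<in> admissible L a b u x y" using \<xi>0 by (simp add: admissible_def)
  have bb: "b \<in> {a..b}" using ab by simp
  have "w0 b \<le> m" if w0: "caratheodory_solution L a b u \<xi>0 w0" for w0
  proof -
    have "w0 b \<le> z b"
      by (rule solution_le_supersolution[OF w0 z_meas z_bound _ _ bb]) (use lsc in \<open>auto simp: v0_def\<close>)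
    \<comment> \<open>At time b the states converge by hypothesis, and the k-th tail infimum lies
      below the k-th state.\<close>
    also have "z b \<le> m"
    proof (rule LIMSEQ_le[OF _ LIMSEQ_subseq_LIMSEQ[OF lim \<rho>]])
      show "(\<lambda>k. tail_inf uk k b) \<longlonglongrightarrow> z b"
        unfolding z_def by (rule tail_inf_tendsto[where u = uk and t = b, OF uk_bound[OF bb]])
      show "\<exists>N. \<forall>k\<ge>N. tail_inf uk k b \<le> ((\<lambda>k. w k b) \<circ> \<rho>) k"
        using tail_inf_le[where u = uk and t = b, OF uk_bound[OF bb] order_refl] by (auto simp: uk_def)
    qed
    finally show ?thesis .
  qed
  then show thesis using that[OF adm] by blast
qed

theorem minimizer_exists:
  "\<exists>\<xi>\<in>admissible L a b u x y. \<forall>\<eta>\<in>admissible L a b u x y. J L a b u \<xi> \<le> J L a b u \<eta>"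
proof -
  define S where "S = (\<lambda>\<eta>. u_sol L a b u \<eta> b) ` admissible L a b u x y"
  have bb: "b \<in> {a..b}" using ab by simp
  \<comment> \<open>The constant does not depend on the curve: this yields both that the infimum is
    finite and a bound common to the minimizing sequence.\<close>
  obtain M1 where M1: "\<And>\<xi> w t. caratheodory_solution L a b u \<xi> w \<Longrightarrow> t \<in> {a..b} \<Longrightarrow> - M1 \<le> w t"
    "\<And>\<xi> w t. caratheodory_solution L a b u \<xi> w \<Longrightarrow> t \<in> {a..b} \<Longrightarrow>
      w t \<le> weight b * \<bar>w b\<bar> + (C + 2 * K * M1) * weight b * (b - a)"
    using solution_bounds by blast
  have ne: "S \<noteq> {}" using straight_line_admissible by (simp add: S_def)
  have bdd: "bdd_below S"
    unfolding S_def using M1(1)[OF J_eq(1) bb] by (auto intro!: bdd_belowI[of _ "- M1"])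
  define m where "m = Inf S"
  have "\<exists>\<eta>. \<eta> \<in> admissible L a b u x y \<and> u_sol L a b u \<eta> b < m + inverse (real (Suc k))" for k
  proof -
    have "Inf S < m + inverse (real (Suc k))" by (simp add: m_def add_pos_nonneg)
    from cInf_lessD[OF ne this] show ?thesis by (auto simp: S_def)
  qed
  then obtain \<xi> where \<xi>: "\<And>k. \<xi> k \<in> admissible L a b u x y"
    "\<And>k. u_sol L a b u (\<xi> k) b < m + inverse (real (Suc k))" by metis
  define w where "w k = u_sol L a b u (\<xi> k)" for k
  have w: "caratheodory_solution L a b u (\<xi> k) (w k)" for k unfolding w_def by (rule J_eq(1)[OF \<xi>(1)])
  have m_le: "m \<le> u_sol L a b u \<eta> b" if "\<eta> \<in> admissible L a b u x y" for \<eta>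
    unfolding m_def using that by (intro cInf_lower bdd) (simp add: S_def)
  have wb: "m \<le> w k b" "w k b \<le> m + inverse (real (Suc k))" for k
    using m_le[OF \<xi>(1)[of k]] \<xi>(2)[of k] by (simp_all add: w_def)
  have lim: "(\<lambda>k. w k b) \<longlonglongrightarrow> m"
  proof (rule tendsto_sandwich[of "\<lambda>_. m" _ _ "\<lambda>k. m + inverse (real (Suc k))"])
    show "(\<lambda>k. m + inverse (real (Suc k))) \<longlonglongrightarrow> m"
      using tendsto_add[OF tendsto_const LIMSEQ_inverse_real_of_nat, of m] by simp
  qed (use wb in auto)
  \<comment> \<open>The terminal states lie within 1 of the infimum m, so |m| + 1 replaces the
    terminal value in the upper bound, uniformly in k.\<close>
  define M where "M = max M1 (weight b * (\<bar>m\<bar> + 1) + (C + 2 * K * M1) * weight b * (b - a))"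
  have "\<bar>w k t\<bar> \<le> M" if t: "t \<in> {a..b}" for k t
  proof -
    have "inverse (real (Suc k)) \<le> 1" by (simp add: inverse_eq_divide)
    then have "\<bar>w k b\<bar> \<le> \<bar>m\<bar> + 1" using wb[of k] by linarith
    then have "weight b * \<bar>w k b\<bar> \<le> weight b * (\<bar>m\<bar> + 1)" using weight_pos[of b] by (intro mult_left_mono) auto
    then show ?thesis using M1[OF w t, of k] unfolding M_def by (simp add: abs_le_iff max_def)
  qed
  from limit_curve[OF _ w this lim] \<xi>(1)
  obtain \<xi>0 where \<xi>0: "\<xi>0 \<in> admissible L a b u x y" "\<And>w0. caratheodory_solution L a b u \<xi>0 w0 \<Longrightarrow> w0 b \<le> m"
    unfolding admissible_def by blast
  show ?thesis
  proof (intro bexI[OF _ \<xi>0(1)] ballI)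
    fix \<eta> assume \<eta>: "\<eta> \<in> admissible L a b u x y"
    have "u_sol L a b u \<xi>0 b \<le> u_sol L a b u \<eta> b"
      using \<xi>0(2)[OF J_eq(1)[OF \<xi>0(1)]] m_le[OF \<eta>] by linarith
    then show "J L a b u \<xi>0 \<le> J L a b u \<eta>" by (simp add: J_eq(2)[OF \<xi>0(1)] J_eq(2)[OF \<eta>])
  qed
qed

end

theorem proposition1p2:
  fixes L :: "real \<Rightarrow> real^'n::finite \<Rightarrow> real^'n \<Rightarrow> real \<Rightarrow> real"
    and x y :: "real^'n" and a b u :: real
  assumes "C1 (\<lambda>(t, x, v, r). L t x v r)"
    and "L1 L" and "L2 L" and "L3 L"
    and "a < b"
  shows "\<exists>\<xi>\<in>admissible L a b u x y. \<forall>\<eta>\<in>admissible L a b u x y. J L a b u \<xi> \<le> J L a b u \<eta>"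
proof -
  obtain P where P: "continuous_on UNIV (\<lambda>(t, x, v, r). P t x v r :: real^'n)"
    "\<And>t x p q r. L t x p r + P t x p r \<bullet> (q - p) \<le> L t x q r"
    using lagrangian_subgradient[OF assms(1,2)] by blast
  obtain K where K: "K > 0" "\<And>t x v r s. t \<in> {a..b} \<Longrightarrow> \<bar>L t x v r - L t x v s\<bar> \<le> K * \<bar>r - s\<bar>"
    using lagrangian_Lipschitz[OF assms(1,4,5)] by blast
  obtain C R where C: "C \<ge> 0" "\<And>t x v. t \<in> {a..b} \<Longrightarrow> - C \<le> L t x v 0" "\<And>n::nat. 0 \<le> R n"
    "\<And>n t x v. t \<in> {a..b} \<Longrightarrow> 0 < n \<Longrightarrow> norm v \<le> R n + (L t x v 0 + C) / real n"
    using lagrangian_coercive[OF assms(1,3,5)] by blast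
  interpret regular_lagrangian L P a b K C R
    using assms(5) C1_imp_continuous[OF assms(1)] P K C by unfold_locales auto
  show ?thesis by (rule minimizer_exists)
qed

end
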